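(* Assume that $\sum_{n\ge1}\beta_n^\alpha/\gamma_n<\infty$ and that $F:H\to H$ is Lipschitz continuous and bounded. Then there exists a unique mild solution $(X_t^x)$ to the equation $$dX_t=AX_t\,dt+F(X_t)\,dt+dZ_t,\qquad X_0=x\in H .$$ Moreover $(X_t^x)$ is a Markov-Feller process.
   Context: Let $H$ be a real separable (infinite-dimensional) Hilbert space with a fixed orthonormal basis $(e_n)_{n\ge1}$. Fix $\alpha\in(0,2)$. $(Z^n_t)_{t\ge0}$, $n\ge1$, are independent real normalized symmetric $\alpha$-stable Lévy processes, $\mathbb E[e^{ihZ^n_t}]=e^{-t|h|^\alpha}$, on a stochastic basis $(\Omega,\mathcal F,(\mathcal F_t)_{t\ge0},\mathbb P)$ satisfying the usual assumptions (adapted, with the increments of $(Z^n)_{n\ge 1}$ after time $s$ independent of $\mathcal F_s$). $(\beta_n)$ is a sequence of positive reals, $Z_t=\sum_n\beta_nZ_t^ne_n$ (a cylindrical $\alpha$-stable process). $A:D(A)\subset H\to H$ is self-adjoint with $e_n\in D(A)$, $Ae_n=-\gamma_ne_n$, $\gamma_n>0$ for all $n\ge 1$, and $\gamma_n\to+\infty$; $e^{tA}e_k=e^{-\gamma_kt}e_k$. Set $Z_A(t)=\int_0^te^{(t-s)A}dZ_s=\sum_{n\ge1}\big(\int_0^te^{-\gamma_n(t-s)}\beta_n\,dZ_s^n\big)e_n$, which is $H$-valued under $\sum_n\beta_n^\alpha/\gamma_n<\infty$ and has a predictable version, which is the one used. A mild solution is a predictable $H$-valued process $X=(X_t^x)$,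 depending on $x\in H$, such that for any $t\ge0$, $x\in H$, $\mathbb P$-a.s., $$X_t^x=e^{tA}x+\int_0^te^{(t-s)A}F(X_s^x)\,ds+Z_A(t).$$ Uniqueness is up to modification. Markov: $\mathbb E[f(X_{t+h}^x)\mid\mathcal F_t]=(P_hf)(X_t^x)$ a.s. for $t,h\ge0$ and bounded Borel $f$, with $P_hf(y)=\mathbb E[f(X_h^y)]$. Feller: $x\mapsto\mathbb E[f(X_t^x)]$ is continuous on $H$ for every $t\ge0$ and every bounded continuous $f:H\to\mathbb R$. *)

theory Defs
  imports "HOL-Probability.Probability"
begin

definition orthonormal_basis :: "(nat \<Rightarrow> 'h::real_inner) \<Rightarrow> bool" where
  "orthonormal_basis e \<longleftrightarrow>
     (\<forall>i j. e i \<bullet> e j = (if i = j then 1 else 0)) \<and> closure (span (range e)) = UNIV"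

text \<open>Unbounded operators are pairs of a domain \<open>D\<close> and a total function \<open>A\<close>, of which only the
  values on \<open>D\<close> matter. The last conjunct says that the graph of the adjoint of \<open>A\<close> equals the graph
  of \<open>A\<close>.\<close>

definition self_adjoint_operator :: "'h::real_inner set \<Rightarrow> ('h \<Rightarrow> 'h) \<Rightarrow> bool" where
  "self_adjoint_operator D A \<longleftrightarrow>
     subspace D \<and> closure D = UNIV \<and>
     (\<forall>x\<in>D. \<forall>y\<in>D. A (x + y) = A x + A y) \<and> (\<forall>c. \<forall>x\<in>D. A (c *\<^sub>R x) = c *\<^sub>R A x) \<and>
     {(y, z). \<forall>x\<in>D. A x \<bullet> y = x \<bullet> z} = {(y, A y) | y. y \<in> D}"

definition c0_semigroup :: "(real \<Rightarrow> 'h::real_normed_vector \<Rightarrow> 'h) \<Rightarrow> bool" where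
  "c0_semigroup S \<longleftrightarrow>
     (\<forall>t\<ge>0. bounded_linear (S t)) \<and> S 0 = id \<and>
     (\<forall>s\<ge>0. \<forall>t\<ge>0. S (s + t) = S s \<circ> S t) \<and>
     (\<forall>x. ((\<lambda>t. S t x) \<longlongrightarrow> x) (at_right 0))"

definition has_generator ::
    "(real \<Rightarrow> 'h::real_normed_vector \<Rightarrow> 'h) \<Rightarrow> 'h set \<Rightarrow> ('h \<Rightarrow> 'h) \<Rightarrow> bool" where
  "has_generator S D A \<longleftrightarrow>
     (\<forall>x y. ((\<lambda>t. (S t x - x) /\<^sub>R t) \<longlongrightarrow> y) (at_right 0) \<longleftrightarrow> x \<in> D \<and> y = A x)"

text \<open>\<open>exp_semigroup D A t\<close> is \<open>e\<^sup>t\<^sup>A\<close>. A \<open>C\<^sub>0\<close>-semigroup is determined on \<open>t \<ge> 0\<close> by its generator, and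
  values at \<open>t < 0\<close> are never used.\<close>

definition exp_semigroup ::
    "'h::real_normed_vector set \<Rightarrow> ('h \<Rightarrow> 'h) \<Rightarrow> real \<Rightarrow> 'h \<Rightarrow> 'h" where
  "exp_semigroup D A = (SOME S. c0_semigroup S \<and> has_generator S D A)"

text \<open>Time is \<open>[0, \<infinity>)\<close>: everything indexed by \<open>real\<close> below is constrained at nonnegative times only.
  The last two conjuncts are completeness and right-continuity.\<close>

definition usual_filtration :: "'w measure \<Rightarrow> (real \<Rightarrow> 'w measure) \<Rightarrow> bool" where
  "usual_filtration M \<F> \<longleftrightarrow>
     (\<forall>t\<ge>0. subalgebra M (\<F> t)) \<and> (\<forall>s\<ge>0. \<forall>t\<ge>s. sets (\<F> s) \<subseteq> sets (\<F> t)) \<and>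
     (\<forall>N\<in>null_sets M. \<forall>B. B \<subseteq> N \<longrightarrow> B \<in> sets (\<F> 0)) \<and>
     (\<forall>t\<ge>0. sets (\<F> t) = (\<Inter>s\<in>{t<..}. sets (\<F> s)))"

definition predictable_sigma :: "'w measure \<Rightarrow> (real \<Rightarrow> 'w measure) \<Rightarrow> (real \<times> 'w) measure" where
  "predictable_sigma M \<F> = sigma ({0..} \<times> space M)
     ({{s<..t} \<times> B | s t B. 0 \<le> s \<and> s < t \<and> B \<in> sets (\<F> s)} \<union> {{0} \<times> B | B. B \<in> sets (\<F> 0)})"

definition predictable ::
    "'w measure \<Rightarrow> (real \<Rightarrow> 'w measure) \<Rightarrow> (real \<Rightarrow> 'w \<Rightarrow> 'b::topological_space) \<Rightarrow> bool" where
  "predictable M \<F> X \<longleftrightarrow> (\<lambda>(t, \<omega>). X t \<omega>) \<in> borel_measurable (predictable_sigma M \<F>)"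

definition cadlag :: "(real \<Rightarrow> real) \<Rightarrow> bool" where
  "cadlag f \<longleftrightarrow>
     (\<forall>t\<ge>0. (f \<longlongrightarrow> f t) (at_right t)) \<and> (\<forall>t>0. \<exists>l. (f \<longlongrightarrow> l) (at_left t))"

definition levy_process :: "'w measure \<Rightarrow> (real \<Rightarrow> 'w \<Rightarrow> real) \<Rightarrow> bool" where
  "levy_process M Z \<longleftrightarrow>
     (\<forall>t\<ge>0. Z t \<in> borel_measurable M) \<and>
     (AE \<omega> in M. Z 0 \<omega> = 0) \<and>
     (\<forall>(n::nat) \<tau>. 0 \<le> \<tau> 0 \<and> (\<forall>i<n. \<tau> i \<le> \<tau> (Suc i)) \<longrightarrow>
        prob_space.indep_vars M (\<lambda>_. borel) (\<lambda>i \<omega>. Z (\<tau> (Suc i)) \<omega> - Z (\<tau> i) \<omega>) {..<n}) \<and>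
     (\<forall>s\<ge>0. \<forall>t\<ge>0. distr M borel (\<lambda>\<omega>. Z (s + t) \<omega> - Z s \<omega>) = distr M borel (Z t)) \<and>
     (\<forall>t\<ge>0. \<forall>\<epsilon>>0.
        ((\<lambda>s. measure M {\<omega>\<in>space M. \<epsilon> < \<bar>Z s \<omega> - Z t \<omega>\<bar>}) \<longlongrightarrow> 0) (at t within {0..})) \<and>
     (AE \<omega> in M. cadlag (\<lambda>t. Z t \<omega>))"

definition normalized_stable_process :: "'w measure \<Rightarrow> real \<Rightarrow> (real \<Rightarrow> 'w \<Rightarrow> real) \<Rightarrow> bool" where
  "normalized_stable_process M \<alpha> Z \<longleftrightarrow> levy_process M Z \<and>
     (\<forall>t\<ge>0. \<forall>h. char (distr M borel (Z t)) h = complex_of_real (exp (- t * \<bar>h\<bar> powr \<alpha>)))"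

text \<open>Independence of the processes is independence of their restrictions to \<open>[0, \<infinity>)\<close> as random
  elements of the product space of paths. The family in the last conjunct generates the \<open>\<sigma>\<close>-algebra of all
  increments after time \<open>s\<close>.\<close>

definition driving_stable_processes ::
    "'w measure \<Rightarrow> (real \<Rightarrow> 'w measure) \<Rightarrow> real \<Rightarrow> (nat \<Rightarrow> real \<Rightarrow> 'w \<Rightarrow> real) \<Rightarrow> bool" where
  "driving_stable_processes M \<F> \<alpha> Z \<longleftrightarrow>
     (\<forall>n. normalized_stable_process M \<alpha> (Z n)) \<and>
     prob_space.indep_vars M (\<lambda>_. Pi\<^sub>M {0..} (\<lambda>_. borel)) (\<lambda>n \<omega>. \<lambda>t\<in>{0..}. Z n t \<omega>) UNIV \<and>
     (\<forall>n. \<forall>t\<ge>0. Z n t \<in> borel_measurable (\<F> t)) \<and>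
     (\<forall>s\<ge>0. prob_space.indep_set M (sets (\<F> s))
        (sigma_sets (space M)
          {(\<lambda>\<omega>. Z n t \<omega> - Z n s \<omega>) -` B \<inter> space M | n t B. s \<le> t \<and> B \<in> sets borel}))"

text \<open>\<open>Y\<close> is (a version of) the stochastic integral of the deterministic continuous function \<open>f\<close>
  against \<open>Z\<close> over \<open>[0, t]\<close>: the limit in probability of the Riemann sums as the mesh of the
  partition tends to \<open>0\<close>.\<close>

definition has_stochastic_integral ::
    "'w measure \<Rightarrow> (real \<Rightarrow> 'w \<Rightarrow> real) \<Rightarrow> (real \<Rightarrow> real) \<Rightarrow> real \<Rightarrow> ('w \<Rightarrow> real) \<Rightarrow> bool" where
  "has_stochastic_integral M Z f t Y \<longleftrightarrow>
     Y \<in> borel_measurable M \<and>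
     (\<forall>\<epsilon>>0. \<exists>\<delta>>0. \<forall>(N::nat) \<tau>.
        \<tau> 0 = 0 \<and> \<tau> N = t \<and> (\<forall>i<N. \<tau> i \<le> \<tau> (Suc i) \<and> \<tau> (Suc i) - \<tau> i < \<delta>) \<longrightarrow>
        measure M {\<omega>\<in>space M.
          \<epsilon> < \<bar>(\<Sum>i<N. f (\<tau> i) * (Z (\<tau> (Suc i)) \<omega> - Z (\<tau> i) \<omega>)) - Y \<omega>\<bar>} < \<epsilon>)"

text \<open>\<open>ZA\<close> is a predictable version of the stochastic convolution \<open>Z\<^sub>A\<close>.\<close>

definition stochastic_convolution ::
    "'w measure \<Rightarrow> (real \<Rightarrow> 'w measure) \<Rightarrow> (nat \<Rightarrow> 'h::real_normed_vector) \<Rightarrow> (nat \<Rightarrow> real) \<Rightarrow>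
     (nat \<Rightarrow> real) \<Rightarrow> (nat \<Rightarrow> real \<Rightarrow> 'w \<Rightarrow> real) \<Rightarrow> (real \<Rightarrow> 'w \<Rightarrow> 'h) \<Rightarrow> bool" where
  "stochastic_convolution M \<F> e \<beta> \<gamma> Z ZA \<longleftrightarrow>
     predictable M \<F> ZA \<and>
     (\<forall>t\<ge>0. \<exists>I.
        (\<forall>n. has_stochastic_integral M (Z n) (\<lambda>s. exp (- \<gamma> n * (t - s)) * \<beta> n) t (I n)) \<and>
        (AE \<omega> in M. (\<lambda>n. I n \<omega> *\<^sub>R e n) sums ZA t \<omega>))"

text \<open>The choice of \<open>ZA\<close> is immaterial, since \<open>ZA t\<close> is unique up to a null set for each \<open>t\<close> and the
  equation is required almost surely for each fixed \<open>t\<close>.\<close>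

definition mild_solution ::
    "'w measure \<Rightarrow> (real \<Rightarrow> 'w measure) \<Rightarrow> (nat \<Rightarrow> 'h::{real_inner, banach, second_countable_topology}) \<Rightarrow>
     (nat \<Rightarrow> real) \<Rightarrow> (nat \<Rightarrow> real) \<Rightarrow> (nat \<Rightarrow> real \<Rightarrow> 'w \<Rightarrow> real) \<Rightarrow> 'h set \<Rightarrow> ('h \<Rightarrow> 'h) \<Rightarrow> ('h \<Rightarrow> 'h) \<Rightarrow>
     'h \<Rightarrow> (real \<Rightarrow> 'w \<Rightarrow> 'h) \<Rightarrow> bool" where
  "mild_solution M \<F> e \<beta> \<gamma> Z D A F x X \<longleftrightarrow>
     predictable M \<F> X \<and>
     (\<exists>ZA. stochastic_convolution M \<F> e \<beta> \<gamma> Z ZA \<and>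
        (\<forall>t\<ge>0. AE \<omega> in M.
           X t \<omega> = exp_semigroup D A t x
             + (LINT s:{0..t}|lborel. exp_semigroup D A (t - s) (F (X s \<omega>))) + ZA t \<omega>))"

definition transition_operator ::
    "'w measure \<Rightarrow> ('h \<Rightarrow> real \<Rightarrow> 'w \<Rightarrow> 'h) \<Rightarrow> real \<Rightarrow> ('h \<Rightarrow> real) \<Rightarrow> 'h \<Rightarrow> real" where
  "transition_operator M X t f x = (LINT \<omega>|M. f (X x t \<omega>))"

definition markov_process ::
    "'w measure \<Rightarrow> (real \<Rightarrow> 'w measure) \<Rightarrow> ('h::topological_space \<Rightarrow> real \<Rightarrow> 'w \<Rightarrow> 'h) \<Rightarrow> bool" where
  "markov_process M \<F> X \<longleftrightarrow>
     (\<forall>x. \<forall>t\<ge>0. \<forall>h\<ge>0. \<forall>f. f \<in> borel_measurable borel \<and> bounded (range f) \<longrightarrow>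
        (AE \<omega> in M. real_cond_exp M (\<F> t) (\<lambda>\<omega>'. f (X x (t + h) \<omega>')) \<omega>
           = transition_operator M X h f (X x t \<omega>)))"

definition feller_process ::
    "'w measure \<Rightarrow> ('h::topological_space \<Rightarrow> real \<Rightarrow> 'w \<Rightarrow> 'h) \<Rightarrow> bool" where
  "feller_process M X \<longleftrightarrow>
     (\<forall>t\<ge>0. \<forall>f. continuous_on UNIV f \<and> bounded (range f) \<longrightarrow>
        continuous_on UNIV (transition_operator M X t f))"

end

theory Submission
  imports Defs
begin

text \<open>
  By integration by parts the coordinates of \<open>Z\<^sub>A\<close> are pathwise functionals of the left-limit processes
  of the \<open>Z\<^sup>n\<close>. This makes them predictable and makes sense for every path. They are square
  summable almost surely, because \<open>E (1 - cos (h Y))\<close> is at most \<open>\<bar>h\<bar>\<^sup>\<alpha> \<beta>\<^sub>n\<^sup>\<alpha> / (\<alpha> \<gamma>\<^sub>n)\<close> for the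
  \<open>n\<close>-th coordinate \<open>Y\<close>, and averaging over a Gaussian \<open>h\<close> bounds \<open>E (1 - exp (- Y\<^sup>2 / 2))\<close>.

  Since the noise is additive, the equation is solved path by path by Picard iteration. The solution
  is a Lipschitz function of the initial value, which gives the Feller property, and Fubini's theorem
  reduces uniqueness up to modification to pathwise uniqueness. For the Markov property, the solution
  restarted at time \<open>t\<close> is the same measurable functional of its value at \<open>t\<close> and of the increments after \<open>t\<close>,
  which are independent of the past and have the law of the original noise.
\<close>

section \<open>Diagonal semigroups\<close>

text \<open>For \<open>\<alpha> < 2\<close> the noise has no variance, and for
  \<open>\<alpha> \<le> 1\<close> no mean, so its size is measured through characteristic functions.
  The other obstacle is null sets. Paths are cadlag only almost surely, and identities between
  processes hold almost surely at each fixed time, with an exceptional set that depends on the time.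
  Hence \<open>lim\<close>, \<open>suminf\<close> and the integral are applied to arbitrary paths,
  where they are total and measurable: no null set enters a definition, and predictability is
  checked for the functionals themselves. The left limit at \<open>t\<close> depends on times before
  \<open>t\<close> only, and it may replace \<open>Z t\<close> because a Levy process has no fixed
  jumps. On the pathwise side the statements tolerate null sets of times, since time integrals do
  not see them. Finally, \<open>exp_semigroup\<close> is a choice among the semigroups with
  generator \<open>A\<close>; it is pinned down by its values on the eigenvectors.\<close>

locale onb =
  fixes e :: "nat \<Rightarrow> 'h::{real_inner, banach}"
  assumes onb: "orthonormal_basis e"
begin

lemma inner_basis [simp]: "e i \<bullet> e j = (if i = j then 1 else 0)"
  using onb by (simp add: orthonormal_basis_def)

lemma norm_sum_basis_sq: "finite I \<Longrightarrow> (norm (\<Sum>i\<in>I. a i *\<^sub>R e i))\<^sup>2 = (\<Sum>i\<in>I. (a i)\<^sup>2)"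
proof -
  assume "finite I"
  then have "(\<Sum>j\<in>I. (a i *\<^sub>R e i) \<bullet> (a j *\<^sub>R e j)) = (a i)\<^sup>2" if "i \<in> I" for i
    using that sum.delta[of I i "\<lambda>j. (a i)\<^sup>2"]
    by (subst sum.cong[OF refl, of _ _ "\<lambda>j. if j = i then (a i)\<^sup>2 else 0"]) (auto simp: power2_eq_square)
  then show ?thesis
    by (subst power2_norm_eq_inner, subst inner_sum_left, intro sum.cong refl, subst inner_sum_right) auto
qed

lemma bessel: "finite I \<Longrightarrow> (\<Sum>i\<in>I. (x \<bullet> e i)\<^sup>2) \<le> (norm x)\<^sup>2"
proof -
  assume I: "finite I"
  define y where "y = (\<Sum>i\<in>I. (x \<bullet> e i) *\<^sub>R e i)"
  have "x \<bullet> y = (\<Sum>i\<in>I. (x \<bullet> e i)\<^sup>2)" "y \<bullet> y = (\<Sum>i\<in>I. (x \<bullet> e i)\<^sup>2)"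
    using norm_sum_basis_sq[OF I, of "\<lambda>i. x \<bullet> e i"]
    by (simp_all add: y_def inner_sum_right power2_eq_square flip: power2_norm_eq_inner)
  moreover have "0 \<le> (x - y) \<bullet> (x - y)" by simp
  ultimately show ?thesis
    by (simp add: inner_diff_left inner_diff_right inner_commute[of y x] power2_norm_eq_inner)
qed

lemma summable_coeffs_sq: "summable (\<lambda>i. (x \<bullet> e i)\<^sup>2)"
  by (rule bounded_imp_summable[of _ "(norm x)\<^sup>2"]) (auto intro: bessel)

lemma summable_basis_series:
  assumes "summable (\<lambda>i. (a i)\<^sup>2)"
  shows "summable (\<lambda>i. a i *\<^sub>R e i)"
  unfolding summable_Cauchy
proof (intro allI impI)
  fix \<epsilon> :: real assume "\<epsilon> > 0"
  then obtain N where N: "\<And>m n. m \<ge> N \<Longrightarrow> norm (\<Sum>i\<in>{m..<n}. (a i)\<^sup>2) < \<epsilon>\<^sup>2"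
    using assms unfolding summable_Cauchy by (metis zero_less_power)
  have "norm (\<Sum>i\<in>{m..<n}. a i *\<^sub>R e i) < \<epsilon>" if "m \<ge> N" for m n
  proof (rule power2_less_imp_less)
    show "(norm (\<Sum>i\<in>{m..<n}. a i *\<^sub>R e i))\<^sup>2 < \<epsilon>\<^sup>2"
      using N[OF that, of n] by (simp only: norm_sum_basis_sq finite_atLeastLessThan real_norm_def)
  qed (use \<open>\<epsilon> > 0\<close> in simp)
  then show "\<exists>N. \<forall>m\<ge>N. \<forall>n. norm (sum (\<lambda>i. a i *\<^sub>R e i) {m..<n}) < \<epsilon>" by blast
qed

lemma inner_basis_series:
  assumes "(\<lambda>i. a i *\<^sub>R e i) sums s"
  shows "s \<bullet> e j = a j"
proof -
  have "(\<lambda>i. (a i *\<^sub>R e i) \<bullet> e j) sums (s \<bullet> e j)"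
    by (rule bounded_linear.sums[OF bounded_linear_inner_left assms])
  moreover have "(\<lambda>i. (a i *\<^sub>R e i) \<bullet> e j) = (\<lambda>i. if i = j then a i else 0)" by auto
  ultimately show ?thesis using sums_unique2 sums_single by metis
qed

lemma coeffs_zero_imp_zero:
  assumes "\<And>n. x \<bullet> e n = 0" shows "x = 0"
proof -
  have "span (range e) \<subseteq> {y. x \<bullet> y = 0}"
    by (rule span_minimal) (auto simp: assms subspace_def inner_add_right)
  moreover have "closed {y. x \<bullet> y = 0}" by (intro closed_Collect_eq continuous_intros)
  ultimately have "closure (span (range e)) \<subseteq> {y. x \<bullet> y = 0}" by (rule closure_minimal)
  then have "x \<bullet> x = 0" using onb unfolding orthonormal_basis_def by blast
  then show ?thesis by simp
qed

lemma coeffs_eqI: "(\<And>n. x \<bullet> e n = y \<bullet> e n) \<Longrightarrow> x = y"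
  using coeffs_zero_imp_zero[of "x - y"] by (simp add: inner_diff_left)

lemma basis_expansion: "(\<lambda>i. (x \<bullet> e i) *\<^sub>R e i) sums x"
proof -
  have *: "(\<lambda>i. (x \<bullet> e i) *\<^sub>R e i) sums (\<Sum>i. (x \<bullet> e i) *\<^sub>R e i)"
    by (intro summable_sums summable_basis_series summable_coeffs_sq)
  then show ?thesis using coeffs_eqI[OF inner_basis_series[OF *]] by simp
qed

text \<open>The Fourier multiplier with symbol \<open>m\<close>. It serves twice: for the semigroup
  itself, and for the approximate identities that appear in its difference quotients.\<close>

definition diag :: "(nat \<Rightarrow> real) \<Rightarrow> 'h \<Rightarrow> 'h" where
  "diag m x = (\<Sum>n. (m n * (x \<bullet> e n)) *\<^sub>R e n)"

context
  fixes m :: "nat \<Rightarrow> real"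
  assumes m: "\<And>n. \<bar>m n\<bar> \<le> 1"
begin

lemma diag_coeff_sq_le: "(m n * a)\<^sup>2 \<le> a\<^sup>2"
  using mult_right_mono[of "(m n)\<^sup>2" 1 "a\<^sup>2"] m[of n] by (simp add: power_mult_distrib abs_square_le_1)

lemma diag_sums: "(\<lambda>n. (m n * (x \<bullet> e n)) *\<^sub>R e n) sums diag m x"
  unfolding diag_def
  by (intro summable_sums summable_basis_series summable_comparison_test[OF _ summable_coeffs_sq[of x]])
     (auto intro: diag_coeff_sq_le)

lemma diag_inner: "diag m x \<bullet> e n = m n * (x \<bullet> e n)"
  by (rule inner_basis_series[OF diag_sums])

lemma norm_diag_le: "norm (diag m x) \<le> norm x"
proof (rule LIMSEQ_le_const2)
  show "(\<lambda>N. norm (\<Sum>n<N. (m n * (x \<bullet> e n)) *\<^sub>R e n)) \<longlonglongrightarrow> norm (diag m x)"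
    using diag_sums[of x] unfolding sums_def by (rule tendsto_norm)
  have "(norm (\<Sum>n<N. (m n * (x \<bullet> e n)) *\<^sub>R e n))\<^sup>2 \<le> (norm x)\<^sup>2" for N
    unfolding norm_sum_basis_sq[OF finite_lessThan]
    by (rule order.trans[OF sum_mono[OF diag_coeff_sq_le] bessel]) simp
  then show "\<exists>N. \<forall>n\<ge>N. norm (\<Sum>n<n. (m n * (x \<bullet> e n)) *\<^sub>R e n) \<le> norm x"
    by (auto intro: power2_le_imp_le)
qed

lemma bounded_linear_diag: "bounded_linear (diag m)"
proof (rule bounded_linear_intro[where K = 1])
  show "diag m (x + y) = diag m x + diag m y" for x y
    by (rule coeffs_eqI) (simp add: diag_inner inner_add_left algebra_simps)
  show "diag m (r *\<^sub>R x) = r *\<^sub>R diag m x" for r x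
    by (rule coeffs_eqI) (simp add: diag_inner)
qed (simp add: norm_diag_le)

end

text \<open>Convergence is clear on finite combinations of basis vectors, and the uniform bound 1 on
  the multipliers carries it to their closure: the error splits into a finite part and two
  tails.\<close>

lemma tendsto_diag_ident:
  assumes bound: "\<And>t n. \<bar>m t n\<bar> \<le> 1" and lim: "\<And>n. ((\<lambda>t. m t n) \<longlongrightarrow> 1) F"
  shows "((\<lambda>t. diag (m t) x) \<longlongrightarrow> x) F"
proof (rule tendstoI)
  fix \<epsilon> :: real assume "\<epsilon> > 0"
  define p where "p N = (\<Sum>n<N. (x \<bullet> e n) *\<^sub>R e n)" for N
  have "p \<longlonglongrightarrow> x" using basis_expansion[of x] by (simp add: sums_def p_def[abs_def])
  then obtain N where N: "norm (p N - x) < \<epsilon> / 3"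
    using \<open>\<epsilon> > 0\<close> by (force simp: LIMSEQ_iff dest: spec[of _ "\<epsilon>/3"])
  interpret B: bounded_linear "diag (m t)" for t by (rule bounded_linear_diag[OF bound])
  have diag_e: "diag (m t) (e n) = m t n *\<^sub>R e n" for t n
    by (rule coeffs_eqI) (auto simp: diag_inner[OF bound])
  have "((\<lambda>t. diag (m t) (p N)) \<longlongrightarrow> (\<Sum>n<N. (x \<bullet> e n) *\<^sub>R (1 *\<^sub>R e n))) F"
    unfolding p_def B.sum B.scaleR diag_e by (intro tendsto_intros lim)
  then have "\<forall>\<^sub>F t in F. dist (diag (m t) (p N)) (p N) < \<epsilon> / 3"
    using \<open>\<epsilon> > 0\<close> by (intro tendstoD) (auto simp: p_def)
  then show "\<forall>\<^sub>F t in F. dist (diag (m t) x) x < \<epsilon>"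
  proof eventually_elim
    case (elim t)
    have "norm (diag (m t) (x - p N)) \<le> norm (p N - x)"
      unfolding norm_minus_commute[of "p N"] by (rule norm_diag_le[OF bound])
    moreover have "diag (m t) x - x = diag (m t) (x - p N) + (diag (m t) (p N) - p N) + (p N - x)"
      by (simp add: B.diff)
    ultimately have "norm (diag (m t) x - x)
      \<le> norm (diag (m t) (x - p N)) + norm (diag (m t) (p N) - p N) + norm (p N - x)"
      by (metis add_mono norm_triangle_ineq norm_triangle_le order_refl)
    then show ?case using elim N \<open>norm (diag (m t) (x - p N)) \<le> norm (p N - x)\<close>
      unfolding dist_norm by linarith
  qed
qed

end

section \<open>Uniform boundedness, and local bounds for strongly continuous semigroups\<close>

lemma uniform_boundedness:
  fixes T :: "'i \<Rightarrow> 'a::banach \<Rightarrow> 'b::real_normed_vector"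
  assumes lin: "\<And>i. bounded_linear (T i)" and ptw: "\<And>x. bounded (range (\<lambda>i. T i x))"
  shows "\<exists>K. \<forall>i x. norm (T i x) \<le> K * norm x"
proof (rule ccontr)
  assume no: "\<not> ?thesis"
  interpret T: bounded_linear "T i" for i by (rule lin)
  have "\<exists>i y. norm y \<le> r \<and> norm (T i (x + y)) \<ge> c" if "r > 0" for r c :: real and x
  proof -
    \<comment> \<open>One of \<open>x + y\<close> and \<open>x - y\<close> has an image at least as large as that of \<open>y\<close>.\<close>
    obtain i z where z: "norm (T i z) > (\<bar>c\<bar> / r) * norm z" using no by (meson not_le)
    then have "z \<noteq> 0" by (auto simp: T.zero)
    define y where "y = (r / norm z) *\<^sub>R z"
    have y: "norm y = r" "norm (T i y) > \<bar>c\<bar>"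
      using z \<open>z \<noteq> 0\<close> that by (auto simp: y_def T.scaleR field_simps)
    have "T i (x + y) - T i (x - y) = 2 *\<^sub>R T i y"
      by (simp add: T.add T.diff scaleR_2)
    then have "2 * \<bar>c\<bar> < norm (T i (x + y)) + norm (T i (x + (- y)))"
      using y norm_triangle_ineq4[of "T i (x + y)" "T i (x - y)"] by simp
    then have "norm (T i (x + y)) \<ge> c \<or> norm (T i (x + (- y))) \<ge> c" by linarith
    then show ?thesis using y by (metis norm_minus_cancel order_refl)
  qed
  then obtain i y where
    y: "\<And>r c x. r > 0 \<Longrightarrow> norm (y r c x) \<le> r \<and> norm (T (i r c x) (x + y r c x)) \<ge> c" by metis
  obtain B where B: "\<And>i x. norm (T i x) \<le> B i * norm x" "\<And>i. B i > 0"
    using T.pos_bounded by (metis mult.commute)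
  \<comment> \<open>Gliding hump: state \<open>(x, r)\<close>, where every point within \<open>r\<close> of \<open>x\<close> has a large image under the
    operators chosen so far.\<close>
  define step where "step = (\<lambda>k (x, r). let j = i (r / 2) (real k + 1) x; x' = x + y (r / 2) (real k + 1) x
     in (x', min (r / 2) (1 / B j)))"
  define st where "st = rec_nat (0 :: 'a, 1 :: real) step"
  define u r where "u k = fst (st k)" and "r k = snd (st k)" for k
  define j where "j k = i (r k / 2) (real k + 1) (u k)" for k
  have uSuc: "u (Suc k) = u k + y (r k / 2) (real k + 1) (u k)" "r (Suc k) = min (r k / 2) (1 / B (j k))" for k
    by (simp_all add: u_def r_def j_def st_def step_def case_prod_beta Let_def)
  have r0: "r 0 = 1" by (simp add: r_def st_def)
  have rpos: "r k > 0" for k by (induction k) (use r0 uSuc B in auto)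
  have rpow: "r k \<le> (1/2)^k" for k
  proof (induction k)
    case (Suc k) then show ?case unfolding uSuc(2) by (auto simp: min_def)
  qed (simp add: r0)
  have du: "norm (u (Suc k) - u k) \<le> r k / 2" for k using y[of "r k / 2"] rpos[of k] by (simp add: uSuc)
  have big: "norm (T (j k) (u (Suc k))) \<ge> real k + 1" for k
    using y[of "r k / 2" "real k + 1" "u k"] rpos[of k] by (simp add: uSuc j_def)
  have near: "norm (u (k + n) - u k) \<le> r k - r (k + n)" for k n
  proof (induction n)
    case (Suc n)
    have "norm (u (k + Suc n) - u k) \<le> norm (u (Suc (k + n)) - u (k + n)) + norm (u (k + n) - u k)"
      by (metis add_Suc_right diff_add_cancel diff_diff_eq2 norm_triangle_ineq add.commute add_diff_eq)
    also have "\<dots> \<le> r (k + n) / 2 + (r k - r (k + n))" using du[of "k + n"] Suc.IH by linarith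
    also have "\<dots> \<le> r k - r (Suc (k + n))" unfolding uSuc(2) by (auto simp: min_def)
    finally show ?case by simp
  qed simp
  have "Cauchy u"
  proof (rule metric_CauchyI)
    fix \<epsilon> :: real assume "\<epsilon> > 0"
    then obtain N where N: "(1/2)^N < \<epsilon> / 2" using real_arch_pow_inv[of "\<epsilon> / 2" "1/2"] by auto
    have "dist (u n) (u N) < \<epsilon> / 2" if "n \<ge> N" for n
      using near[of N "n - N"] that N rpow[of N] rpos[of n] by (simp add: dist_norm)
    then have "dist (u m) (u n) < \<epsilon>" if "m \<ge> N" "n \<ge> N" for m n
      using that by (metis dist_triangle_half_l dist_commute)
    then show "\<exists>M. \<forall>m\<ge>M. \<forall>n\<ge>M. dist (u m) (u n) < \<epsilon>" by blast
  qed
  then obtain x where x: "u \<longlonglongrightarrow> x" by (auto simp: Cauchy_convergent_iff convergent_def)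
  have close: "norm (x - u k) \<le> r k" for k
  proof (rule LIMSEQ_le_const2)
    show "(\<lambda>n. norm (u n - u k)) \<longlonglongrightarrow> norm (x - u k)" by (intro tendsto_intros x)
    have "norm (u n - u k) \<le> r k" if "n \<ge> k" for n
      using near[of k "n - k"] that rpos[of n] by simp
    then show "\<exists>N. \<forall>n\<ge>N. norm (u n - u k) \<le> r k" by blast
  qed
  \<comment> \<open>\<open>x\<close> is within \<open>1 / B (j k)\<close> of
    \<open>u (Suc k)\<close>, so passing to the limit costs at most 1 of the lower bound
    \<open>real k + 1\<close>.\<close>
  have "norm (T (j k) x) \<ge> real k" for k
  proof -
    have "norm (T (j k) (x - u (Suc k))) \<le> B (j k) * r (Suc k)"
      using B(1)[of "j k" "x - u (Suc k)"] close[of "Suc k"] B(2)[of "j k"]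
      by (meson less_imp_le mult_left_mono order_trans)
    also have "\<dots> \<le> B (j k) * (1 / B (j k))"
      using B(2)[of "j k"] by (intro mult_left_mono) (auto simp: uSuc)
    also have "\<dots> = 1" using B(2)[of "j k"] by simp
    finally have "norm (T (j k) (u (Suc k)) - T (j k) x) \<le> 1"
      by (simp add: T.diff norm_minus_commute)
    then show ?thesis using big[of k] norm_triangle_ineq2[of "T (j k) (u (Suc k))" "T (j k) x"] by linarith
  qed
  moreover obtain C where "norm (T (j k) x) \<le> C" for k
    using ptw[of x] unfolding bounded_iff by auto
  ultimately have "real k \<le> C" for k by (meson order_trans)
  then show False by (meson not_le reals_Archimedean2)
qed

text \<open>Along times tending to 0 all orbits are bounded by strong continuity, so uniform
  boundedness gives a bound near 0, and the semigroup law spreads it over \<open>[0, t]\<close>. The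
  telescoping for eigenvectors needs one constant for all times up to \<open>t\<close>.\<close>

lemma c0_semigroup_locally_bounded:
  fixes S :: "real \<Rightarrow> 'h::banach \<Rightarrow> 'h"
  assumes S: "c0_semigroup S"
  shows "\<exists>K. \<forall>s x. 0 \<le> s \<and> s \<le> t \<longrightarrow> norm (S s x) \<le> K * norm x"
proof -
  have lin: "bounded_linear (S s)" if "s \<ge> 0" for s using S that by (auto simp: c0_semigroup_def)
  have add: "S (s + s') x = S s (S s' x)" if "s \<ge> 0" "s' \<ge> 0" for s s' x
    using S that by (auto simp: c0_semigroup_def)
  \<comment> \<open>One number \<open>n\<close> controls both the length of the interval and the
    bound, so that failure for every \<open>n\<close> yields a sequence of times tending to
    0.\<close>
  have "\<exists>n. \<forall>s x. 0 \<le> s \<and> s \<le> 1 / (real n + 1) \<longrightarrow> norm (S s x) \<le> real n * norm x"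
  proof (rule ccontr)
    assume "\<not> ?thesis"
    then have "\<forall>n. \<exists>s x. 0 \<le> s \<and> s \<le> 1 / (real n + 1) \<and> norm (S s x) > real n * norm x"
      by (force simp: not_le)
    then obtain s x where s: "\<And>n. 0 \<le> s n" "\<And>n. s n \<le> 1 / (real n + 1)"
      and x: "\<And>n. norm (S (s n) (x n)) > real n * norm (x n)" by metis
    have "s \<longlonglongrightarrow> 0"
      by (rule real_tendsto_sandwich[of "\<lambda>_. 0" _ _ "\<lambda>n. 1 / (real n + 1)"])
         (use s LIMSEQ_inverse_real_of_nat in \<open>auto simp: inverse_eq_divide add.commute\<close>)
    have "(\<lambda>n. S (s n) y) \<longlonglongrightarrow> y" for y
    proof -
      have "((\<lambda>t. S t y) \<longlongrightarrow> S 0 y) (at 0 within {0..})"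
        using S by (simp add: c0_semigroup_def at_within_Ici_at_right)
      then have "continuous (at 0 within {0..}) (\<lambda>t. S t y)" by (simp add: continuous_within)
      then have "(\<lambda>n. S (s n) y) \<longlonglongrightarrow> S 0 y"
        using s(1) \<open>s \<longlonglongrightarrow> 0\<close> unfolding continuous_within_sequentially by (simp add: o_def)
      then show ?thesis using S by (simp add: c0_semigroup_def)
    qed
    then have "bounded (range (\<lambda>n. S (s n) y))" for y by (rule convergent_imp_bounded)
    from uniform_boundedness[OF lin[OF s(1)] this]
    obtain K where K: "\<And>n y. norm (S (s n) y) \<le> K * norm y" by auto
    obtain n where "K \<le> real n" using real_arch_simple by blast
    then have "K * norm (x n) \<le> real n * norm (x n)" by (intro mult_right_mono) auto
    then show False using K[of n "x n"] x[of n] by linarith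
  qed
  then obtain n where n: "\<And>s x. 0 \<le> s \<Longrightarrow> s \<le> 1 / (real n + 1) \<Longrightarrow> norm (S s x) \<le> real n * norm x" by blast
  define \<delta> K where "\<delta> = 1 / (real n + 1)" and "K = max 1 (real n)"
  have K: "K \<ge> 1" and \<delta>: "\<delta> > 0" by (auto simp: K_def \<delta>_def)
  have base: "norm (S s x) \<le> K * norm x" if "0 \<le> s" "s \<le> \<delta>" for s x
    using n[OF that[unfolded \<delta>_def], of x]
    by (rule order.trans) (auto intro!: mult_right_mono simp: K_def)
  have bd: "norm (S s x) \<le> K ^ Suc k * norm x" if "0 \<le> s" "s \<le> real (Suc k) * \<delta>" for k s x
    using that
  proof (induction k arbitrary: s)
    case 0 then show ?case using base by simp
  next
    case (Suc k)
    show ?case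
    proof (cases "s \<le> \<delta>")
      case True
      have "K \<le> K ^ Suc (Suc k)" using K power_increasing[of 1 "Suc (Suc k)" K] by simp
      then show ?thesis using base[OF Suc.prems(1) True, of x]
        by (meson mult_right_mono norm_ge_zero order_trans)
    next
      case False
      have "S s x = S \<delta> (S (s - \<delta>) x)" using add[of \<delta> "s - \<delta>" x] False \<delta> by simp
      then have "norm (S s x) \<le> K * norm (S (s - \<delta>) x)" using base[of \<delta>] \<delta> by simp
      also have "\<dots> \<le> K * (K ^ Suc k * norm x)"
        using Suc False K by (intro mult_left_mono Suc.IH) (auto simp: algebra_simps)
      finally show ?thesis by (simp add: mult.assoc)
    qed
  qed
  obtain k where k: "t / \<delta> \<le> real k" using real_arch_simple by blast
  then have "t \<le> real (Suc k) * \<delta>" using \<delta> by (simp add: field_simps)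
  then show ?thesis using bd by (intro exI[of _ "K ^ Suc k"]) auto
qed

text \<open>The defect \<open>S h v - e\<^sup>c\<^sup>h v\<close> is \<open>o(h)\<close>, so telescoping over \<open>n\<close> steps of length \<open>t / n\<close> and
  local boundedness give the claim in the limit.\<close>

lemma c0_semigroup_eigenvector:
  fixes S :: "real \<Rightarrow> 'h::banach \<Rightarrow> 'h"
  assumes S: "c0_semigroup S" and gen: "((\<lambda>t. (S t v - v) /\<^sub>R t) \<longlongrightarrow> c *\<^sub>R v) (at_right 0)"
    and c: "c \<le> 0" and t: "t \<ge> 0"
  shows "S t v = exp (c * t) *\<^sub>R v"
proof (cases "t = 0")
  case True then show ?thesis using S by (simp add: c0_semigroup_def)
next
  case False
  then have t: "t > 0" using t by simp
  have add: "S (s + s') x = S s (S s' x)" if "s \<ge> 0" "s' \<ge> 0" for s s' x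
    using S that by (auto simp: c0_semigroup_def)
  obtain K where K: "\<And>s x. 0 \<le> s \<Longrightarrow> s \<le> t \<Longrightarrow> norm (S s x) \<le> K * norm x"
    using c0_semigroup_locally_bounded[OF S, of t] by blast
  define d where "d h = S h v - exp (c * h) *\<^sub>R v" for h
  \<comment> \<open>\<open>c \<le> 0\<close> gives \<open>exp (c * h) \<le> 1\<close>, so earlier
    errors are not amplified, and each step adds one defect, transported by an operator of norm at
    most \<open>K\<close>.\<close>
  have tel: "norm (S (real m * h) v - exp (c * (real m * h)) *\<^sub>R v) \<le> real m * (K * norm (d h))"
    if h: "h > 0" "real m * h \<le> t" for m h
    using h(2)
  proof (induction m)
    case 0 then show ?case using S by (simp add: c0_semigroup_def)
  next
    case (Suc m)
    have lin: "bounded_linear (S (real m * h))" using S h by (auto simp: c0_semigroup_def)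
    have mh: "real m * h \<le> t" using Suc.prems h by (simp add: algebra_simps)
    have "S (real (Suc m) * h) v = S (real m * h) (S h v)" using add[of "real m * h" h v] h
      by (simp add: algebra_simps)
    moreover have "S (real m * h) (S h v) = S (real m * h) (d h) + exp (c * h) *\<^sub>R S (real m * h) v"
      by (simp add: d_def linear_diff[OF bounded_linear.linear[OF lin]] linear_scale[OF bounded_linear.linear[OF lin]])
    ultimately have "S (real (Suc m) * h) v - exp (c * (real (Suc m) * h)) *\<^sub>R v
      = S (real m * h) (d h) + exp (c * h) *\<^sub>R (S (real m * h) v - exp (c * (real m * h)) *\<^sub>R v)"
      by (simp add: algebra_simps exp_add)
    then have "norm (S (real (Suc m) * h) v - exp (c * (real (Suc m) * h)) *\<^sub>R v)
      \<le> norm (S (real m * h) (d h)) + exp (c * h) * norm (S (real m * h) v - exp (c * (real m * h)) *\<^sub>R v)"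
      by (metis norm_triangle_ineq norm_scaleR abs_exp_cancel)
    also have "\<dots> \<le> K * norm (d h) + 1 * (real m * (K * norm (d h)))"
      using Suc.IH[OF mh] K[OF _ mh, of "d h"] h c
      by (intro add_mono mult_mono) (auto simp: mult_nonpos_nonneg)
    finally show ?case by (simp add: algebra_simps)
  qed
  have "((\<lambda>h. (exp (c * h) - 1) / h) \<longlongrightarrow> c) (at_right 0)"
  proof -
    have "((\<lambda>h. exp (c * h)) has_real_derivative c) (at 0)" by (auto intro!: derivative_eq_intros)
    then show ?thesis by (auto simp: has_field_derivative_iff intro: filterlim_mono at_le)
  qed
  from tendsto_diff[OF gen tendsto_scaleR[OF this tendsto_const[of v]]]
  have "((\<lambda>h. (1 / h) *\<^sub>R d h) \<longlongrightarrow> 0) (at_right 0)"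
    by (simp add: d_def algebra_simps divide_inverse)
  then have lim: "((\<lambda>h. norm ((1 / h) *\<^sub>R d h)) \<longlongrightarrow> 0) (at_right 0)"
    by (intro tendsto_norm_zero)
  have "filterlim (\<lambda>n. t / real (Suc n)) (at_right 0) sequentially"
    using t using LIMSEQ_Suc[OF lim_const_over_n[of t]] by (auto simp: filterlim_at)
  from filterlim_compose[OF lim this]
  have lim: "(\<lambda>n. t * K * norm ((1 / (t / real (Suc n))) *\<^sub>R d (t / real (Suc n)))) \<longlonglongrightarrow> t * K * 0"
    by (intro tendsto_intros)
  have "norm (S t v - exp (c * t) *\<^sub>R v) \<le> t * K * norm ((1 / (t / real (Suc n))) *\<^sub>R d (t / real (Suc n)))" for n
  proof -
    have "norm ((1 / (t / real (Suc n))) *\<^sub>R d (t / real (Suc n))) = real (Suc n) / t * norm (d (t / real (Suc n)))"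
      using t by simp
    moreover have "real (Suc n) * (t / real (Suc n)) = t" by simp
    ultimately show ?thesis using tel[of "t / real (Suc n)" "Suc n"] t by (simp add: mult_ac)
  qed
  then have "norm (S t v - exp (c * t) *\<^sub>R v) \<le> t * K * 0"
    by (intro LIMSEQ_le_const[OF lim]) blast
  then show ?thesis by simp
qed

section \<open>The semigroup generated by the diagonal operator\<close>

locale spectral_semigroup = onb +
  fixes \<gamma> :: "nat \<Rightarrow> real"
  assumes \<gamma>_pos: "\<And>n. \<gamma> n > 0"
begin

text \<open>Negative times are clamped to 0, which keeps every \<open>sgr t\<close> a linear
  contraction; the pathwise equation then carries no sign conditions in its norm estimates.\<close>

definition sgr :: "real \<Rightarrow> 'a \<Rightarrow> 'a" where
  "sgr t = diag (\<lambda>n. exp (- \<gamma> n * max 0 t))"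

lemma sgr_multiplier_le: "\<bar>exp (- \<gamma> n * max 0 t)\<bar> \<le> 1"
  using \<gamma>_pos[of n] by (simp add: mult_nonneg_nonneg less_imp_le)

lemma bounded_linear_sgr: "bounded_linear (sgr t)"
  unfolding sgr_def by (rule bounded_linear_diag[OF sgr_multiplier_le])

lemma norm_sgr_le: "norm (sgr t x) \<le> norm x"
  unfolding sgr_def by (rule norm_diag_le[OF sgr_multiplier_le])

lemma sgr_inner: "sgr t x \<bullet> e n = exp (- \<gamma> n * max 0 t) * (x \<bullet> e n)"
  unfolding sgr_def by (rule diag_inner[OF sgr_multiplier_le])

lemma sgr_sums: "(\<lambda>n. (exp (- \<gamma> n * max 0 t) * (x \<bullet> e n)) *\<^sub>R e n) sums sgr t x"
  unfolding sgr_def by (rule diag_sums[OF sgr_multiplier_le])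

lemma sgr_add: "s \<ge> 0 \<Longrightarrow> t \<ge> 0 \<Longrightarrow> sgr (s + t) x = sgr s (sgr t x)"
  by (rule coeffs_eqI) (simp add: sgr_inner algebra_simps exp_add flip: exp_add)

lemma c0_semigroup_sgr: "c0_semigroup sgr"
  unfolding c0_semigroup_def
proof (intro conjI allI impI)
  show "sgr 0 = id" by (rule ext, rule coeffs_eqI) (simp add: sgr_inner)
  fix x
  have "((\<lambda>t. exp (- \<gamma> n * max 0 t)) \<longlongrightarrow> exp (- \<gamma> n * max 0 0)) (at_right 0)" for n
    by (intro tendsto_intros)
  then show "((\<lambda>t. sgr t x) \<longlongrightarrow> x) (at_right 0)"
    unfolding sgr_def by (intro tendsto_diag_ident sgr_multiplier_le) simp
qed (auto simp: bounded_linear_sgr sgr_add)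

lemma has_generator_sgr:
  assumes sa: "self_adjoint_operator D A" and eD: "\<And>n. e n \<in> D" and Ae: "\<And>n. A (e n) = - \<gamma> n *\<^sub>R e n"
  shows "has_generator sgr D A"
proof -
  have graph: "(\<forall>z\<in>D. A z \<bullet> x = z \<bullet> y) \<longleftrightarrow> x \<in> D \<and> y = A x" for x y
    using sa unfolding self_adjoint_operator_def by blast
  have coeff_A: "A x \<bullet> e n = - \<gamma> n * (x \<bullet> e n)" if "x \<in> D" for x n
    using graph[of x "A x"] that eD[of n] by (auto simp: Ae inner_commute)
  \<comment> \<open>The substance is that an \<open>x\<close> with admissible coefficients lies in
    \<open>D\<close>. Pairing with every \<open>z \<in> D\<close> places \<open>(x, y)\<close> in
    the graph of the adjoint, and by self-adjointness this is the graph of \<open>A\<close>.\<close>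
  have A_iff: "x \<in> D \<and> y = A x \<longleftrightarrow> (\<forall>n. y \<bullet> e n = - \<gamma> n * (x \<bullet> e n))" for x y
  proof
    assume y: "\<forall>n. y \<bullet> e n = - \<gamma> n * (x \<bullet> e n)"
    have "A z \<bullet> x = z \<bullet> y" if "z \<in> D" for z
    proof (rule sums_unique2)
      show "(\<lambda>n. A z \<bullet> ((x \<bullet> e n) *\<^sub>R e n)) sums (A z \<bullet> x)"
        by (rule bounded_linear.sums[OF bounded_linear_inner_right basis_expansion])
      have "(\<lambda>n. z \<bullet> ((y \<bullet> e n) *\<^sub>R e n)) sums (z \<bullet> y)"
        by (rule bounded_linear.sums[OF bounded_linear_inner_right basis_expansion])
      then show "(\<lambda>n. A z \<bullet> ((x \<bullet> e n) *\<^sub>R e n)) sums (z \<bullet> y)"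
        by (simp add: y coeff_A[OF that] mult_ac)
    qed
    then show "x \<in> D \<and> y = A x" using graph by blast
  qed (auto simp: coeff_A)
  have "((\<lambda>t. (sgr t x - x) /\<^sub>R t) \<longlongrightarrow> y) (at_right 0) \<longleftrightarrow> (\<forall>n. y \<bullet> e n = - \<gamma> n * (x \<bullet> e n))" for x y
  proof
    assume lim: "((\<lambda>t. (sgr t x - x) /\<^sub>R t) \<longlongrightarrow> y) (at_right 0)"
    show "\<forall>n. y \<bullet> e n = - \<gamma> n * (x \<bullet> e n)"
    proof
      fix n
      have 1: "((\<lambda>t. ((sgr t x - x) /\<^sub>R t) \<bullet> e n) \<longlongrightarrow> y \<bullet> e n) (at_right 0)"
        by (intro tendsto_intros lim)
      have "((\<lambda>t. exp (- \<gamma> n * t)) has_real_derivative - \<gamma> n) (at 0)"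
        by (auto intro!: derivative_eq_intros)
      then have "((\<lambda>t. (exp (- \<gamma> n * t) - 1) / t * (x \<bullet> e n)) \<longlongrightarrow> - \<gamma> n * (x \<bullet> e n)) (at_right 0)"
        by (intro tendsto_intros) (auto simp: has_field_derivative_iff intro: filterlim_mono at_le)
      moreover have "\<forall>\<^sub>F t in at_right 0. (exp (- \<gamma> n * t) - 1) / t * (x \<bullet> e n) = ((sgr t x - x) /\<^sub>R t) \<bullet> e n"
        using eventually_at_right_less[of "0::real"]
        by eventually_elim (simp add: sgr_inner inner_diff_left field_simps)
      ultimately have "((\<lambda>t. ((sgr t x - x) /\<^sub>R t) \<bullet> e n) \<longlongrightarrow> - \<gamma> n * (x \<bullet> e n)) (at_right 0)"
        by (rule Lim_transform_eventually)
      with 1 show "y \<bullet> e n = - \<gamma> n * (x \<bullet> e n)" by (rule tendsto_unique[rotated]) simp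
    qed
  next
    assume y: "\<forall>n. y \<bullet> e n = - \<gamma> n * (x \<bullet> e n)"
    \<comment> \<open>The difference quotient has the coefficients
      \<open>(exp (- \<gamma> n * t) - 1) / t * (x \<bullet> e n)\<close>. Taking out
      \<open>y \<bullet> e n = - \<gamma> n * (x \<bullet> e n)\<close> leaves this multiplier, and
      it is at most 1 because \<open>1 - exp (- u) \<le> u\<close>.\<close>
    define m where "m t n = (if t > 0 then (1 - exp (- (\<gamma> n * t))) / (\<gamma> n * t) else 1)" for t n
    have "\<bar>m t n\<bar> \<le> 1" for t n
      using exp_ge_add_one_self[of "- (\<gamma> n * t)"] \<gamma>_pos[of n]
      by (auto simp: m_def divide_le_eq abs_of_nonneg)
    moreover have "((\<lambda>t. m t n) \<longlongrightarrow> 1) (at_right 0)" for n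
    proof -
      have "((\<lambda>t. 1 - exp (- (\<gamma> n * t))) has_real_derivative \<gamma> n) (at 0)"
        by (auto intro!: derivative_eq_intros)
      then have "((\<lambda>t. (1 - exp (- (\<gamma> n * t))) / t / \<gamma> n) \<longlongrightarrow> \<gamma> n / \<gamma> n) (at_right 0)"
        using \<gamma>_pos[of n]
        by (intro tendsto_intros) (auto simp: has_field_derivative_iff intro: filterlim_mono at_le)
      moreover have "\<forall>\<^sub>F t in at_right 0. (1 - exp (- (\<gamma> n * t))) / t / \<gamma> n = m t n"
        using eventually_at_right_less[of "0::real"]
        by eventually_elim (simp add: m_def mult.commute)
      ultimately show ?thesis using \<gamma>_pos[of n] Lim_transform_eventually by fastforce
    qed
    ultimately have "((\<lambda>t. diag (m t) y) \<longlongrightarrow> y) (at_right 0)" by (rule tendsto_diag_ident)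
    moreover have nz: "\<gamma> n \<noteq> 0" for n using \<gamma>_pos by (metis less_irrefl)
    have "diag (m t) y = (sgr t x - x) /\<^sub>R t" if "t > 0" for t
      using that nz y
      by (intro coeffs_eqI) (auto simp: diag_inner[of "m t", OF \<open>\<And>n. \<bar>m t n\<bar> \<le> 1\<close>] sgr_inner inner_diff_left m_def field_simps)
    then have "\<forall>\<^sub>F t in at_right 0. diag (m t) y = (sgr t x - x) /\<^sub>R t"
      using eventually_at_right_less[of "0::real"] by (auto elim: eventually_mono)
    ultimately show "((\<lambda>t. (sgr t x - x) /\<^sub>R t) \<longlongrightarrow> y) (at_right 0)" by (rule Lim_transform_eventually)
  qed
  then show ?thesis unfolding has_generator_def A_iff by blast
qed

text \<open>\<open>sgr\<close> shows that there is something to choose. For whatever semigroup was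
  chosen, the values on the eigenvectors are forced, and linearity and continuity of each
  \<open>S t\<close> force the rest through the basis expansion.\<close>

lemma exp_semigroup_eq_sgr:
  assumes "self_adjoint_operator D A" "\<And>n. e n \<in> D" "\<And>n. A (e n) = - \<gamma> n *\<^sub>R e n" and t: "t \<ge> 0"
  shows "exp_semigroup D A t x = sgr t x"
proof -
  define S where "S = exp_semigroup D A"
  have S: "c0_semigroup S \<and> has_generator S D A"
    unfolding S_def exp_semigroup_def
    by (rule someI[of _ sgr]) (simp add: c0_semigroup_sgr has_generator_sgr[OF assms(1-3)])
  then have lin: "bounded_linear (S t)" using t by (simp add: c0_semigroup_def)
  have "S t (e n) = exp (- \<gamma> n * t) *\<^sub>R e n" for n
  proof (rule c0_semigroup_eigenvector)
    show "((\<lambda>t. (S t (e n) - e n) /\<^sub>R t) \<longlongrightarrow> - \<gamma> n *\<^sub>R e n) (at_right 0)"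
      using S assms(2,3) unfolding has_generator_def by metis
  qed (use S \<gamma>_pos[of n] t in auto)
  then have "(\<lambda>n. (exp (- \<gamma> n * max 0 t) * (x \<bullet> e n)) *\<^sub>R e n) sums S t x"
    using bounded_linear.sums[OF lin basis_expansion[of x]] t
    by (simp add: linear_scale[OF bounded_linear.linear[OF lin]] mult.commute)
  then show ?thesis using sums_unique2[OF _ sgr_sums[of t x]] by (simp add: S_def)
qed

end

section \<open>Picard iteration\<close>

text \<open>Time integrals up to \<open>t\<close> of \<open>G\<close>-measurable processes are again \<open>G\<close>-measurable. Both the predictable
  \<open>\<sigma>\<close>-algebra and the products with the Borel sets of the line have this property.\<close>

definition past_closed :: "(real \<times> 'a) measure \<Rightarrow> bool" where
  "past_closed G \<longleftrightarrow> fst \<in> borel_measurable G \<and>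
     (\<lambda>q. (min (max 0 (fst q)) (fst (snd q)), snd (snd q))) \<in> borel \<Otimes>\<^sub>M G \<rightarrow>\<^sub>M G"

lemma past_closed_pair: "past_closed (borel \<Otimes>\<^sub>M N)"
  unfolding past_closed_def by measurable

section \<open>The predictable sigma-algebra\<close>

context
  fixes M :: "'w measure" and \<F> :: "real \<Rightarrow> 'w measure"
  assumes filt: "usual_filtration M \<F>"
begin

lemma filtration_subalgebra: "s \<ge> 0 \<Longrightarrow> subalgebra M (\<F> s)"
  using filt[unfolded usual_filtration_def, THEN conjunct1] by blast

lemma filtration_space: "s \<ge> 0 \<Longrightarrow> space (\<F> s) = space M"
  using filtration_subalgebra[of s] by (simp add: subalgebra_def)

lemma filtration_sets_subset: "B \<in> sets (\<F> s) \<Longrightarrow> s \<ge> 0 \<Longrightarrow> B \<subseteq> space M"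
  using filtration_space[of s] sets.sets_into_space[of B "\<F> s"] by simp

lemma filtration_top: "s \<ge> 0 \<Longrightarrow> space M \<in> sets (\<F> s)"
  using filtration_space[of s] sets.top[of "\<F> s"] by simp

lemma predictable_generator:
  "{{s<..t} \<times> B | s t B. 0 \<le> s \<and> s < t \<and> B \<in> sets (\<F> s)} \<union> {{0} \<times> B | B. B \<in> sets (\<F> 0)}
    \<subseteq> Pow ({0..} \<times> space M)"
  by (auto dest: filtration_sets_subset[THEN subsetD])

lemma space_predictable: "space (predictable_sigma M \<F>) = {0..} \<times> space M"
  unfolding predictable_sigma_def by (rule space_measure_of[OF predictable_generator])

lemma predictable_rect:
  assumes "0 \<le> s" "B \<in> sets (\<F> s)" shows "{s<..t} \<times> B \<in> sets (predictable_sigma M \<F>)"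
proof (cases "s < t")
  case True
  then show ?thesis unfolding predictable_sigma_def sets_measure_of[OF predictable_generator] using assms by blast
qed simp

lemma predictable_zero: "B \<in> sets (\<F> 0) \<Longrightarrow> {0} \<times> B \<in> sets (predictable_sigma M \<F>)"
  unfolding predictable_sigma_def sets_measure_of[OF predictable_generator] by blast

lemma predictable_ray:
  assumes "0 \<le> s" "B \<in> sets (\<F> s)" shows "{s<..} \<times> B \<in> sets (predictable_sigma M \<F>)"
proof -
  have "{s<..} \<times> B = (\<Union>n. {s<..s + real n} \<times> B)"
    using real_arch_simple[of "x - s" for x] by (force simp: algebra_simps)
  then show ?thesis using predictable_rect[OF assms] by auto
qed

lemma predictable_ray0:
  assumes "B \<in> sets (\<F> 0)" shows "{0..} \<times> B \<in> sets (predictable_sigma M \<F>)"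
proof -
  have "{0..} = insert (0::real) {0<..}" by auto
  then have "{0..} \<times> B = ({0::real} \<times> B) \<union> ({0<..} \<times> B)" by auto
  then show ?thesis using predictable_zero[OF assms] predictable_ray[OF order_refl assms] by auto
qed

lemma fst_predictable: "fst \<in> borel_measurable (predictable_sigma M \<F>)"
proof (rule borel_measurable_iff_greater[THEN iffD2], rule allI)
  fix a :: real
  have "{w \<in> space (predictable_sigma M \<F>). a < fst w} = (if a < 0 then {0..} \<times> space M else {a<..} \<times> space M)"
    by (auto simp: space_predictable)
  then show "{w \<in> space (predictable_sigma M \<F>). a < fst w} \<in> sets (predictable_sigma M \<F>)"
    using filtration_top predictable_ray predictable_ray0 by auto
qed

lemma past_closed_predictable: "past_closed (predictable_sigma M \<F>)"
proof -
  let ?P = "predictable_sigma M \<F>"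
  have "(\<lambda>q. (min (max 0 (fst q)) (fst (snd q)), snd (snd q))) \<in> borel \<Otimes>\<^sub>M ?P \<rightarrow>\<^sub>M ?P" (is "?\<phi> \<in> _")
  proof (subst (2) predictable_sigma_def, rule measurable_measure_of[OF predictable_generator])
    show "?\<phi> \<in> space (borel \<Otimes>\<^sub>M ?P) \<rightarrow> {0..} \<times> space M"
      by (auto simp: space_pair_measure space_predictable)
    fix C assume "C \<in> {{s<..t} \<times> B | s t B. 0 \<le> s \<and> s < t \<and> B \<in> sets (\<F> s)} \<union> {{0} \<times> B | B. B \<in> sets (\<F> 0)}"
    then consider s t B where "C = {s<..t} \<times> B" "0 \<le> s" "s < t" "B \<in> sets (\<F> s)"
      | B where "C = {0} \<times> B" "B \<in> sets (\<F> 0)" by blast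
    then show "?\<phi> -` C \<inter> space (borel \<Otimes>\<^sub>M ?P) \<in> sets (borel \<Otimes>\<^sub>M ?P)"
    proof cases
      case 1
      \<comment> \<open>A minimum lies in \<open>{s<..t}\<close> iff both terms exceed
        \<open>s\<close> and one of them is at most \<open>t\<close>. Since
        \<open>s \<ge> 0\<close>, the inner \<open>max 0\<close> does not affect these
        conditions.\<close>
      have "?\<phi> -` C \<inter> space (borel \<Otimes>\<^sub>M ?P) = {s<..t} \<times> ({s<..} \<times> B) \<union> {s<..} \<times> ({s<..t} \<times> B)"
        using 1 filtration_sets_subset[OF 1(4,2)] by (auto simp: space_pair_measure space_predictable)
      then show ?thesis using 1 predictable_rect predictable_ray by auto
    next
      case 2
      have "?\<phi> -` C \<inter> space (borel \<Otimes>\<^sub>M ?P) = {..0} \<times> ({0..} \<times> B) \<union> UNIV \<times> ({0} \<times> B)"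
        using 2 filtration_sets_subset[OF 2(2)] by (auto simp: space_pair_measure space_predictable)
      then show ?thesis using 2 by (auto intro!: pair_measureI predictable_zero predictable_ray0)
    qed
  qed
  then show ?thesis by (simp add: past_closed_def fst_predictable)
qed

text \<open>The section of a generating rectangle over the time \<open>t\<close> is empty or is its
  base set, and in the latter case the base set belongs to some \<open>\<F> s\<close> with
  \<open>s \<le> t\<close>.\<close>

lemma predictable_imp_adapted:
  assumes X: "(\<lambda>(t, \<omega>). X t \<omega>) \<in> predictable_sigma M \<F> \<rightarrow>\<^sub>M N" and t: "t \<ge> 0"
  shows "X t \<in> \<F> t \<rightarrow>\<^sub>M N"
proof -
  have "(\<lambda>\<omega>. (t, \<omega>)) \<in> \<F> t \<rightarrow>\<^sub>M predictable_sigma M \<F>"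
  proof (subst predictable_sigma_def, rule measurable_measure_of[OF predictable_generator])
    show "(\<lambda>\<omega>. (t, \<omega>)) \<in> space (\<F> t) \<rightarrow> {0..} \<times> space M" using t by (auto simp: filtration_space)
    fix C assume "C \<in> {{s<..t} \<times> B | s t B. 0 \<le> s \<and> s < t \<and> B \<in> sets (\<F> s)} \<union> {{0} \<times> B | B. B \<in> sets (\<F> 0)}"
    then consider s u B where "C = {s<..u} \<times> B" "0 \<le> s" "B \<in> sets (\<F> s)"
      | B where "C = {0} \<times> B" "B \<in> sets (\<F> 0)" by blast
    then obtain I s B where C: "C = I \<times> B" "0 \<le> s" "B \<in> sets (\<F> s)" "t \<in> I \<Longrightarrow> s \<le> t"
    proof cases
      case (1 s u B)
      then show ?thesis using that[of "{s<..u}" B s] by auto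
    next
      case (2 B)
      then show ?thesis using that[of "{0}" B 0] by auto
    qed
    then have "(\<lambda>\<omega>. (t, \<omega>)) -` C \<inter> space (\<F> t) = (if t \<in> I then B else {})"
      using filtration_sets_subset[OF C(3,2)] filtration_space[OF t] by auto
    moreover have "B \<in> sets (\<F> t)" if "t \<in> I"
      using filt[unfolded usual_filtration_def, THEN conjunct2, THEN conjunct1] C that by blast
    ultimately show "(\<lambda>\<omega>. (t, \<omega>)) -` C \<inter> space (\<F> t) \<in> sets (\<F> t)" by simp
  qed
  from measurable_compose[OF this X] show ?thesis by simp
qed

end

text \<open>The integral up to \<open>t\<close> sees \<open>U s\<close> only for
  \<open>0 \<le> s \<le> t\<close>, where clamping \<open>s\<close> to \<open>[0, t]\<close> changes
  nothing. By \<open>past_closed\<close> the clamped integrand is jointly measurable in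
  \<open>s\<close> and \<open>p\<close>, whereas \<open>U s\<close> at times after \<open>t\<close>
  would bring in the future.\<close>

lemma past_closed_integral:
  fixes g :: "real \<Rightarrow> real \<Rightarrow> 'b \<Rightarrow> 'c::{banach, second_countable_topology}"
  assumes G: "past_closed G" and U: "(\<lambda>p. U (fst p) (snd p)) \<in> G \<rightarrow>\<^sub>M N"
    and g: "(\<lambda>(t, s, v). g t s v) \<in> borel_measurable (borel \<Otimes>\<^sub>M (borel \<Otimes>\<^sub>M N))"
  shows "(\<lambda>p. LINT s:{0..fst p}|lborel. g (fst p) s (U s (snd p))) \<in> borel_measurable G"
proof -
  have [measurable]: "fst \<in> borel_measurable G"
    and \<phi>: "(\<lambda>q. (min (max 0 (fst q)) (fst (snd q)), snd (snd q))) \<in> borel \<Otimes>\<^sub>M G \<rightarrow>\<^sub>M G"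
    using G by (auto simp: past_closed_def)
  have "(\<lambda>q. U (min (max 0 (fst q)) (fst (snd q))) (snd (snd q))) \<in> borel \<Otimes>\<^sub>M G \<rightarrow>\<^sub>M N"
    using measurable_compose[OF \<phi> U] by simp
  from measurable_compose[OF measurable_pair_swap' this]
  have [measurable]: "(\<lambda>x. U (min (max 0 (snd x)) (fst (fst x))) (snd (fst x))) \<in> G \<Otimes>\<^sub>M borel \<rightarrow>\<^sub>M N"
    by (simp add: case_prod_beta)
  have "(\<lambda>x. (fst (fst x), snd x, U (min (max 0 (snd x)) (fst (fst x))) (snd (fst x))))
    \<in> G \<Otimes>\<^sub>M borel \<rightarrow>\<^sub>M borel \<Otimes>\<^sub>M (borel \<Otimes>\<^sub>M N)" by measurable
  from measurable_compose[OF this g]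
  have [measurable]: "(\<lambda>x. g (fst (fst x)) (snd x) (U (min (max 0 (snd x)) (fst (fst x))) (snd (fst x))))
    \<in> borel_measurable (G \<Otimes>\<^sub>M borel)" by simp
  have "(\<lambda>p. \<integral>s. indicator {0..fst p} s *\<^sub>R g (fst p) s (U (min (max 0 s) (fst p)) (snd p)) \<partial>lborel)
      \<in> borel_measurable G"
  proof (rule lborel.borel_measurable_lebesgue_integral)
    have "(\<lambda>x. indicator {y. 0 \<le> snd y \<and> snd y \<le> fst (fst y)} x *\<^sub>R
        g (fst (fst x)) (snd x) (U (min (max 0 (snd x)) (fst (fst x))) (snd (fst x)))) \<in> borel_measurable (G \<Otimes>\<^sub>M borel)"
      by measurable
    then show "(\<lambda>(p, s). indicator {0..fst p} s *\<^sub>R g (fst p) s (U (min (max 0 s) (fst p)) (snd p)))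
        \<in> borel_measurable (G \<Otimes>\<^sub>M lborel)"
      by (simp add: case_prod_beta indicator_def cong: measurable_cong_sets)
  qed
  moreover have "indicator {0..fst p} s *\<^sub>R g (fst p) s (U (min (max 0 s) (fst p)) (snd p))
    = indicator {0..fst p} s *\<^sub>R g (fst p) s (U s (snd p))" for p and s :: real
    by (auto simp: indicator_def)
  ultimately show ?thesis by (simp add: set_lebesgue_integral_def)
qed

lemma set_integral_power:
  "0 \<le> t \<Longrightarrow> (LINT s:{0..t}|lborel. c * s ^ n) = c * t ^ Suc n / real (Suc n)" for c t :: real
  using integral_power[of 0 t n] by (simp add: set_lebesgue_integral_def mult_ac)

lemma set_integrable_continuous: "continuous_on {0..t} f \<Longrightarrow> set_integrable lborel {0..t} f"
  for f :: "real \<Rightarrow> real"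
  by (rule borel_integrable_atLeastAtMost')

section \<open>The mild equation along a single path\<close>

locale mild_equation =
  fixes S :: "real \<Rightarrow> 'h::{banach, second_countable_topology} \<Rightarrow> 'h" and F :: "'h \<Rightarrow> 'h" and L K :: real
  assumes S_meas: "(\<lambda>x. S (fst x) (snd x)) \<in> borel_measurable (borel \<Otimes>\<^sub>M borel)"
    and S_lin: "\<And>t. bounded_linear (S t)" and S_norm: "\<And>t x. norm (S t x) \<le> norm x"
    and S_add: "\<And>s t x. s \<ge> 0 \<Longrightarrow> t \<ge> 0 \<Longrightarrow> S (s + t) x = S s (S t x)"
    and L_nonneg: "L \<ge> 0" and F_lip: "\<And>x y. norm (F x - F y) \<le> L * norm (x - y)"
    and F_bd: "\<And>x. norm (F x) \<le> K"
begin

lemma continuous_F: "continuous_on A F"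
proof -
  have "L-lipschitz_on A F" by (rule lipschitz_onI) (auto simp: dist_norm F_lip L_nonneg)
  then show ?thesis by (rule lipschitz_on_continuous_on)
qed

lemma F_meas [measurable]: "F \<in> borel_measurable borel"
  by (rule borel_measurable_continuous_onI[OF continuous_F])

lemma S_meas_comp [measurable (raw)]:
  assumes "f \<in> borel_measurable M" "g \<in> borel_measurable M"
  shows "(\<lambda>x. S (f x) (g x)) \<in> borel_measurable M"
  using measurable_compose[OF measurable_Pair[OF assms] S_meas] by simp

definition drift :: "(real \<Rightarrow> 'h) \<Rightarrow> real \<Rightarrow> 'h" where
  "drift v t = (LINT s:{0..t}|lborel. S (t - s) (F (v s)))"

lemma drift_measurable_past:
  assumes "past_closed G" "(\<lambda>p. U (fst p) (snd p)) \<in> borel_measurable G"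
  shows "(\<lambda>p. drift (\<lambda>s. U s (snd p)) (fst p)) \<in> borel_measurable G"
  unfolding drift_def by (rule past_closed_integral[OF assms]) (simp add: case_prod_beta, measurable)

lemma drift_measurable [measurable]:
  assumes [measurable]: "v \<in> borel_measurable borel"
  shows "drift v \<in> borel_measurable borel"
proof -
  \<comment> \<open>A deterministic path is a process over a one-point space.\<close>
  have "(\<lambda>p. drift v (fst p)) \<in> borel_measurable (borel \<Otimes>\<^sub>M count_space (UNIV :: unit set))"
    by (rule drift_measurable_past[OF past_closed_pair, where U = "\<lambda>s _. v s"]) measurable
  then have "(\<lambda>t. (\<lambda>p. drift v (fst p)) (t, ())) \<in> borel_measurable borel"
    by (rule measurable_compose[rotated]) measurable
  then show ?thesis by simp
qed

text \<open>The bound \<open>K\<close> on \<open>F\<close> makes the drift of every measurable path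
  finite. This is what allows inputs that are merely measurable in time.\<close>

lemma drift_integrable:
  assumes [measurable]: "v \<in> borel_measurable borel"
  shows "set_integrable lborel {0..t} (\<lambda>s. S (t' - s) (F (v s)))"
  unfolding set_integrable_def
  by (rule integrableI_bounded_set_indicator[where B = K])
     (auto simp: emeasure_lborel_Icc_eq intro: order_trans[OF S_norm F_bd])

lemma norm_drift_diff_le:
  assumes [measurable]: "v \<in> borel_measurable borel" "w \<in> borel_measurable borel"
    and \<rho>: "set_integrable lborel {0..t} \<rho>" "\<And>s. 0 \<le> s \<Longrightarrow> s \<le> t \<Longrightarrow> norm (F (v s) - F (w s)) \<le> \<rho> s"
  shows "norm (drift v t - drift w t) \<le> (LINT s:{0..t}|lborel. \<rho> s)"
proof -
  have "drift v t - drift w t = (LINT s:{0..t}|lborel. S (t - s) (F (v s)) - S (t - s) (F (w s)))"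
    unfolding drift_def by (rule set_integral_diff(2)[symmetric]) (auto intro: drift_integrable)
  also have "norm \<dots> \<le> (LINT s|lborel. indicator {0..t} s *\<^sub>R \<rho> s)"
    unfolding set_lebesgue_integral_def
  proof (rule Bochner_Integration.integral_norm_bound_integral)
    show "integrable lborel (\<lambda>s. indicator {0..t} s *\<^sub>R (S (t - s) (F (v s)) - S (t - s) (F (w s))))"
      using set_integral_diff(1)[OF drift_integrable drift_integrable, of v w t t t]
      by (simp add: set_integrable_def)
    show "integrable lborel (\<lambda>s. indicator {0..t} s *\<^sub>R \<rho> s)"
      using \<rho>(1) by (simp add: set_integrable_def)
    have "norm (S r x - S r y) \<le> norm (x - y)" for r x y
      using S_norm[of r "x - y"] linear_diff[OF bounded_linear.linear[OF S_lin], of r x y] by simp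
    then show "norm (indicator {0..t} s *\<^sub>R (S (t - s) (F (v s)) - S (t - s) (F (w s)))) \<le> indicator {0..t} s *\<^sub>R \<rho> s" for s
      using \<rho>(2)[of s] by (auto simp: indicator_def intro: order_trans)
  qed
  finally show ?thesis by (simp add: set_lebesgue_integral_def)
qed

lemma norm_drift_lipschitz_le:
  assumes "v \<in> borel_measurable borel" "w \<in> borel_measurable borel"
    and "continuous_on {0..t} \<rho>" "\<And>s. 0 \<le> s \<Longrightarrow> s \<le> t \<Longrightarrow> norm (v s - w s) \<le> \<rho> s"
  shows "norm (drift v t - drift w t) \<le> (LINT s:{0..t}|lborel. L * \<rho> s)"
  using assms L_nonneg
  by (intro norm_drift_diff_le set_integrable_continuous continuous_intros)
     (auto intro!: order_trans[OF F_lip] mult_left_mono)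

lemma norm_drift_le:
  assumes [measurable]: "v \<in> borel_measurable borel" and "t \<ge> 0"
  shows "norm (drift v t) \<le> K * t"
proof -
  have "norm (drift v t) \<le> (LINT s|lborel. indicator {0..t} s *\<^sub>R K)"
    unfolding drift_def set_lebesgue_integral_def
  proof (rule Bochner_Integration.integral_norm_bound_integral)
    show "integrable lborel (\<lambda>s. indicator {0..t} s *\<^sub>R S (t - s) (F (v s)))"
      using drift_integrable[of v t t] by (simp add: set_integrable_def)
    show "integrable lborel (\<lambda>s. indicator {0..t} s *\<^sub>R K)"
      using set_integrable_continuous[of t "\<lambda>_. K"] by (simp add: set_integrable_def)
    show "norm (indicator {0..t} s *\<^sub>R S (t - s) (F (v s))) \<le> indicator {0..t} s *\<^sub>R K" for s
      by (auto simp: indicator_def intro: order_trans[OF S_norm F_bd])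
  qed
  also have "\<dots> = K * t" using set_integral_power[OF \<open>t \<ge> 0\<close>, of K 0] by (simp add: set_lebesgue_integral_def)
  finally show ?thesis .
qed

text \<open>One step of the iteration: integrating \<open>s ^ Suc k\<close> supplies the next
  factorial. The estimate drives the convergence of the iterates as well as uniqueness, which differ
  only in the constant \<open>c\<close>.\<close>

lemma drift_diff_iterate:
  assumes "v \<in> borel_measurable borel" "w \<in> borel_measurable borel" "t \<ge> 0"
    and "\<And>s. 0 \<le> s \<Longrightarrow> s \<le> t \<Longrightarrow> norm (v s - w s) \<le> c * L ^ k * s ^ Suc k / fact (Suc k)"
  shows "norm (drift v t - drift w t) \<le> c * L ^ Suc k * t ^ Suc (Suc k) / fact (Suc (Suc k))"
proof -
  have "norm (drift v t - drift w t) \<le> (LINT s:{0..t}|lborel. L * (c * L ^ k * s ^ Suc k / fact (Suc k)))"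
    by (rule norm_drift_lipschitz_le[OF assms(1,2) _ assms(4)]) (auto intro!: continuous_intros)
  also have "\<dots> = (LINT s:{0..t}|lborel. (c * L ^ Suc k / fact (Suc k)) * s ^ Suc k)"
    by (simp add: mult_ac)
  also have "\<dots> = c * L ^ Suc k * t ^ Suc (Suc k) / fact (Suc (Suc k))"
    unfolding set_integral_power[OF assms(3)] by (simp add: field_simps)
  finally show ?thesis .
qed

lemma summable_iterate_bound: "summable (\<lambda>k. c * L ^ k * t ^ Suc k / fact (Suc k))"
proof -
  have "summable (\<lambda>k. (c * t) * (L * t) ^ k / fact (Suc k))"
  proof (rule summable_comparison_test)
    show "summable (\<lambda>k. \<bar>c * t\<bar> * (\<bar>L * t\<bar> ^ k / fact k))"
      using summable_exp[of "\<bar>L * t\<bar>"] by (intro summable_mult) (simp add: divide_inverse mult.commute)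
    have "\<bar>c * t\<bar> * \<bar>L * t\<bar> ^ k / fact (Suc k) \<le> \<bar>c * t\<bar> * \<bar>L * t\<bar> ^ k / fact k" for k
      by (intro divide_left_mono) (auto simp: fact_mono simp del: fact_Suc)
    then show "\<exists>N. \<forall>k\<ge>N. norm ((c * t) * (L * t) ^ k / fact (Suc k)) \<le> \<bar>c * t\<bar> * (\<bar>L * t\<bar> ^ k / fact k)"
      by (auto simp: abs_mult power_abs simp del: fact_Suc)
  qed
  then show ?thesis by (simp add: power_mult_distrib mult_ac)
qed

primrec picard :: "(real \<Rightarrow> 'h) \<Rightarrow> nat \<Rightarrow> real \<Rightarrow> 'h" where
  "picard u 0 = u"
| "picard u (Suc k) = (\<lambda>t. u t + drift (picard u k) t)"

text \<open>A total limit, so that joint measurability in time and parameters passes from the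
  iterates to \<open>sol\<close> without any statement about convergence.\<close>

definition sol :: "(real \<Rightarrow> 'h) \<Rightarrow> real \<Rightarrow> 'h" where
  "sol u t = lim (\<lambda>k. picard u k t)"

lemma picard_measurable_past:
  assumes G: "past_closed G" and U [measurable]: "(\<lambda>p. U (fst p) (snd p)) \<in> borel_measurable G"
  shows "(\<lambda>p. picard (\<lambda>s. U s (snd p)) k (fst p)) \<in> borel_measurable G"
proof (induction k)
  case (Suc k)
  from drift_measurable_past[OF G, where U = "\<lambda>t a. picard (\<lambda>s. U s a) k t", OF this]
  show ?case by simp
qed simp

lemma sol_measurable_past:
  assumes "past_closed G" "(\<lambda>p. U (fst p) (snd p)) \<in> borel_measurable G"
  shows "(\<lambda>p. sol (\<lambda>s. U s (snd p)) (fst p)) \<in> borel_measurable G"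
  unfolding sol_def using picard_measurable_past[OF assms] by measurable

context
  fixes u :: "real \<Rightarrow> 'h"
  assumes u [measurable]: "u \<in> borel_measurable borel"
begin

lemma picard_measurable [measurable]: "picard u k \<in> borel_measurable borel"
  by (induction k) auto

lemma sol_measurable [measurable]: "sol u \<in> borel_measurable borel"
  unfolding sol_def[abs_def] by measurable

text \<open>The induction starts with \<open>drift u t\<close>, which \<open>norm_drift_le\<close>
  bounds by \<open>K * t\<close>; this is the origin of the factor \<open>K\<close>.\<close>

lemma picard_step_le: "t \<ge> 0 \<Longrightarrow> norm (picard u (Suc k) t - picard u k t) \<le> K * L ^ k * t ^ Suc k / fact (Suc k)"
proof (induction k arbitrary: t)
  case 0 then show ?case using norm_drift_le[OF u, of t] by simp
next
  case (Suc k)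
  then show ?case using drift_diff_iterate[OF picard_measurable[of "Suc k"] picard_measurable[of k] Suc.prems Suc.IH]
    by (simp del: fact_Suc)
qed

lemma picard_tendsto_sol: "t \<ge> 0 \<Longrightarrow> (\<lambda>k. picard u k t) \<longlonglongrightarrow> sol u t"
proof -
  assume "t \<ge> 0"
  then have "summable (\<lambda>k. picard u (Suc k) t - picard u k t)"
    by (intro summable_comparison_test[OF _ summable_iterate_bound[of K t]] exI[of _ 0] allI impI picard_step_le)
  then have "convergent (\<lambda>n. \<Sum>k<n. picard u (Suc k) t - picard u k t)"
    by (simp add: summable_iff_convergent)
  then have "convergent (\<lambda>n. (picard u n t - picard u 0 t) + picard u 0 t)"
    unfolding sum_lessThan_telescope[of "\<lambda>k. picard u k t"] by (intro convergent_add convergent_const)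
  then show ?thesis by (simp add: convergent_LIMSEQ_iff sol_def)
qed

lemma sol_eq: "t \<ge> 0 \<Longrightarrow> sol u t = u t + drift (sol u) t"
proof -
  assume t: "t \<ge> 0"
  have "(\<lambda>k. drift (picard u k) t) \<longlonglongrightarrow> drift (sol u) t"
    unfolding drift_def set_lebesgue_integral_def
  proof (rule integral_dominated_convergence)
    show "integrable lborel (\<lambda>s. indicator {0..t} s *\<^sub>R K)"
      using set_integrable_continuous[of t "\<lambda>_. K"] by (simp add: set_integrable_def)
    have "(\<lambda>k. S (t - s) (F (picard u k s))) \<longlonglongrightarrow> S (t - s) (F (sol u s))" if "s \<ge> 0" for s
      using picard_tendsto_sol[OF that] continuous_F[of UNIV]
      by (intro bounded_linear.tendsto[OF S_lin]) (auto simp: continuous_on_eq_continuous_at intro: isCont_tendsto_compose)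
    then show "AE s in lborel. (\<lambda>k. indicator {0..t} s *\<^sub>R S (t - s) (F (picard u k s)))
        \<longlonglongrightarrow> indicator {0..t} s *\<^sub>R S (t - s) (F (sol u s))"
      by (auto simp: indicator_def)
    show "AE s in lborel. norm (indicator {0..t} s *\<^sub>R S (t - s) (F (picard u k s))) \<le> indicator {0..t} s *\<^sub>R K" for k
      by (auto simp: indicator_def intro: order_trans[OF S_norm F_bd])
  qed measurable
  then have "(\<lambda>k. picard u (Suc k) t) \<longlonglongrightarrow> u t + drift (sol u) t" by (auto intro: tendsto_intros)
  moreover have "(\<lambda>k. picard u (Suc k) t) \<longlonglongrightarrow> sol u t"
    using picard_tendsto_sol[OF t] by (rule LIMSEQ_Suc)
  ultimately show ?thesis by (rule LIMSEQ_unique[symmetric])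
qed

lemma sol_unique:
  assumes v: "v \<in> borel_measurable borel" and eq: "\<And>t. t \<ge> 0 \<Longrightarrow> v t = u t + drift v t" and t: "t \<ge> 0"
  shows "v t = sol u t"
proof -
  \<comment> \<open>The difference of two solutions is a difference of two drifts, each at most
    \<open>K * t\<close>, hence \<open>2 * K\<close>.\<close>
  have "norm (v t - sol u t) \<le> (2 * K) * L ^ k * t ^ Suc k / fact (Suc k)" if "t \<ge> 0" for k t
    using that
  proof (induction k arbitrary: t)
    case 0
    have "norm (drift v t - drift (sol u) t) \<le> norm (drift v t) + norm (drift (sol u) t)"
      by (rule norm_triangle_ineq4)
    then show ?case using norm_drift_le[OF v 0] norm_drift_le[OF sol_measurable 0] 0 by (simp add: eq sol_eq)
  next
    case (Suc k)
    show ?case using drift_diff_iterate[OF v sol_measurable Suc.prems Suc.IH] Suc.prems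
      by (simp add: eq[of t] sol_eq[of t] del: fact_Suc)
  qed
  from LIMSEQ_le_const[OF summable_LIMSEQ_zero[OF summable_iterate_bound], of "norm (v t - sol u t)", OF exI[of _ 0]] this[OF t]
  have "norm (v t - sol u t) \<le> 0" by blast
  then show ?thesis by simp
qed

end

lemma drift_cong_AE:
  assumes [measurable]: "v \<in> borel_measurable borel" "w \<in> borel_measurable borel"
    and "AE s in lborel. s \<ge> 0 \<longrightarrow> v s = w s"
  shows "drift v t = drift w t"
  unfolding drift_def set_lebesgue_integral_def using assms(3)
  by (intro integral_cong_AE) (auto simp: indicator_def)

text \<open>The drift ignores null sets of times, so \<open>w = u + drift v\<close> has the same
  drift as \<open>v\<close> and solves the equation at all nonnegative times. This form fits what is
  available for random paths: the equation at almost every time and at the one time of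
  interest.\<close>

lemma sol_unique_AE:
  assumes [measurable]: "u \<in> borel_measurable borel" "v \<in> borel_measurable borel"
    and eq: "AE s in lborel. s \<ge> 0 \<longrightarrow> v s = u s + drift v s" and t: "t \<ge> 0" "v t = u t + drift v t"
  shows "v t = sol u t"
proof -
  define w where "w s = u s + drift v s" for s
  have [measurable]: "w \<in> borel_measurable borel" unfolding w_def[abs_def] by measurable
  have "drift v = drift w"
  proof
    show "drift v s = drift w s" for s using eq by (intro drift_cong_AE) (auto simp: w_def)
  qed
  then have "w t = sol u t" using t(1) by (intro sol_unique) (simp_all add: w_def[abs_def])
  then show ?thesis using t by (simp add: w_def)
qed

lemma sol_cong_AE:
  assumes u [measurable]: "u \<in> borel_measurable borel" "u' \<in> borel_measurable borel"
    and eq: "AE s in lborel. s \<ge> 0 \<longrightarrow> u s = u' s" and t: "t \<ge> 0" "u t = u' t"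
  shows "sol u t = sol u' t"
  using eq t sol_eq[OF u(1)] by (intro sol_unique_AE u sol_measurable) (auto elim!: eventually_mono)

lemma sol_lipschitz:
  assumes [measurable]: "u \<in> borel_measurable borel" "u' \<in> borel_measurable borel"
    and close: "\<And>s. s \<ge> 0 \<Longrightarrow> norm (u s - u' s) \<le> \<delta>" and t: "t \<ge> 0"
  shows "norm (sol u t - sol u' t) \<le> \<delta> * exp (L * t)"
proof -
  have \<delta>: "\<delta> \<ge> 0" using close[of 0] norm_ge_zero order_trans by blast
  \<comment> \<open>The bound reproduces itself under the iteration: \<open>\<delta>\<close> plus
    the integral of \<open>L * \<delta> * exp (L * s)\<close> over \<open>[0, t]\<close> is again
    \<open>\<delta> * exp (L * t)\<close>.\<close>
  have bd: "norm (picard u k t - picard u' k t) \<le> \<delta> * exp (L * t)" if "t \<ge> 0" for k t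
    using that
  proof (induction k arbitrary: t)
    case 0
    have "\<delta> * 1 \<le> \<delta> * exp (L * t)" using \<delta> L_nonneg 0 by (intro mult_left_mono) auto
    then show ?case using close[OF 0] by simp
  next
    case (Suc k)
    have "norm (drift (picard u k) t - drift (picard u' k) t) \<le> (LINT s:{0..t}|lborel. L * (\<delta> * exp (L * s)))"
      using Suc by (intro norm_drift_lipschitz_le) (auto intro!: continuous_intros)
    also have "\<dots> = \<delta> * exp (L * t) - \<delta> * exp (L * 0)"
      unfolding set_lebesgue_integral_def
      by (simp only: real_scaleR_def mult.commute[of "indicator _ _"],
          rule integral_FTC_Icc_real[OF Suc.prems])
         (auto intro!: derivative_eq_intros continuous_intros)
    finally have "norm (drift (picard u k) t - drift (picard u' k) t) \<le> \<delta> * exp (L * t) - \<delta>" by simp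
    then show ?case using close[OF Suc.prems]
        norm_triangle_ineq[of "u t - u' t" "drift (picard u k) t - drift (picard u' k) t"]
      by (simp add: algebra_simps)
  qed
  have "(\<lambda>k. norm (picard u k t - picard u' k t)) \<longlonglongrightarrow> norm (sol u t - sol u' t)"
    by (intro tendsto_intros picard_tendsto_sol t) auto
  then show ?thesis using bd[OF t] by (intro LIMSEQ_le_const2) auto
qed

lemma drift_split:
  assumes [measurable]: "v \<in> borel_measurable borel" and t: "t \<ge> 0" "r \<ge> 0"
  shows "drift v (t + r) = S r (drift v t) + drift (\<lambda>q. v (t + q)) r"
proof -
  let ?f = "\<lambda>s. S (t + r - s) (F (v s))"
  have int: "set_integrable lborel A ?f" if "A \<in> sets borel" "A \<subseteq> {0..t + r}" for A
    using set_integrable_subset[OF drift_integrable[of v "t + r" "t + r"]] that by auto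
  have "drift v (t + r) = (LINT s:{0..t} \<union> {t<..t + r}|lborel. ?f s)"
    unfolding drift_def using t by (intro arg_cong[where f = "\<lambda>A. set_lebesgue_integral lborel A _"]) auto
  also have "\<dots> = (LINT s:{0..t}|lborel. ?f s) + (LINT s:{t<..t + r}|lborel. ?f s)"
    using t by (intro set_integral_Un int) auto
  also have "(LINT s:{0..t}|lborel. ?f s) = (LINT s:{0..t}|lborel. S r (S (t - s) (F (v s))))"
    using t S_add[of r "t - s" for s] by (intro set_lebesgue_integral_cong) (auto simp: algebra_simps)
  also have "\<dots> = S r (drift v t)"
    unfolding drift_def set_lebesgue_integral_def
    using drift_integrable[of v t t] assms(1)
    by (subst integral_bounded_linear[OF S_lin, symmetric])
       (simp_all add: set_integrable_def linear_scale[OF bounded_linear.linear[OF S_lin]])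
  also have "(LINT s:{t<..t + r}|lborel. ?f s) = (LINT q|lborel. indicator {t<..t + r} (t + 1 * q) *\<^sub>R ?f (t + 1 * q))"
    unfolding set_lebesgue_integral_def by (subst lborel_integral_real_affine[where c = 1 and t = t]) auto
  also have "\<dots> = drift (\<lambda>q. v (t + q)) r"
    unfolding drift_def set_lebesgue_integral_def using AE_lborel_singleton[of 0]
    by (intro integral_cong_AE) (auto simp: indicator_def elim!: eventually_mono)
  finally show ?thesis .
qed

text \<open>The input restarted at \<open>t\<close> consists of the transported state and of what is
  new in \<open>u\<close> after \<open>t\<close>. For \<open>u s = sgr s x + ZA s\<close> the terms
  with \<open>x\<close> cancel in the second part, so only noise after \<open>t\<close>
  remains.\<close>

lemma sol_flow:
  assumes [measurable]: "u \<in> borel_measurable borel" and t: "t \<ge> 0" "r \<ge> 0"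
  shows "sol u (t + r) = sol (\<lambda>r. S r (sol u t) + (u (t + r) - S r (u t))) r"
proof (rule sol_unique[where v = "\<lambda>r. sol u (t + r)"])
  fix r :: real assume r: "r \<ge> 0"
  have "S r (sol u t) = S r (u t) + S r (drift (sol u) t)"
    using sol_eq[of u t] t by (simp add: linear_add[OF bounded_linear.linear[OF S_lin]])
  then show "sol u (t + r) = S r (sol u t) + (u (t + r) - S r (u t)) + drift (\<lambda>r. sol u (t + r)) r"
    using sol_eq[of u "t + r"] drift_split[of "sol u" t r] t r by simp
qed (use t in measurable)

end

section \<open>The stochastic convolution\<close>

definition dyad :: "nat \<Rightarrow> real \<Rightarrow> real" where
  "dyad k s = of_int (\<lceil>s * 2 ^ k\<rceil> - 1) / 2 ^ k"

text \<open>The ceiling minus one, rather than the floor, keeps the sample strictly before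
  \<open>s\<close> even when \<open>s\<close> is dyadic itself. Left limits and predictability both
  depend on this strictness.\<close>

lemma dyad_less: "dyad k s < s"
proof -
  have "of_int (\<lceil>s * 2 ^ k\<rceil> - 1) < s * 2 ^ k" by linarith
  then show ?thesis by (simp add: dyad_def pos_divide_less_eq)
qed

lemma dyad_ge: "s - (1/2) ^ k \<le> dyad k s"
proof -
  have "s * 2 ^ k - 1 \<le> of_int (\<lceil>s * 2 ^ k\<rceil> - 1)" by linarith
  then have "(s * 2 ^ k - 1) / 2 ^ k \<le> dyad k s" unfolding dyad_def by (intro divide_right_mono) auto
  moreover have "(s * 2 ^ k - 1) / 2 ^ k = s - (1/2) ^ k" by (simp add: field_simps power_divide)
  ultimately show ?thesis by simp
qed

lemma dyad_nonneg: "s > 0 \<Longrightarrow> 0 \<le> dyad k s"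
proof -
  assume "s > 0"
  then have "\<lceil>s * 2 ^ k\<rceil> \<ge> 1" by simp
  then show ?thesis by (simp add: dyad_def)
qed

lemma dyad_tendsto: "(\<lambda>k. dyad k s) \<longlonglongrightarrow> s"
proof (rule real_tendsto_sandwich[where h = "\<lambda>_. s" and f = "\<lambda>k. s - (1/2) ^ k"])
  have "(\<lambda>k. s - (1/2) ^ k) \<longlonglongrightarrow> s - 0" by (intro tendsto_intros LIMSEQ_power_zero) auto
  then show "(\<lambda>k. s - (1/2) ^ k) \<longlonglongrightarrow> s" by simp
qed (auto intro: always_eventually dyad_ge less_imp_le[OF dyad_less])

lemma dyad_at_left: "filterlim (\<lambda>k. dyad k s) (at_left s) sequentially"
proof (rule filterlim_at_withinI[OF dyad_tendsto])
  show "\<forall>\<^sub>F k in sequentially. dyad k s \<in> {..<s} - {s}"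
    using dyad_less by (intro always_eventually allI) (auto simp: less_imp_neq)
qed

text \<open>The left-limit process. Sampling it at dyadic times from below makes it a predictable functional,
  defined for every path (with an unspecified value where the limit does not exist).\<close>

definition lft :: "(real \<Rightarrow> real) \<Rightarrow> real \<Rightarrow> real" where
  "lft z s = (if s \<le> 0 then 0 else lim (\<lambda>k. z (dyad k s)))"

text \<open>Samples of a positive time are nonnegative, and elsewhere \<open>lft\<close> is 0. Thus
  \<open>lft\<close> factors through the restriction of a path to \<open>{0..}\<close>, as it must
  for a functional on \<open>path_space\<close>.\<close>

lemma lft_cong: "(\<And>r. r \<ge> 0 \<Longrightarrow> z r = z' r) \<Longrightarrow> lft z = lft z'"
proof
  fix s assume eq: "\<And>r. r \<ge> 0 \<Longrightarrow> z r = z' r"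
  show "lft z s = lft z' s"
  proof (cases "s \<le> 0")
    case False
    then have "z (dyad k s) = z' (dyad k s)" for k by (intro eq dyad_nonneg) simp
    then show ?thesis by (simp only: lft_def)
  qed (simp add: lft_def)
qed

lemma lft_eq: "s > 0 \<Longrightarrow> (z \<longlongrightarrow> l) (at_left s) \<Longrightarrow> lft z s = l"
proof -
  assume s: "s > 0" and z: "(z \<longlongrightarrow> l) (at_left s)"
  have "(\<lambda>k. z (dyad k s)) \<longlonglongrightarrow> l" by (rule filterlim_compose[OF z dyad_at_left])
  then show ?thesis using s by (simp add: lft_def limI)
qed

lemma cadlag_tendsto_lft:
  assumes "cadlag z" "s > 0" shows "(z \<longlongrightarrow> lft z s) (at_left s)"
proof -
  obtain l where "(z \<longlongrightarrow> l) (at_left s)" using assms by (auto simp: cadlag_def)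
  then show ?thesis using lft_eq[OF assms(2)] by simp
qed

text \<open>Bisection: bounds combine on adjacent intervals, and near each point the one-sided
  limits bound the path. The clause \<open>0 \<le> s\<close> in \<open>?P\<close> reflects that
  \<open>cadlag\<close> constrains nonnegative times only.\<close>

lemma cadlag_bounded:
  assumes z: "cadlag z" and T: "T \<ge> 0" shows "\<exists>B. \<forall>s. 0 \<le> s \<and> s \<le> T \<longrightarrow> \<bar>z s\<bar> \<le> B"
proof -
  let ?P = "\<lambda>a b. \<exists>B. \<forall>s. 0 \<le> s \<and> a \<le> s \<and> s \<le> b \<longrightarrow> \<bar>z s\<bar> \<le> B"
  have "?P 0 T"
    using T
  proof (rule Bolzano[where P = ?P])
    fix a b c assume "?P a b" "?P b c"
    then obtain B B' where "\<forall>s. 0 \<le> s \<and> a \<le> s \<and> s \<le> b \<longrightarrow> \<bar>z s\<bar> \<le> B"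
      "\<forall>s. 0 \<le> s \<and> b \<le> s \<and> s \<le> c \<longrightarrow> \<bar>z s\<bar> \<le> B'" by blast
    then have "\<forall>s. 0 \<le> s \<and> a \<le> s \<and> s \<le> c \<longrightarrow> \<bar>z s\<bar> \<le> max B B'" by (metis le_max_iff_disj linear)
    then show "?P a c" by blast
  next
    fix x :: real assume x: "0 \<le> x"
    have near: "\<exists>d>0. \<forall>s\<in>I. \<bar>s - x\<bar> < d \<longrightarrow> s \<noteq> x \<longrightarrow> \<bar>z s\<bar> \<le> \<bar>l\<bar> + 1"
      if "(z \<longlongrightarrow> l) (at x within I)" for l I
    proof -
      have "\<forall>\<^sub>F s in at x within I. dist (z s) l < 1" using that by (rule tendstoD) simp
      then obtain d where "d > 0" "\<And>s. s \<in> I \<Longrightarrow> s \<noteq> x \<Longrightarrow> \<bar>s - x\<bar> < d \<Longrightarrow> \<bar>z s - l\<bar> < 1"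
        by (auto simp: eventually_at dist_real_def)
      moreover from this have "\<bar>z s\<bar> \<le> \<bar>l\<bar> + 1" if "s \<in> I" "s \<noteq> x" "\<bar>s - x\<bar> < d" for s
        using that by fastforce
      ultimately show ?thesis by blast
    qed
    obtain d1 where d1: "d1 > 0" "\<And>s. x < s \<Longrightarrow> \<bar>s - x\<bar> < d1 \<Longrightarrow> \<bar>z s\<bar> \<le> \<bar>z x\<bar> + 1"
    proof -
      have "(z \<longlongrightarrow> z x) (at x within {x<..})" using z x by (simp add: cadlag_def)
      from near[OF this] that show ?thesis by (metis greaterThan_iff less_irrefl)
    qed
    obtain d2 l where d2: "d2 > 0" "\<And>s. s < x \<Longrightarrow> 0 \<le> s \<Longrightarrow> \<bar>s - x\<bar> < d2 \<Longrightarrow> \<bar>z s\<bar> \<le> l"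
    proof (cases "x > 0")
      case True
      from near[OF cadlag_tendsto_lft[OF z this]] that show ?thesis by (metis lessThan_iff less_irrefl)
    next
      case False
      then show ?thesis using that[of 1 0] x by auto
    qed
    have "?P a b" if ab: "a \<le> x" "x \<le> b" "b - a < min d1 d2" for a b
    proof -
      have "\<bar>z s\<bar> \<le> max l (\<bar>z x\<bar> + 1)" if s: "0 \<le> s" "a \<le> s" "s \<le> b" for s
      proof -
        consider "s < x" | "s = x" | "x < s" by linarith
        then show ?thesis
        proof cases
          case 1
          then have "\<bar>z s\<bar> \<le> l" using s ab by (intro d2) auto
          then show ?thesis by simp
        next
          case 3
          then have "\<bar>z s\<bar> \<le> \<bar>z x\<bar> + 1" using s ab by (intro d1) auto
          then show ?thesis by simp
        qed simp
      qed
      then show ?thesis by blast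
    qed
    then show "\<exists>d>0. \<forall>a b. a \<le> x \<and> x \<le> b \<and> b - a < d \<longrightarrow> ?P a b"
      using d1(1) d2(1) by (intro exI[of _ "min d1 d2"]) auto
  qed
  then show ?thesis by auto
qed

lemma lft_bounded:
  assumes z: "cadlag z" and bd: "\<And>s. 0 \<le> s \<Longrightarrow> s \<le> T \<Longrightarrow> \<bar>z s\<bar> \<le> B" and s: "s \<le> T" "B \<ge> 0"
  shows "\<bar>lft z s\<bar> \<le> B"
proof (cases "s > 0")
  case True
  have "(\<lambda>k. \<bar>z (dyad k s)\<bar>) \<longlonglongrightarrow> \<bar>lft z s\<bar>"
    by (intro tendsto_rabs filterlim_compose[OF cadlag_tendsto_lft[OF z True] dyad_at_left])
  moreover have "\<bar>z (dyad k s)\<bar> \<le> B" for k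
    using s dyad_less[of k s] dyad_nonneg[OF True, of k] by (intro bd) auto
  ultimately show ?thesis by (intro LIMSEQ_le_const2) auto
qed (use s in \<open>simp add: lft_def\<close>)

text \<open>For fixed \<open>k\<close> the sample time takes countably many values
  \<open>j / 2 ^ k\<close>, all strictly before the current time. So \<open>U s\<close> enters only
  after truncation to \<open>s < fst p\<close>, and for adapted \<open>U\<close> this truncation is
  predictable.\<close>

lemma lft_measurable_past:
  assumes fst [measurable]: "fst \<in> borel_measurable G"
    and U: "\<And>s. s \<ge> 0 \<Longrightarrow> (\<lambda>p. if s < fst p then U s (snd p) else 0) \<in> borel_measurable G"
  shows "(\<lambda>p. lft (\<lambda>s. U s (snd p)) (fst p)) \<in> borel_measurable G"
proof -
  have "(\<lambda>p. (if real j / 2 ^ k < fst p then U (real j / 2 ^ k) (snd p) else 0)) \<in> borel_measurable G" for j k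
    by (rule U) simp
  then have [measurable]: "(\<lambda>p. (\<lambda>j p. if real j / 2 ^ k < fst p then U (real j / 2 ^ k) (snd p) else 0)
      (nat (\<lceil>fst p * 2 ^ k\<rceil> - 1)) p) \<in> borel_measurable G" for k
    by (rule measurable_compose_countable) measurable
  have eq: "U (dyad k (fst p)) (snd p) = (\<lambda>j p. if real j / 2 ^ k < fst p then U (real j / 2 ^ k) (snd p) else 0)
      (nat (\<lceil>fst p * 2 ^ k\<rceil> - 1)) p" if "fst p > 0" for p k
  proof -
    have "real (nat (\<lceil>fst p * 2 ^ k\<rceil> - 1)) / 2 ^ k = dyad k (fst p)" using that by (simp add: dyad_def of_nat_nat)
    then show ?thesis using dyad_less[of k "fst p"] by simp
  qed
  have "(\<lambda>p. lft (\<lambda>s. U s (snd p)) (fst p)) = (\<lambda>p. if fst p \<le> 0 then 0 else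
      lim (\<lambda>k. (\<lambda>j p. if real j / 2 ^ k < fst p then U (real j / 2 ^ k) (snd p) else 0)
      (nat (\<lceil>fst p * 2 ^ k\<rceil> - 1)) p))"
    by (rule ext) (simp add: lft_def eq cong: if_cong)
  also have "\<dots> \<in> borel_measurable G" by measurable
  finally show ?thesis .
qed

lemma lft_measurable_pair:
  assumes U: "\<And>s. s \<ge> 0 \<Longrightarrow> U s \<in> borel_measurable N"
  shows "(\<lambda>p. lft (\<lambda>s. U s (snd p)) (fst p)) \<in> borel_measurable (borel \<Otimes>\<^sub>M N)"
proof (rule lft_measurable_past)
  fix s :: real assume "s \<ge> 0"
  note [measurable] = U[OF this]
  show "(\<lambda>p. if s < fst p then U s (snd p) else 0) \<in> borel_measurable (borel \<Otimes>\<^sub>M N)" by measurable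
qed measurable

lemma lft_measurable_predictable:
  assumes filt: "usual_filtration M \<F>" and U: "\<And>s. s \<ge> 0 \<Longrightarrow> U s \<in> borel_measurable (\<F> s)"
  shows "(\<lambda>p. lft (\<lambda>s. U s (snd p)) (fst p)) \<in> borel_measurable (predictable_sigma M \<F>)"
proof (rule lft_measurable_past[OF fst_predictable[OF filt]])
  fix s :: real assume s: "s \<ge> 0"
  let ?P = "predictable_sigma M \<F>"
  have C: "{s<..} \<times> space M \<in> sets ?P"
    by (rule predictable_ray[OF filt s filtration_top[OF filt s]])
  show "(\<lambda>p. if s < fst p then U s (snd p) else 0) \<in> borel_measurable ?P"
  proof (rule borel_measurableI)
    fix B :: "real set" assume "open B"
    have V: "{s<..} \<times> (U s -` B \<inter> space M) \<in> sets ?P"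
      using measurable_sets[OF U[OF s], of B] \<open>open B\<close>
      by (intro predictable_ray[OF filt s]) (simp add: filtration_space[OF filt s])
    have "(\<lambda>p. if s < fst p then U s (snd p) else 0) -` B \<inter> space ?P
      = {s<..} \<times> (U s -` B \<inter> space M) \<union> (if 0 \<in> B then space ?P - {s<..} \<times> space M else {})"
      using s by (auto simp: space_predictable[OF filt] split: if_splits)
    then show "(\<lambda>p. if s < fst p then U s (snd p) else 0) -` B \<inter> space ?P \<in> sets ?P"
      using V C by auto
  qed
qed

lemma borel_measurable_section:
  assumes "(\<lambda>p. f (fst p)) \<in> borel_measurable (borel \<Otimes>\<^sub>M count_space (UNIV :: unit set))"
  shows "f \<in> borel_measurable borel"
proof -
  have "(\<lambda>t. (t, ())) \<in> borel \<rightarrow>\<^sub>M borel \<Otimes>\<^sub>M count_space (UNIV :: unit set)" by measurable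
  from measurable_compose[OF this assms] show ?thesis by simp
qed

lemma lft_measurable [measurable]: "lft z \<in> borel_measurable borel"
  by (rule borel_measurable_section, rule lft_measurable_pair[where U = "\<lambda>s _. z s"]) measurable

text \<open>Integration by parts: \<open>conv g z s\<close> is \<open>\<integral>\<^sub>0\<^sup>s e\<^sup>-\<^sup>g\<^sup>(\<^sup>s\<^sup>-\<^sup>r\<^sup>) dz\<^sub>r\<close>, up to replacing \<open>z\<^sub>s\<close> by its left limit.\<close>

definition conv :: "real \<Rightarrow> (real \<Rightarrow> real) \<Rightarrow> real \<Rightarrow> real" where
  "conv g z s = lft z s - (LINT r:{0..s}|lborel. g * exp (- g * (s - r)) * lft z r)"

lemma conv_zero [simp]: "conv g z 0 = 0"
proof -
  have "indicator {0..0} r *\<^sub>R (g * exp (- g * (0 - r)) * lft z r) = 0" for r :: real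
    by (cases "r = 0") (simp_all add: lft_def)
  then show ?thesis unfolding conv_def set_lebesgue_integral_def by (simp only: integral_zero) (simp add: lft_def)
qed

lemma conv_cong: "(\<And>r. r \<ge> 0 \<Longrightarrow> z r = z' r) \<Longrightarrow> conv g z = conv g z'"
proof -
  assume "\<And>r. r \<ge> 0 \<Longrightarrow> z r = z' r"
  then have "lft z = lft z'" by (rule lft_cong)
  then show ?thesis by (simp add: conv_def fun_eq_iff)
qed

lemma conv_measurable_past:
  assumes G: "past_closed G" and U: "(\<lambda>p. lft (\<lambda>s. U s (snd p)) (fst p)) \<in> borel_measurable G"
  shows "(\<lambda>p. conv g (\<lambda>s. U s (snd p)) (fst p)) \<in> borel_measurable G"
  unfolding conv_def
  by (intro borel_measurable_diff U
      past_closed_integral[OF G, where U = "\<lambda>s a. lft (\<lambda>s. U s a) s", OF U]) (simp add: case_prod_beta, measurable)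

lemma conv_measurable [measurable]: "conv g z \<in> borel_measurable borel"
  by (rule borel_measurable_section,
      rule conv_measurable_past[OF past_closed_pair, where U = "\<lambda>s _. z s"],
      rule lft_measurable_pair[where U = "\<lambda>s _. z s"]) measurable

lemma conv_integrable:
  assumes z: "cadlag z"
  shows "set_integrable lborel {a..b} (\<lambda>r. g * exp (- g * (s - r)) * lft z r)"
proof -
  obtain B where B: "\<And>s. 0 \<le> s \<Longrightarrow> s \<le> max 0 b \<Longrightarrow> \<bar>z s\<bar> \<le> B" using cadlag_bounded[OF z, of "max 0 b"] by auto
  then have "B \<ge> 0" using B[of 0] by (meson abs_ge_zero max.cobounded1 order_refl order_trans)
  have "continuous_on {a..b} (\<lambda>r. g * exp (- g * (s - r)))" by (intro continuous_intros)
  then have "bounded ((\<lambda>r. g * exp (- g * (s - r))) ` {a..b})"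
    by (intro compact_imp_bounded compact_continuous_image compact_Icc)
  then obtain C where "\<forall>x\<in>(\<lambda>r. g * exp (- g * (s - r))) ` {a..b}. norm x \<le> C"
    unfolding bounded_iff by blast
  then have C: "\<And>r. r \<in> {a..b} \<Longrightarrow> \<bar>g * exp (- g * (s - r))\<bar> \<le> C" by auto
  show ?thesis
    unfolding set_integrable_def
  proof (rule integrableI_bounded_set_indicator[where B = "C * B"])
    show "AE r in lborel. r \<in> {a..b} \<longrightarrow> norm (g * exp (- g * (s - r)) * lft z r) \<le> C * B"
    proof (intro AE_I2 impI)
      fix r assume r: "r \<in> {a..b}"
      then have "\<bar>lft z r\<bar> \<le> B" using \<open>B \<ge> 0\<close> by (intro lft_bounded[OF z B]) auto
      moreover have "0 \<le> C" using C[OF r] by simp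
      ultimately show "norm (g * exp (- g * (s - r)) * lft z r) \<le> C * B"
        unfolding real_norm_def abs_mult[of "g * exp (- g * (s - r))"] using C[OF r] by (intro mult_mono) auto
    qed
  qed (auto simp: emeasure_lborel_Icc_eq)
qed

lemma
  assumes z: "cadlag z" and t: "t \<ge> 0"
  shows cadlag_shift: "cadlag (\<lambda>r. z (t + r) - c)"
    and lft_shift: "r > 0 \<Longrightarrow> lft (\<lambda>r. z (t + r) - c) r = lft z (t + r) - c"
proof -
  have right: "((\<lambda>r. z (t + r) - c) \<longlongrightarrow> z (t + r) - c) (at_right r)" if "r \<ge> 0" for r
  proof -
    have "filterlim (\<lambda>r. t + r) (at_right (t + r)) (at_right r)"
      by (auto simp: filterlim_at eventually_at intro!: tendsto_intros exI[of _ 1])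
    moreover have "(z \<longlongrightarrow> z (t + r)) (at_right (t + r))" using z t that by (simp add: cadlag_def)
    ultimately show ?thesis by (intro tendsto_intros) (rule filterlim_compose)
  qed
  have left: "((\<lambda>r. z (t + r) - c) \<longlongrightarrow> lft z (t + r) - c) (at_left r)" if "r > 0" for r
  proof -
    have "filterlim (\<lambda>r. t + r) (at_left (t + r)) (at_left r)"
      by (auto simp: filterlim_at eventually_at intro!: tendsto_intros exI[of _ 1])
    moreover have "(z \<longlongrightarrow> lft z (t + r)) (at_left (t + r))" using z t that by (intro cadlag_tendsto_lft) auto
    ultimately show ?thesis by (intro tendsto_intros) (rule filterlim_compose)
  qed
  show "cadlag (\<lambda>r. z (t + r) - c)" unfolding cadlag_def using right left by blast
  show "lft (\<lambda>r. z (t + r) - c) r = lft z (t + r) - c" if "r > 0"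
    by (rule lft_eq[OF that left[OF that]])
qed

text \<open>Subtracting the constant \<open>z t\<close> contributes \<open>- z t\<close> at the
  endpoint and \<open>z t * (1 - exp (- g * s))\<close> through the integral, in total
  \<open>- exp (- g * s) * z t\<close>. This matches the endpoint term of
  \<open>exp (- g * s) * conv g z t\<close> because \<open>z\<close> does not jump at
  \<open>t\<close>.\<close>

lemma conv_shift:
  assumes z: "cadlag z" and t: "t \<ge> 0" "lft z t = z t" and s: "s \<ge> 0"
  shows "conv g (\<lambda>r. z (t + r) - z t) s = conv g z (t + s) - exp (- g * s) * conv g z t"
proof (cases "s = 0")
  case False
  then have s: "s > 0" using s by simp
  note lft = lft_shift[OF z t(1), of _ "z t"]
  let ?k = "\<lambda>r. g * exp (- g * (t + s - r))"
  have fin: "set_integrable lborel A (\<lambda>r. ?k r * lft z r)" if "A \<in> sets borel" "A \<subseteq> {0..t + s}" for A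
    using set_integrable_subset[OF conv_integrable[OF z, of 0 "t + s" g "t + s"]] that by auto
  have "(LINT r:{0..t + s}|lborel. ?k r * lft z r) = (LINT r:{0..t} \<union> {t<..t + s}|lborel. ?k r * lft z r)"
    using t s by (intro arg_cong[where f = "\<lambda>A. set_lebesgue_integral lborel A _"]) auto
  also have "\<dots> = (LINT r:{0..t}|lborel. ?k r * lft z r) + (LINT r:{t<..t + s}|lborel. ?k r * lft z r)"
    using t s by (intro set_integral_Un fin) auto
  also have "(LINT r:{0..t}|lborel. ?k r * lft z r)
      = exp (- g * s) * (LINT r:{0..t}|lborel. g * exp (- g * (t - r)) * lft z r)"
    by (subst set_integral_mult_right[symmetric], intro set_lebesgue_integral_cong)
       (auto simp: algebra_simps simp flip: exp_add)
  also have "(LINT r:{t<..t + s}|lborel. ?k r * lft z r)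
      = (LINT q|lborel. indicator {t<..t + s} (t + 1 * q) *\<^sub>R (?k (t + 1 * q) * lft z (t + 1 * q)))"
    unfolding set_lebesgue_integral_def by (subst lborel_integral_real_affine[where c = 1 and t = t]) auto
  also have "\<dots> = (LINT q:{0..s}|lborel. g * exp (- g * (s - q)) * lft z (t + q))"
    unfolding set_lebesgue_integral_def
  proof (rule integral_cong_AE)
    show "AE q in lborel. indicator {t<..t + s} (t + 1 * q) *\<^sub>R (?k (t + 1 * q) * lft z (t + 1 * q))
        = indicator {0..s} q *\<^sub>R (g * exp (- g * (s - q)) * lft z (t + q))"
      using AE_lborel_singleton[of 0] by eventually_elim (auto simp: indicator_def)
  qed measurable
  also have "\<dots> = (LINT q:{0..s}|lborel. g * exp (- g * (s - q)) * lft (\<lambda>r. z (t + r) - z t) q + g * exp (- g * (s - q)) * z t)"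
    unfolding set_lebesgue_integral_def
  proof (rule integral_cong_AE)
    show "AE q in lborel. indicator {0..s} q *\<^sub>R (g * exp (- g * (s - q)) * lft z (t + q))
        = indicator {0..s} q *\<^sub>R (g * exp (- g * (s - q)) * lft (\<lambda>r. z (t + r) - z t) q
          + g * exp (- g * (s - q)) * z t)"
      using AE_lborel_singleton[of 0]
      by eventually_elim (auto simp: indicator_def lft right_diff_distrib)
  qed measurable
  also have "\<dots> = (LINT q:{0..s}|lborel. g * exp (- g * (s - q)) * lft (\<lambda>r. z (t + r) - z t) q)
      + (LINT q:{0..s}|lborel. g * exp (- g * (s - q)) * z t)"
  proof (rule set_integral_add)
    show "set_integrable lborel {0..s} (\<lambda>q. g * exp (- g * (s - q)) * lft (\<lambda>r. z (t + r) - z t) q)"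
      by (rule conv_integrable[OF cadlag_shift[OF z t(1)]])
    show "set_integrable lborel {0..s} (\<lambda>q. g * exp (- g * (s - q)) * z t)"
      by (intro set_integrable_continuous continuous_intros)
  qed
  also have "(LINT q:{0..s}|lborel. g * exp (- g * (s - q)) * z t) = exp (- g * (s - s)) * z t - exp (- g * (s - 0)) * z t"
    unfolding set_lebesgue_integral_def using s
    by (simp only: real_scaleR_def mult.commute[of "indicator _ _"], intro integral_FTC_Icc_real)
       (auto intro!: derivative_eq_intros continuous_intros)
  finally have split: "(LINT r:{0..t + s}|lborel. ?k r * lft z r) =
      exp (- g * s) * (LINT r:{0..t}|lborel. g * exp (- g * (t - r)) * lft z r)
      + ((LINT q:{0..s}|lborel. g * exp (- g * (s - q)) * lft (\<lambda>r. z (t + r) - z t) q)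
      + (exp (- g * (s - s)) * z t - exp (- g * (s - 0)) * z t))" .
  show ?thesis unfolding conv_def split lft[OF s] t(2) by (simp add: right_diff_distrib)
qed simp

section \<open>Riemann sums against cadlag paths\<close>

lemma partition_cell:
  fixes \<tau> :: "nat \<Rightarrow> real"
  assumes "\<tau> 0 < s" "s \<le> \<tau> N" shows "\<exists>i<N. \<tau> i < s \<and> s \<le> \<tau> (Suc i)"
  using assms(2)
proof (induction N)
  case (Suc N)
  show ?case
  proof (cases "s \<le> \<tau> N")
    case True
    then show ?thesis using Suc.IH less_Suc_eq by blast
  next
    case False
    then show ?thesis using Suc.prems by (intro exI[of _ N]) auto
  qed
qed (use assms in auto)

lemma partition_mono:
  fixes \<tau> :: "nat \<Rightarrow> real"
  assumes "\<And>i. i < N \<Longrightarrow> \<tau> i \<le> \<tau> (Suc i)" and "i \<le> j" "j \<le> N"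
  shows "\<tau> i \<le> \<tau> j"
  using assms(2,3)
proof (induction rule: dec_induct)
  case (step n)
  then show ?case using assms(1)[of n] by auto
qed simp

lemma sum_partition_cell:
  fixes \<tau> :: "nat \<Rightarrow> real" and c :: "nat \<Rightarrow> real"
  assumes mono: "\<And>i. i < N \<Longrightarrow> \<tau> i \<le> \<tau> (Suc i)" and j: "j < N" "\<tau> j < s" "s \<le> \<tau> (Suc j)"
  shows "(\<Sum>i<N. indicator {\<tau> i<..\<tau> (Suc i)} s * c i) = c j"
proof -
  have "indicator {\<tau> i<..\<tau> (Suc i)} s * c i = (if i = j then c j else 0)" if "i < N" for i
  proof (cases i j rule: linorder_cases)
    case less
    then have "\<tau> (Suc i) \<le> \<tau> j" using j by (intro partition_mono[of N \<tau>, OF mono]) auto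
    then show ?thesis using less j by auto
  next
    case greater
    then have "\<tau> (Suc j) \<le> \<tau> i" using that by (intro partition_mono[of N \<tau>, OF mono]) auto
    then show ?thesis using greater j by auto
  qed (use j in auto)
  then have "(\<Sum>i<N. indicator {\<tau> i<..\<tau> (Suc i)} s * c i) = (\<Sum>i<N. if i = j then c j else 0)"
    by (intro sum.cong) auto
  then show ?thesis using j by simp
qed

lemma sum_by_parts:
  fixes f z :: "nat \<Rightarrow> real"
  shows "(\<Sum>i<m. f i * (z (Suc i) - z i)) = f m * z m - f 0 * z 0 - (\<Sum>i<m. (f (Suc i) - f i) * z (Suc i))"
  by (induction m) (auto simp: algebra_simps)

text \<open>After summation by parts the increments of the integrand are weighted by the values of \<open>z\<close> at the
  right endpoints, which converge by right-continuity.\<close>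

lemma riemann_sums_tendsto_conv:
  fixes \<tau> :: "nat \<Rightarrow> nat \<Rightarrow> real"
  assumes z: "cadlag z" "z 0 = 0" and t: "t \<ge> 0" "lft z t = z t" and g: "g \<ge> 0"
    and ae: "AE r in lborel. r \<ge> 0 \<longrightarrow> lft z r = z r"
    and \<tau>: "\<And>k. \<tau> k 0 = 0" "\<And>k. \<tau> k (N k) = t" "\<And>k i. i < N k \<Longrightarrow> \<tau> k i \<le> \<tau> k (Suc i)"
      "\<And>k i. i < N k \<Longrightarrow> \<tau> k (Suc i) - \<tau> k i < \<delta> k" and \<delta>: "\<delta> \<longlonglongrightarrow> 0"
  shows "(\<lambda>k. \<Sum>i<N k. exp (- g * (t - \<tau> k i)) * (z (\<tau> k (Suc i)) - z (\<tau> k i))) \<longlonglongrightarrow> conv g z t"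
proof -
  define f where "f r = exp (- g * (t - r))" for r
  \<comment> \<open>The integrand \<open>g * f r * z r\<close> with \<open>z\<close> sampled at the
    right end of the cell. Since \<open>g * f\<close> is the derivative of \<open>f\<close>, a cell
    integrates to the increment of \<open>f\<close> times that sample, so the whole integral is
    exactly the sum left over by \<open>sum_by_parts\<close>.\<close>
  define w where "w k r = (\<Sum>i<N k. indicator {\<tau> k i<..\<tau> k (Suc i)} r * (g * f r * z (\<tau> k (Suc i))))" for k r
  have [measurable]: "f \<in> borel_measurable borel" unfolding f_def by measurable
  have w_meas [measurable]: "w k \<in> borel_measurable borel" for k unfolding w_def by measurable
  have mono: "\<tau> k i \<le> \<tau> k j" if "i \<le> j" "j \<le> N k" for i j k
    by (rule partition_mono[of "N k" "\<tau> k", OF \<tau>(3) that])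
  have range: "0 \<le> \<tau> k i \<and> \<tau> k i \<le> t" if "i \<le> N k" for i k
    using mono[of 0 i k] mono[of i "N k" k] that \<tau> by simp
  have cell: "has_bochner_integral lborel (\<lambda>r. indicator {a<..b} r * (g * f r * c)) ((f b - f a) * c)"
    if "a \<le> b" for a b c
  proof -
    have "has_bochner_integral lborel (\<lambda>r. (g * f r * c) * indicator {a..b} r) (f b * c - f a * c)"
      by (rule has_bochner_integral_FTC_Icc_real[OF that])
         (auto simp: f_def intro!: derivative_eq_intros continuous_intros)
    moreover have "AE r in lborel. (g * f r * c) * indicator {a..b} r = indicator {a<..b} r * (g * f r * c)"
      using AE_lborel_singleton[of a] by eventually_elim (auto simp: indicator_def)
    ultimately show ?thesis
      by (subst (asm) has_bochner_integral_cong_AE) (auto simp: algebra_simps)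
  qed
  have int_w: "(\<integral>r. w k r \<partial>lborel) = (\<Sum>i<N k. (f (\<tau> k (Suc i)) - f (\<tau> k i)) * z (\<tau> k (Suc i)))" for k
    unfolding w_def
    by (intro has_bochner_integral_integral_eq has_bochner_integral_sum cell \<tau>(3)) auto
  obtain B where B: "\<And>s. 0 \<le> s \<Longrightarrow> s \<le> t \<Longrightarrow> \<bar>z s\<bar> \<le> B" using cadlag_bounded[OF z(1) t(1)] by blast
  have "B \<ge> 0" using B[of 0] t by (meson abs_ge_zero order_refl order_trans)
  have out: "w k r = 0" if "\<not> (0 < r \<and> r \<le> t)" for k r
  proof -
    have "indicator {\<tau> k i<..\<tau> k (Suc i)} r = (0::real)" if "i < N k" for i
      using range[of i k] range[of "Suc i" k] that \<open>\<not> (0 < r \<and> r \<le> t)\<close> by (auto simp: indicator_def)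
    then show ?thesis unfolding w_def by simp
  qed
  have val: "\<exists>\<rho>. r \<le> \<rho> \<and> \<rho> < r + \<delta> k \<and> \<rho> \<le> t \<and> w k r = g * f r * z \<rho>" if r: "0 < r" "r \<le> t" for k r
  proof -
    obtain i where i: "i < N k" "\<tau> k i < r" "r \<le> \<tau> k (Suc i)"
      using partition_cell[of "\<tau> k" r "N k"] r \<tau> by auto
    have "w k r = g * f r * z (\<tau> k (Suc i))"
      unfolding w_def by (rule sum_partition_cell[OF \<tau>(3) i, where c = "\<lambda>i. g * f r * z (\<tau> k (Suc i))"])
    then show ?thesis using i range[of "Suc i" k] \<tau>(4)[OF i(1)] by (intro exI[of _ "\<tau> k (Suc i)"]) auto
  qed
  have lim: "(\<lambda>k. w k r) \<longlonglongrightarrow> indicator {0<..t} r * (g * f r * z r)" for r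
  proof (cases "0 < r \<and> r \<le> t")
    case True
    then obtain \<rho> where \<rho>: "\<And>k. r \<le> \<rho> k" "\<And>k. \<rho> k < r + \<delta> k" "\<And>k. w k r = g * f r * z (\<rho> k)"
      using val[of r] by metis
    have "\<rho> \<longlonglongrightarrow> r"
    proof (rule real_tendsto_sandwich[where f = "\<lambda>_. r" and h = "\<lambda>k. r + \<delta> k"])
      have "(\<lambda>k. r + \<delta> k) \<longlonglongrightarrow> r + 0" by (intro tendsto_intros \<delta>)
      then show "(\<lambda>k. r + \<delta> k) \<longlonglongrightarrow> r" by simp
    qed (use \<rho> in \<open>auto intro: always_eventually less_imp_le\<close>)
    moreover have "continuous (at r within {r..}) z"
      using z(1) True by (simp add: cadlag_def continuous_within at_within_Ici_at_right)
    ultimately have "(\<lambda>k. z (\<rho> k)) \<longlonglongrightarrow> z r"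
      using \<rho>(1) unfolding continuous_within_sequentially by (auto simp: o_def)
    then have "(\<lambda>k. g * f r * z (\<rho> k)) \<longlonglongrightarrow> g * f r * z r" by (intro tendsto_intros)
    then show ?thesis using True by (simp add: \<rho>(3))
  qed (simp add: out)
  \<comment> \<open>No measurability of \<open>z\<close> is assumed; the limit inherits it from the
    step functions.\<close>
  have lim_meas: "(\<lambda>r. indicator {0<..t} r * (g * f r * z r)) \<in> borel_measurable borel"
    by (rule borel_measurable_LIMSEQ_metric[OF w_meas lim])
  have "(\<lambda>k. \<integral>r. w k r \<partial>lborel) \<longlonglongrightarrow> (\<integral>r. indicator {0<..t} r * (g * f r * z r) \<partial>lborel)"
  proof (rule integral_dominated_convergence)
    show "integrable lborel (\<lambda>r. indicator {0..t} r *\<^sub>R (g * B))"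
      using set_integrable_continuous[of t "\<lambda>_. g * B"] by (simp add: set_integrable_def)
    show "AE r in lborel. norm (w k r) \<le> indicator {0..t} r *\<^sub>R (g * B)" for k
    proof (rule AE_I2)
      fix r
      show "norm (w k r) \<le> indicator {0..t} r *\<^sub>R (g * B)"
      proof (cases "0 < r \<and> r \<le> t")
        case True
        then obtain \<rho> where \<rho>: "r \<le> \<rho>" "\<rho> \<le> t" "w k r = g * f r * z \<rho>" using val by blast
        have "f r \<le> 1" using True g by (simp add: f_def)
        then have "g * f r * \<bar>z \<rho>\<bar> \<le> g * 1 * B"
          using B[of \<rho>] \<rho> True g by (intro mult_mono) (auto simp: f_def)
        then show ?thesis using True g by (simp add: \<rho> abs_mult f_def)
      qed (use out g \<open>B \<ge> 0\<close> in auto)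
    qed
  qed (use lim_meas lim in auto)
  \<comment> \<open>Under the integral, \<open>ae\<close> exchanges \<open>z\<close> for its left
    limit; at the endpoint the exchange is \<open>lft z t = z t\<close>.\<close>
  moreover have "(\<integral>r. indicator {0<..t} r * (g * f r * z r) \<partial>lborel) = (LINT r:{0..t}|lborel. g * exp (- g * (t - r)) * lft z r)"
    unfolding set_lebesgue_integral_def
  proof (rule integral_cong_AE)
    show "AE r in lborel. indicator {0<..t} r * (g * f r * z r) = indicator {0..t} r *\<^sub>R (g * exp (- g * (t - r)) * lft z r)"
      using ae AE_lborel_singleton[of 0] by eventually_elim (auto simp: indicator_def f_def)
  qed (use lim_meas in auto)
  ultimately have "(\<lambda>k. z t - (\<integral>r. w k r \<partial>lborel)) \<longlonglongrightarrow> conv g z t"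
    unfolding conv_def t(2) by (intro tendsto_intros) simp
  moreover have "(\<Sum>i<N k. exp (- g * (t - \<tau> k i)) * (z (\<tau> k (Suc i)) - z (\<tau> k i))) = z t - (\<integral>r. w k r \<partial>lborel)" for k
    unfolding int_w using sum_by_parts[of "\<lambda>i. f (\<tau> k i)" "\<lambda>i. z (\<tau> k i)" "N k"]
    by (simp add: \<tau> z f_def)
  ultimately show ?thesis by simp
qed

text \<open>The mesh bound has \<open>t + 1\<close> in place of \<open>t\<close>, which makes it
  strict and positive also for \<open>t = 0\<close>.\<close>

lemma uniform_partition:
  assumes "t \<ge> 0"
  shows "t * real 0 / real (Suc k) = 0" "t * real (Suc k) / real (Suc k) = t"
    "t * real i / real (Suc k) \<le> t * real (Suc i) / real (Suc k)"
    "t * real (Suc i) / real (Suc k) - t * real i / real (Suc k) < (t + 1) / real (Suc k)"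
proof -
  show "t * real i / real (Suc k) \<le> t * real (Suc i) / real (Suc k)"
    using assms by (intro divide_right_mono mult_left_mono) auto
  have "t * real (Suc i) / real (Suc k) - t * real i / real (Suc k) = t / real (Suc k)"
    by (simp add: diff_divide_distrib[symmetric] algebra_simps)
  also have "\<dots> < (t + 1) / real (Suc k)" by (rule divide_strict_right_mono) auto
  finally show "t * real (Suc i) / real (Suc k) - t * real i / real (Suc k) < (t + 1) / real (Suc k)" .
qed auto

lemma conv_random_measurable:
  assumes "\<And>s. s \<ge> 0 \<Longrightarrow> Z s \<in> borel_measurable M"
  shows "(\<lambda>\<omega>. conv g (\<lambda>r. Z r \<omega>) t) \<in> borel_measurable M"
    and "(\<lambda>\<omega>. lft (\<lambda>r. Z r \<omega>) t) \<in> borel_measurable M"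
proof -
  have pair: "(\<lambda>\<omega>. (t, \<omega>)) \<in> M \<rightarrow>\<^sub>M borel \<Otimes>\<^sub>M M" by measurable
  note lft = lft_measurable_pair[where U = Z, OF assms]
  show "(\<lambda>\<omega>. conv g (\<lambda>r. Z r \<omega>) t) \<in> borel_measurable M"
    using measurable_compose[OF pair conv_measurable_past[OF past_closed_pair, of Z, OF lft]] by simp
  show "(\<lambda>\<omega>. lft (\<lambda>r. Z r \<omega>) t) \<in> borel_measurable M"
    using measurable_compose[OF pair lft] by simp
qed

text \<open>The sequence is jointly measurable in time and randomness, which is not known for the path itself.\<close>

lemma lft_right_limit:
  assumes z: "cadlag z" and s: "s \<ge> 0"
  shows "(\<lambda>n. lft z (s + 1 / real (Suc n))) \<longlonglongrightarrow> z s"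
proof (rule LIMSEQ_I)
  fix \<epsilon> :: real assume "\<epsilon> > 0"
  have "(z \<longlongrightarrow> z s) (at_right s)" using z s by (simp add: cadlag_def)
  then have "\<forall>\<^sub>F r in at_right s. dist (z r) (z s) < \<epsilon> / 2" by (rule tendstoD) (use \<open>\<epsilon> > 0\<close> in simp)
  then obtain d where d: "d > s" "\<And>r. s < r \<Longrightarrow> r < d \<Longrightarrow> dist (z r) (z s) < \<epsilon> / 2"
    unfolding eventually_at_right_field by blast
  obtain N where N: "1 / real (Suc N) < d - s" using d nat_approx_posE[of "d - s"] by auto
  have "norm (lft z (s + 1 / real (Suc n)) - z s) < \<epsilon>" if "n \<ge> N" for n
  proof -
    let ?s = "s + 1 / real (Suc n)"
    have s': "s < ?s" by simp
    have "1 / real (Suc n) \<le> 1 / real (Suc N)" using that by (intro divide_left_mono) auto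
    then have "?s < d" using N by linarith
    have "\<forall>\<^sub>F k in sequentially. dyad k ?s \<in> {s<..}"
      by (rule topological_tendstoD[OF dyad_tendsto]) (use s' in auto)
    then have ev: "\<forall>\<^sub>F k in sequentially. \<bar>z (dyad k ?s) - z s\<bar> \<le> \<epsilon> / 2"
      by eventually_elim (use d(2) dyad_less[of _ ?s] \<open>?s < d\<close> in \<open>force simp: dist_real_def intro: less_imp_le less_trans\<close>)
    have "(\<lambda>k. \<bar>z (dyad k ?s) - z s\<bar>) \<longlonglongrightarrow> \<bar>lft z ?s - z s\<bar>"
      using s s' by (intro tendsto_intros filterlim_compose[OF cadlag_tendsto_lft[OF z] dyad_at_left]) linarith
    from tendsto_upperbound[OF this ev] show ?thesis using \<open>\<epsilon> > 0\<close> by auto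
  qed
  then show "\<exists>N. \<forall>n\<ge>N. norm (lft z (s + 1 / real (Suc n)) - z s) < \<epsilon>" by blast
qed

text \<open>Fubini's theorem exchanges quantifiers: what holds almost surely at each time holds, on
  almost every path, at almost every time. Only the second form can be fed into pathwise lemmas such
  as \<open>sol_unique_AE\<close>.\<close>

lemma AE_lborel_commute:
  fixes U V :: "real \<Rightarrow> 'a \<Rightarrow> 'b::{metric_space, second_countable_topology}"
  assumes "sigma_finite_measure M"
    and meas: "(\<lambda>p. U (fst p) (snd p)) \<in> borel_measurable (borel \<Otimes>\<^sub>M M)" "(\<lambda>p. V (fst p) (snd p)) \<in> borel_measurable (borel \<Otimes>\<^sub>M M)"
    and eq: "\<And>s. s \<ge> 0 \<Longrightarrow> AE \<omega> in M. U s \<omega> = V s \<omega>"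
  shows "AE \<omega> in M. AE s in lborel. s \<ge> 0 \<longrightarrow> U s \<omega> = V s \<omega>"
proof -
  interpret M: sigma_finite_measure M by fact
  interpret P: pair_sigma_finite lborel M ..
  note [measurable] = meas
  have "AE s in lborel. AE \<omega> in M. s \<ge> 0 \<longrightarrow> U s \<omega> = V s \<omega>"
  proof (rule AE_I2)
    fix s :: real
    show "AE \<omega> in M. s \<ge> 0 \<longrightarrow> U s \<omega> = V s \<omega>" using eq[of s] by (cases "s \<ge> 0") auto
  qed
  also have "?this \<longleftrightarrow> (AE \<omega> in M. AE s in lborel. s \<ge> 0 \<longrightarrow> U s \<omega> = V s \<omega>)"
  proof (rule P.AE_commute)
    have sets: "sets (lborel \<Otimes>\<^sub>M M) = sets (borel \<Otimes>\<^sub>M M)" by (intro sets_pair_measure_cong) auto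
    \<comment> \<open>Written through \<open>dist\<close>, the equality becomes a condition on a
      real measurable function.\<close>
    have "{x \<in> space (borel \<Otimes>\<^sub>M M). fst x \<ge> 0 \<longrightarrow> dist (U (fst x) (snd x)) (V (fst x) (snd x)) = 0} \<in> sets (borel \<Otimes>\<^sub>M M)"
      by measurable
    then show "{x \<in> space (lborel \<Otimes>\<^sub>M M). fst x \<ge> 0 \<longrightarrow> U (fst x) (snd x) = V (fst x) (snd x)} \<in> sets (lborel \<Otimes>\<^sub>M M)"
      by (simp add: sets space_pair_measure)
  qed
  finally show ?thesis .
qed

section \<open>Limits in probability and stochastic integrals for Levy processes\<close>

context prob_space
begin

lemma AE_tendsto_imp_prob:
  fixes X :: "nat \<Rightarrow> 'a \<Rightarrow> real"
  assumes [measurable]: "\<And>k. X k \<in> borel_measurable M" "Y \<in> borel_measurable M"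
    and lim: "AE \<omega> in M. (\<lambda>k. X k \<omega>) \<longlonglongrightarrow> Y \<omega>" and \<epsilon>: "\<epsilon> > 0"
  shows "(\<lambda>k. prob {\<omega>\<in>space M. \<epsilon> < \<bar>X k \<omega> - Y \<omega>\<bar>}) \<longlonglongrightarrow> 0"
proof -
  let ?A = "\<lambda>k. {\<omega>\<in>space M. \<epsilon> < \<bar>X k \<omega> - Y \<omega>\<bar>}"
  have "(\<lambda>k. \<integral>\<omega>. indicator (?A k) \<omega> \<partial>M) \<longlonglongrightarrow> (\<integral>\<omega>. (0::real) \<partial>M)"
  proof (rule integral_dominated_convergence[where w = "\<lambda>_. 1"])
    show "AE \<omega> in M. (\<lambda>k. indicator (?A k) \<omega>) \<longlonglongrightarrow> (0::real)"
      using lim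
    proof eventually_elim
      case (elim \<omega>)
      have "\<forall>\<^sub>F k in sequentially. dist (X k \<omega>) (Y \<omega>) < \<epsilon>" using elim \<epsilon> by (rule tendstoD)
      then have "\<forall>\<^sub>F k in sequentially. indicator (?A k) \<omega> = (0::real)"
        by eventually_elim (auto simp: dist_real_def)
      then show ?case by (rule tendsto_eventually)
    qed
  qed auto
  then show ?thesis by simp
qed

lemma tendsto_prob_unique:
  fixes X :: "nat \<Rightarrow> 'a \<Rightarrow> real"
  assumes [measurable]: "\<And>k. X k \<in> borel_measurable M" "Y \<in> borel_measurable M" "Y' \<in> borel_measurable M"
    and lim: "\<And>\<epsilon>. \<epsilon> > 0 \<Longrightarrow> (\<lambda>k. prob {\<omega>\<in>space M. \<epsilon> < \<bar>X k \<omega> - Y \<omega>\<bar>}) \<longlonglongrightarrow> 0"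
      "\<And>\<epsilon>. \<epsilon> > 0 \<Longrightarrow> (\<lambda>k. prob {\<omega>\<in>space M. \<epsilon> < \<bar>X k \<omega> - Y' \<omega>\<bar>}) \<longlonglongrightarrow> 0"
  shows "AE \<omega> in M. Y \<omega> = Y' \<omega>"
proof -
  have le: "AE \<omega> in M. \<bar>Y \<omega> - Y' \<omega>\<bar> \<le> 2 * \<epsilon>" if \<epsilon>: "\<epsilon> > 0" for \<epsilon>
  proof -
    have "prob {\<omega>\<in>space M. 2 * \<epsilon> < \<bar>Y \<omega> - Y' \<omega>\<bar>}
        \<le> prob {\<omega>\<in>space M. \<epsilon> < \<bar>X k \<omega> - Y \<omega>\<bar>} + prob {\<omega>\<in>space M. \<epsilon> < \<bar>X k \<omega> - Y' \<omega>\<bar>}" for k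
      by (rule order.trans[OF finite_measure_mono measure_Un_le]) auto
    moreover have "(\<lambda>k. prob {\<omega>\<in>space M. \<epsilon> < \<bar>X k \<omega> - Y \<omega>\<bar>} + prob {\<omega>\<in>space M. \<epsilon> < \<bar>X k \<omega> - Y' \<omega>\<bar>}) \<longlonglongrightarrow> 0 + 0"
      by (intro tendsto_add lim \<epsilon>)
    ultimately have "prob {\<omega>\<in>space M. 2 * \<epsilon> < \<bar>Y \<omega> - Y' \<omega>\<bar>} \<le> 0 + 0"
      by (intro LIMSEQ_le_const) auto
    then have "prob {\<omega>\<in>space M. 2 * \<epsilon> < \<bar>Y \<omega> - Y' \<omega>\<bar>} = 0" by (simp add: measure_le_0_iff)
    then show ?thesis by (subst (asm) prob_eq_0) (auto simp: not_less elim!: eventually_mono)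
  qed
  have "AE \<omega> in M. \<bar>Y \<omega> - Y' \<omega>\<bar> \<le> 2 * (1 / real (Suc n))" for n by (rule le) simp
  then have "AE \<omega> in M. \<forall>n. \<bar>Y \<omega> - Y' \<omega>\<bar> \<le> 2 * (1 / real (Suc n))"
    unfolding AE_all_countable by blast
  then show ?thesis
  proof eventually_elim
    case (elim \<omega>)
    have "(\<lambda>n. 2 * (1 / real (Suc n))) \<longlonglongrightarrow> 2 * 0"
      using LIMSEQ_inverse_real_of_nat by (intro tendsto_intros) (simp add: inverse_eq_divide)
    then have "\<bar>Y \<omega> - Y' \<omega>\<bar> \<le> 2 * 0" using elim by (intro LIMSEQ_le_const) auto
    then show ?case by simp
  qed
qed

context
  fixes Z :: "real \<Rightarrow> 'a \<Rightarrow> real"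
  assumes levy: "levy_process M Z"
begin

lemma
  shows levy_measurable: "t \<ge> 0 \<Longrightarrow> Z t \<in> borel_measurable M"
    and levy_zero: "AE \<omega> in M. Z 0 \<omega> = 0"
    and levy_indep: "0 \<le> \<tau> 0 \<Longrightarrow> (\<And>i. i < n \<Longrightarrow> \<tau> i \<le> \<tau> (Suc i)) \<Longrightarrow>
        indep_vars (\<lambda>_. borel) (\<lambda>i \<omega>. Z (\<tau> (Suc i)) \<omega> - Z (\<tau> i) \<omega>) {..<n}"
    and levy_stationary: "s \<ge> 0 \<Longrightarrow> t \<ge> 0 \<Longrightarrow> distr M borel (\<lambda>\<omega>. Z (s + t) \<omega> - Z s \<omega>) = distr M borel (Z t)"
    and levy_stochastically_continuous: "t \<ge> 0 \<Longrightarrow> \<epsilon> > 0 \<Longrightarrow>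
        ((\<lambda>s. prob {\<omega>\<in>space M. \<epsilon> < \<bar>Z s \<omega> - Z t \<omega>\<bar>}) \<longlongrightarrow> 0) (at t within {0..})"
    and levy_cadlag: "AE \<omega> in M. cadlag (\<lambda>t. Z t \<omega>)"
proof -
  note * = levy[unfolded levy_process_def]
  note 1 = *[THEN conjunct1] and r1 = *[THEN conjunct2]
  note 2 = r1[THEN conjunct1] and r2 = r1[THEN conjunct2]
  note 3 = r2[THEN conjunct1] and r3 = r2[THEN conjunct2]
  note 4 = r3[THEN conjunct1] and r4 = r3[THEN conjunct2]
  note 5 = r4[THEN conjunct1] and 6 = r4[THEN conjunct2]
  show "t \<ge> 0 \<Longrightarrow> Z t \<in> borel_measurable M" using 1 by simp
  show "AE \<omega> in M. Z 0 \<omega> = 0" by (rule 2)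
  show "0 \<le> \<tau> 0 \<Longrightarrow> (\<And>i. i < n \<Longrightarrow> \<tau> i \<le> \<tau> (Suc i)) \<Longrightarrow>
      indep_vars (\<lambda>_. borel) (\<lambda>i \<omega>. Z (\<tau> (Suc i)) \<omega> - Z (\<tau> i) \<omega>) {..<n}"
    by (rule 3[rule_format]) simp
  show "s \<ge> 0 \<Longrightarrow> t \<ge> 0 \<Longrightarrow> distr M borel (\<lambda>\<omega>. Z (s + t) \<omega> - Z s \<omega>) = distr M borel (Z t)"
    by (rule 4[rule_format])
  show "t \<ge> 0 \<Longrightarrow> \<epsilon> > 0 \<Longrightarrow>
      ((\<lambda>s. prob {\<omega>\<in>space M. \<epsilon> < \<bar>Z s \<omega> - Z t \<omega>\<bar>}) \<longlongrightarrow> 0) (at t within {0..})"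
    by (rule 5[rule_format])
  show "AE \<omega> in M. cadlag (\<lambda>t. Z t \<omega>)" by (rule 6)
qed

text \<open>There is no fixed jump: along the dyadic times below \<open>t\<close> the process tends
  to its left limit almost surely, and to \<open>Z t\<close> in probability by stochastic
  continuity.\<close>

lemma levy_lft_AE:
  assumes t: "t \<ge> 0" shows "AE \<omega> in M. lft (\<lambda>r. Z r \<omega>) t = Z t \<omega>"
proof (cases "t = 0")
  case True
  show ?thesis using levy_zero by eventually_elim (simp add: True lft_def)
next
  case False
  then have t: "t > 0" using t by simp
  note [measurable] = levy_measurable levy_measurable[OF dyad_nonneg[OF t]] levy_measurable[OF less_imp_le[OF t]]
  show ?thesis
  proof (rule tendsto_prob_unique[where X = "\<lambda>k. Z (dyad k t)"])
    have lim: "AE \<omega> in M. (\<lambda>k. Z (dyad k t) \<omega>) \<longlonglongrightarrow> lft (\<lambda>r. Z r \<omega>) t"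
      using levy_cadlag
    proof eventually_elim
      case (elim \<omega>)
      from filterlim_compose[OF cadlag_tendsto_lft[OF elim t] dyad_at_left] show ?case .
    qed
    show meas [measurable]: "(\<lambda>\<omega>. lft (\<lambda>r. Z r \<omega>) t) \<in> borel_measurable M"
      by (rule conv_random_measurable(2)[OF levy_measurable])
    show "(\<lambda>k. prob {\<omega>\<in>space M. \<epsilon> < \<bar>Z (dyad k t) \<omega> - lft (\<lambda>r. Z r \<omega>) t\<bar>}) \<longlonglongrightarrow> 0" if "\<epsilon> > 0" for \<epsilon>
      by (rule AE_tendsto_imp_prob[OF _ meas lim that]) measurable
    fix \<epsilon> :: real assume "\<epsilon> > 0"
    then have "((\<lambda>s. prob {\<omega>\<in>space M. \<epsilon> < \<bar>Z s \<omega> - Z t \<omega>\<bar>}) \<longlongrightarrow> 0) (at t within {0..})"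
      using t by (intro levy_stochastically_continuous) auto
    moreover have "filterlim (\<lambda>k. dyad k t) (at t within {0..}) sequentially"
      using dyad_less[of _ t] dyad_nonneg[OF t]
      by (intro filterlim_at_withinI[OF dyad_tendsto] always_eventually allI) (auto simp: less_imp_neq)
    ultimately show "(\<lambda>k. prob {\<omega>\<in>space M. \<epsilon> < \<bar>Z (dyad k t) \<omega> - Z t \<omega>\<bar>}) \<longlonglongrightarrow> 0"
      by (rule filterlim_compose)
  qed measurable
qed

lemma levy_lft_AE_AE: "AE \<omega> in M. AE r in lborel. r \<ge> 0 \<longrightarrow> lft (\<lambda>t. Z t \<omega>) r = Z r \<omega>"
proof -
  \<comment> \<open>A jointly measurable stand-in for \<open>Z\<close>. On a cadlag path the right
    limits of \<open>lft\<close> recover \<open>Z\<close> at all nonnegative times, so Fubini's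
    theorem can compare \<open>lft\<close> with \<open>R\<close>.\<close>
  define R where "R r \<omega> = lim (\<lambda>n. lft (\<lambda>t. Z t \<omega>) (r + 1 / real (Suc n)))" for r \<omega>
  have lft [measurable]: "(\<lambda>p. lft (\<lambda>t. Z t (snd p)) (fst p)) \<in> borel_measurable (borel \<Otimes>\<^sub>M M)"
    by (rule lft_measurable_pair[OF levy_measurable])
  have [measurable]: "(\<lambda>p. lft (\<lambda>t. Z t (snd p)) (fst p + 1 / real (Suc n))) \<in> borel_measurable (borel \<Otimes>\<^sub>M M)" for n
  proof -
    have "(\<lambda>p. (fst p + 1 / real (Suc n), snd p)) \<in> borel \<Otimes>\<^sub>M M \<rightarrow>\<^sub>M borel \<Otimes>\<^sub>M M" by measurable
    from measurable_compose[OF this lft] show ?thesis by simp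
  qed
  have [measurable]: "(\<lambda>p. R (fst p) (snd p)) \<in> borel_measurable (borel \<Otimes>\<^sub>M M)"
    unfolding R_def by measurable
  have R: "AE \<omega> in M. \<forall>r\<ge>0. R r \<omega> = Z r \<omega>"
    using levy_cadlag by eventually_elim (unfold R_def, blast intro: limI lft_right_limit)
  have "AE \<omega> in M. AE r in lborel. r \<ge> 0 \<longrightarrow> lft (\<lambda>t. Z t \<omega>) r = R r \<omega>"
  proof (rule AE_lborel_commute[OF _ lft])
    show "AE \<omega> in M. lft (\<lambda>t. Z t \<omega>) r = R r \<omega>" if "r \<ge> 0" for r
      using R levy_lft_AE[OF that] by eventually_elim (use that in auto)
    show "(\<lambda>p. R (fst p) (snd p)) \<in> borel_measurable (borel \<Otimes>\<^sub>M M)" by measurable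
  qed unfold_locales
  then show ?thesis
    using R
  proof eventually_elim
    case (elim \<omega>)
    from elim(1) show ?case by eventually_elim (use elim(2) in auto)
  qed
qed

lemma levy_riemann_sums_AE:
  fixes \<tau> :: "nat \<Rightarrow> nat \<Rightarrow> real"
  assumes "t \<ge> 0" "g \<ge> 0" "\<And>k. \<tau> k 0 = 0" "\<And>k. \<tau> k (N k) = t" "\<And>k i. i < N k \<Longrightarrow> \<tau> k i \<le> \<tau> k (Suc i)"
      "\<And>k i. i < N k \<Longrightarrow> \<tau> k (Suc i) - \<tau> k i < \<delta> k" and "\<delta> \<longlonglongrightarrow> 0"
  shows "AE \<omega> in M. (\<lambda>k. \<Sum>i<N k. exp (- g * (t - \<tau> k i)) * b * (Z (\<tau> k (Suc i)) \<omega> - Z (\<tau> k i) \<omega>))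
    \<longlonglongrightarrow> b * conv g (\<lambda>r. Z r \<omega>) t"
  using levy_cadlag levy_zero levy_lft_AE[OF assms(1)] levy_lft_AE_AE
proof eventually_elim
  case (elim \<omega>)
  from tendsto_mult_left[OF riemann_sums_tendsto_conv[OF elim(1,2) assms(1) elim(3) assms(2) elim(4) assms(3-7)], of b]
  show ?case by (simp add: sum_distrib_left mult_ac)
qed

lemma partition_sum_measurable:
  fixes \<tau> :: "nat \<Rightarrow> real"
  assumes "\<tau> 0 = 0" "\<And>i. i < N \<Longrightarrow> \<tau> i \<le> \<tau> (Suc i)"
  shows "(\<lambda>\<omega>. \<Sum>i<N. f (\<tau> i) * (Z (\<tau> (Suc i)) \<omega> - Z (\<tau> i) \<omega>)) \<in> borel_measurable M"
proof -
  have "0 \<le> \<tau> i" if "i \<le> N" for i using partition_mono[of N \<tau> 0 i] assms that by simp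
  then have "Z (\<tau> i) \<in> borel_measurable M" if "i \<le> N" for i using that levy_measurable by simp
  then show ?thesis
    by (intro borel_measurable_sum borel_measurable_times borel_measurable_diff borel_measurable_const) auto
qed

lemma levy_has_stochastic_integral:
  assumes t: "t \<ge> 0" and g: "g \<ge> 0"
  shows "has_stochastic_integral M Z (\<lambda>s. exp (- g * (t - s)) * b) t (\<lambda>\<omega>. b * conv g (\<lambda>r. Z r \<omega>) t)"
  unfolding has_stochastic_integral_def
proof (intro conjI allI impI)
  show meas: "(\<lambda>\<omega>. b * conv g (\<lambda>r. Z r \<omega>) t) \<in> borel_measurable M"
    by (intro borel_measurable_times borel_measurable_const conv_random_measurable levy_measurable)
  fix \<epsilon> :: real assume \<epsilon>: "\<epsilon> > 0"
  let ?R = "\<lambda>N \<tau> \<omega>. \<Sum>i<N. exp (- g * (t - \<tau> i)) * b * (Z (\<tau> (Suc i)) \<omega> - Z (\<tau> i) \<omega>)"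
  let ?part = "\<lambda>\<delta> N \<tau>. \<tau> 0 = 0 \<and> \<tau> N = t \<and> (\<forall>i<N. \<tau> i \<le> \<tau> (Suc i) \<and> \<tau> (Suc i) - \<tau> i < \<delta>)"
  let ?p = "\<lambda>N \<tau>. prob {\<omega>\<in>space M. \<epsilon> < \<bar>?R N \<tau> \<omega> - b * conv g (\<lambda>r. Z r \<omega>) t\<bar>}"
  show "\<exists>\<delta>>0. \<forall>N \<tau>. ?part \<delta> N \<tau> \<longrightarrow> ?p N \<tau> < \<epsilon>"
  \<comment> \<open>Failure at each mesh \<open>1 / real (Suc k)\<close> produces one sequence of
    bad partitions. Along it the Riemann sums converge almost surely, hence in probability, against
    the lower bound \<open>\<epsilon>\<close>.\<close>
  proof (rule ccontr)
    assume "\<not> ?thesis"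
    then have "\<exists>N \<tau>. ?part \<delta> N \<tau> \<and> \<not> ?p N \<tau> < \<epsilon>" if "\<delta> > 0" for \<delta> using that by blast
    then have "\<forall>k. \<exists>N \<tau>. ?part (1 / real (Suc k)) N \<tau> \<and> \<not> ?p N \<tau> < \<epsilon>" by simp
    from choice[OF this] obtain N where "\<forall>k. \<exists>\<tau>. ?part (1 / real (Suc k)) (N k) \<tau> \<and> \<not> ?p (N k) \<tau> < \<epsilon>" ..
    from choice[OF this] obtain \<tau> where
      "\<forall>k. ?part (1 / real (Suc k)) (N k) (\<tau> k) \<and> \<not> ?p (N k) (\<tau> k) < \<epsilon>" ..
    then have P: "\<And>k. ?part (1 / real (Suc k)) (N k) (\<tau> k)" and bad: "\<And>k. \<not> ?p (N k) (\<tau> k) < \<epsilon>"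
      by blast+
    have "AE \<omega> in M. (\<lambda>k. ?R (N k) (\<tau> k) \<omega>) \<longlonglongrightarrow> b * conv g (\<lambda>r. Z r \<omega>) t"
      using LIMSEQ_inverse_real_of_nat
      by (intro levy_riemann_sums_AE[OF t g, where \<delta> = "\<lambda>k. 1 / real (Suc k)"]) (use P in \<open>auto simp: inverse_eq_divide\<close>)
    from AE_tendsto_imp_prob[OF _ meas this \<epsilon>]
    have "(\<lambda>k. ?p (N k) (\<tau> k)) \<longlonglongrightarrow> 0"
      using partition_sum_measurable[of "\<tau> k" "N k" for k] P by simp
    then have "\<forall>\<^sub>F k in sequentially. ?p (N k) (\<tau> k) < \<epsilon>" using \<epsilon> by (rule order_tendstoD)
    then show False using bad by (auto simp: eventually_sequentially)
  qed
qed

lemma stochastic_integral_unique: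
  assumes t: "t \<ge> 0" and Y: "has_stochastic_integral M Z f t Y" and Y': "has_stochastic_integral M Z f t Y'"
  shows "AE \<omega> in M. Y \<omega> = Y' \<omega>"
proof -
  define \<tau> where "\<tau> k i = t * real i / real (Suc k)" for k i
  note part = uniform_partition[OF t, folded \<tau>_def]
  let ?R = "\<lambda>k \<omega>. \<Sum>i<Suc k. f (\<tau> k i) * (Z (\<tau> k (Suc i)) \<omega> - Z (\<tau> k i) \<omega>)"
  have R: "?R k \<in> borel_measurable M" for k by (rule partition_sum_measurable) (use part in auto)
  have lim: "(\<lambda>k. prob {\<omega>\<in>space M. \<epsilon> < \<bar>?R k \<omega> - Y \<omega>\<bar>}) \<longlonglongrightarrow> 0"
    if Y: "has_stochastic_integral M Z f t Y" and \<epsilon>: "\<epsilon> > 0" for Y \<epsilon>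
  proof (rule LIMSEQ_I)
    have [measurable]: "Y \<in> borel_measurable M" using Y by (simp add: has_stochastic_integral_def)
    note [measurable] = R
    fix \<eta> :: real assume \<eta>: "\<eta> > 0"
    \<comment> \<open>In \<open>has_stochastic_integral\<close> one number is both the threshold and
      the bound on the probability; the minimum serves \<open>\<epsilon>\<close> in the first role
      and \<open>\<eta>\<close> in the second.\<close>
    define \<epsilon>' where "\<epsilon>' = min \<epsilon> \<eta>"
    have "\<epsilon>' > 0" using \<epsilon> \<eta> by (simp add: \<epsilon>'_def)
    from Y[unfolded has_stochastic_integral_def, THEN conjunct2, rule_format, OF this]
    obtain \<delta> where \<delta>: "\<delta> > 0" "\<And>N \<tau>. \<tau> 0 = 0 \<and> \<tau> N = t \<and> (\<forall>i<N. \<tau> i \<le> \<tau> (Suc i) \<and> \<tau> (Suc i) - \<tau> i < \<delta>) \<Longrightarrow>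
        prob {\<omega>\<in>space M. \<epsilon>' < \<bar>(\<Sum>i<N. f (\<tau> i) * (Z (\<tau> (Suc i)) \<omega> - Z (\<tau> i) \<omega>)) - Y \<omega>\<bar>} < \<epsilon>'"
      by blast
    obtain n where n: "1 / real (Suc n) < \<delta> / (t + 1)" using nat_approx_posE[of "\<delta> / (t + 1)"] \<delta> t by auto
    have "norm (prob {\<omega>\<in>space M. \<epsilon> < \<bar>?R k \<omega> - Y \<omega>\<bar>} - 0) < \<eta>" if "k \<ge> n" for k
    proof -
      have "1 / real (Suc k) \<le> 1 / real (Suc n)" using that by (intro divide_left_mono) auto
      then have "1 / real (Suc k) < \<delta> / (t + 1)" using n by linarith
      then have mesh: "(t + 1) / real (Suc k) < \<delta>" using t by (simp add: pos_less_divide_eq del: of_nat_Suc)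
      have "prob {\<omega>\<in>space M. \<epsilon>' < \<bar>?R k \<omega> - Y \<omega>\<bar>} < \<epsilon>'"
        using part(1-3) less_trans[OF part(4) mesh] by (intro \<delta>(2)) blast
      moreover have "prob {\<omega>\<in>space M. \<epsilon> < \<bar>?R k \<omega> - Y \<omega>\<bar>} \<le> prob {\<omega>\<in>space M. \<epsilon>' < \<bar>?R k \<omega> - Y \<omega>\<bar>}"
        by (intro finite_measure_mono) (auto simp: \<epsilon>'_def simp del: sum.lessThan_Suc)
      ultimately show ?thesis by (simp add: \<epsilon>'_def)
    qed
    then show "\<exists>n. \<forall>k\<ge>n. norm (prob {\<omega>\<in>space M. \<epsilon> < \<bar>?R k \<omega> - Y \<omega>\<bar>} - 0) < \<eta>" by blast
  qed
  show ?thesis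
    using Y Y' by (intro tendsto_prob_unique[OF R _ _ lim[OF Y] lim[OF Y']]) (auto simp: has_stochastic_integral_def)
qed

end

end

section \<open>Characteristic functions and square summability\<close>

lemma exp_riemann_sum_le:
  fixes \<tau> :: "nat \<Rightarrow> real"
  assumes q: "q > 0"
  shows "(\<Sum>i<N. (\<tau> (Suc i) - \<tau> i) * exp (- q * (t - \<tau> i))) \<le> (exp (- q * (t - \<tau> N)) - exp (- q * (t - \<tau> 0))) / q"
proof -
  have "(\<tau> (Suc i) - \<tau> i) * exp (- q * (t - \<tau> i)) \<le> exp (- q * (t - \<tau> (Suc i))) / q - exp (- q * (t - \<tau> i)) / q" for i
  proof -
    \<comment> \<open>The left endpoint rule underestimates the integral of an increasing function,
      cell by cell; for the exponential this is \<open>1 + x \<le> exp x\<close>.\<close>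
    have "1 + q * (\<tau> (Suc i) - \<tau> i) \<le> exp (q * (\<tau> (Suc i) - \<tau> i))" by (rule exp_ge_add_one_self)
    then have "(1 + q * (\<tau> (Suc i) - \<tau> i)) * exp (- q * (t - \<tau> i)) \<le> exp (q * (\<tau> (Suc i) - \<tau> i)) * exp (- q * (t - \<tau> i))"
      by (rule mult_right_mono) simp
    also have "\<dots> = exp (- q * (t - \<tau> (Suc i)))" by (simp add: exp_add[symmetric] algebra_simps)
    finally show ?thesis using q by (simp add: field_simps)
  qed
  then have "(\<Sum>i<N. (\<tau> (Suc i) - \<tau> i) * exp (- q * (t - \<tau> i)))
      \<le> (\<Sum>i<N. exp (- q * (t - \<tau> (Suc i))) / q - exp (- q * (t - \<tau> i)) / q)"
    by (intro sum_mono)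
  also have "\<dots> = (exp (- q * (t - \<tau> N)) - exp (- q * (t - \<tau> 0))) / q"
    unfolding sum_lessThan_telescope[of "\<lambda>i. exp (- q * (t - \<tau> i)) / q"] by (simp add: diff_divide_distrib)
  finally show ?thesis .
qed

context prob_space
begin

lemma char_distr_scale:
  assumes [measurable]: "X \<in> borel_measurable M"
  shows "char (distr M borel (\<lambda>\<omega>. c * X \<omega>)) h = char (distr M borel X) (h * c)"
  by (simp add: char_def integral_distr mult_ac)

lemma expectation_cos_eq_char:
  assumes [measurable]: "X \<in> borel_measurable M"
  shows "expectation (\<lambda>\<omega>. cos (h * X \<omega>)) = Re (char (distr M borel X) h)"
proof -
  have "char (distr M borel X) h = (CLINT \<omega>|M. iexp (h * X \<omega>))"
    by (simp add: char_def integral_distr)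
  moreover have "Re (CLINT \<omega>|M. iexp (h * X \<omega>)) = (\<integral>\<omega>. Re (iexp (h * X \<omega>)) \<partial>M)"
    by (intro integral_Re[symmetric] integrable_const_bound[where B = 1]) auto
  ultimately show ?thesis by (simp add: Re_exp)
qed

text \<open>The Riemann sums are sums of independent stable variables. The exponent of their
  characteristic function is \<open>- (|h| powr \<alpha> * b powr \<alpha>)\<close> times a left
  Riemann sum of \<open>exp (- (\<alpha> * g) * (t - s))\<close>, which is at most
  \<open>1 / (\<alpha> * g)\<close>; then \<open>exp (- x) \<ge> 1 - x\<close>. The bound survives
  the limit by dominated convergence, as the cosine is bounded.\<close>

lemma expectation_cos_conv_ge:
  assumes Z: "normalized_stable_process M \<alpha> Z" and \<alpha>: "\<alpha> > 0" and g: "g > 0" and b: "b > 0" and t: "t \<ge> 0"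
  shows "1 - expectation (\<lambda>\<omega>. cos (h * (b * conv g (\<lambda>r. Z r \<omega>) t))) \<le> \<bar>h\<bar> powr \<alpha> * (b powr \<alpha> / (\<alpha> * g))"
proof -
  have levy: "levy_process M Z" and char: "\<And>t h. t \<ge> 0 \<Longrightarrow> char (distr M borel (Z t)) h = complex_of_real (exp (- t * \<bar>h\<bar> powr \<alpha>))"
    using Z by (auto simp: normalized_stable_process_def)
  define \<tau> where "\<tau> k i = t * real i / real (Suc k)" for k i
  note part = uniform_partition[OF t, folded \<tau>_def]
  have \<tau>0: "\<tau> k i \<ge> 0" for k i using t by (simp add: \<tau>_def)
  note [measurable] = levy_measurable[OF levy \<tau>0]
  define c where "c k i = exp (- g * (t - \<tau> k i)) * b" for k i
  define R where "R k \<omega> = (\<Sum>i<Suc k. c k i * (Z (\<tau> k (Suc i)) \<omega> - Z (\<tau> k i) \<omega>))" for k \<omega>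
  have [measurable]: "R k \<in> borel_measurable M" for k unfolding R_def by measurable
  have "expectation (\<lambda>\<omega>. cos (h * R k \<omega>)) \<ge> 1 - \<bar>h\<bar> powr \<alpha> * (b powr \<alpha> / (\<alpha> * g))" for k
  proof -
    have pow: "\<bar>h * c k i\<bar> powr \<alpha> = \<bar>h\<bar> powr \<alpha> * (exp (- (\<alpha> * g) * (t - \<tau> k i)) * b powr \<alpha>)" for i
      using b by (simp add: c_def abs_mult powr_mult exp_powr_real algebra_simps)
    have indep: "indep_vars (\<lambda>_. borel) (\<lambda>i \<omega>. c k i * (Z (\<tau> k (Suc i)) \<omega> - Z (\<tau> k i) \<omega>)) {..<Suc k}"
      by (rule indep_vars_compose2[OF levy_indep[OF levy, of "\<tau> k"], where Y = "\<lambda>i x. c k i * x"])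
         (use part in auto)
    have "char (distr M borel (R k)) h
        = (\<Prod>i<Suc k. char (distr M borel (\<lambda>\<omega>. c k i * (Z (\<tau> k (Suc i)) \<omega> - Z (\<tau> k i) \<omega>))) h)"
      unfolding R_def by (rule char_distr_sum[OF indep])
    also have "\<dots> = (\<Prod>i<Suc k. complex_of_real (exp (- (\<tau> k (Suc i) - \<tau> k i) * \<bar>h * c k i\<bar> powr \<alpha>)))"
    proof (rule prod.cong[OF refl])
      fix i
      have "distr M borel (\<lambda>\<omega>. Z (\<tau> k (Suc i)) \<omega> - Z (\<tau> k i) \<omega>) = distr M borel (Z (\<tau> k (Suc i) - \<tau> k i))"
        using levy_stationary[OF levy \<tau>0[of k i], of "\<tau> k (Suc i) - \<tau> k i"] part(3)[of k i] by simp
      then show "char (distr M borel (\<lambda>\<omega>. c k i * (Z (\<tau> k (Suc i)) \<omega> - Z (\<tau> k i) \<omega>))) h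
          = complex_of_real (exp (- (\<tau> k (Suc i) - \<tau> k i) * \<bar>h * c k i\<bar> powr \<alpha>))"
        using part(3)[of k i] by (subst char_distr_scale) (simp_all add: char)
    qed
    also have "\<dots> = complex_of_real (exp (\<Sum>i<Suc k. - (\<tau> k (Suc i) - \<tau> k i) * \<bar>h * c k i\<bar> powr \<alpha>))"
      by (simp only: of_real_prod[symmetric] exp_sum[OF finite_lessThan])
    also have "(\<Sum>i<Suc k. - (\<tau> k (Suc i) - \<tau> k i) * \<bar>h * c k i\<bar> powr \<alpha>)
        = - (\<bar>h\<bar> powr \<alpha> * b powr \<alpha> * (\<Sum>i<Suc k. (\<tau> k (Suc i) - \<tau> k i) * exp (- (\<alpha> * g) * (t - \<tau> k i))))"
      unfolding sum_distrib_left sum_negf[symmetric] pow by (intro sum.cong refl) (simp only: mult_ac mult_minus_left)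
    finally have "expectation (\<lambda>\<omega>. cos (h * R k \<omega>))
        = exp (- (\<bar>h\<bar> powr \<alpha> * b powr \<alpha> * (\<Sum>i<Suc k. (\<tau> k (Suc i) - \<tau> k i) * exp (- (\<alpha> * g) * (t - \<tau> k i)))))"
      by (simp add: expectation_cos_eq_char)
    also have "\<dots> \<ge> 1 - \<bar>h\<bar> powr \<alpha> * b powr \<alpha> * (\<Sum>i<Suc k. (\<tau> k (Suc i) - \<tau> k i) * exp (- (\<alpha> * g) * (t - \<tau> k i)))"
      using exp_ge_add_one_self[of "- (\<bar>h\<bar> powr \<alpha> * b powr \<alpha> * (\<Sum>i<Suc k. (\<tau> k (Suc i) - \<tau> k i) * exp (- (\<alpha> * g) * (t - \<tau> k i))))"] by simp
    moreover have "(\<Sum>i<Suc k. (\<tau> k (Suc i) - \<tau> k i) * exp (- (\<alpha> * g) * (t - \<tau> k i))) \<le> 1 / (\<alpha> * g)"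
    proof -
      have "(exp (- (\<alpha> * g) * (t - \<tau> k (Suc k))) - exp (- (\<alpha> * g) * (t - \<tau> k 0))) / (\<alpha> * g) \<le> 1 / (\<alpha> * g)"
        unfolding part(2) using \<alpha> g by (intro divide_right_mono) auto
      then show ?thesis using exp_riemann_sum_le[of "\<alpha> * g" "\<tau> k" t "Suc k"] \<alpha> g by simp
    qed
    then have "\<bar>h\<bar> powr \<alpha> * b powr \<alpha> * (\<Sum>i<Suc k. (\<tau> k (Suc i) - \<tau> k i) * exp (- (\<alpha> * g) * (t - \<tau> k i)))
        \<le> \<bar>h\<bar> powr \<alpha> * b powr \<alpha> * (1 / (\<alpha> * g))" by (rule mult_left_mono) simp
    ultimately show ?thesis by simp
  qed
  moreover have "(\<lambda>k. expectation (\<lambda>\<omega>. cos (h * R k \<omega>))) \<longlonglongrightarrow> expectation (\<lambda>\<omega>. cos (h * (b * conv g (\<lambda>r. Z r \<omega>) t)))"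
  proof (rule integral_dominated_convergence[where w = "\<lambda>_. 1"])
    have mesh: "(\<lambda>k. (t + 1) / real (Suc k)) \<longlonglongrightarrow> 0" by (rule LIMSEQ_Suc[OF lim_const_over_n])
    have "AE \<omega> in M. (\<lambda>k. R k \<omega>) \<longlonglongrightarrow> b * conv g (\<lambda>r. Z r \<omega>) t"
      unfolding R_def c_def
      by (rule levy_riemann_sums_AE[OF levy t less_imp_le[OF g], where N = Suc and \<tau> = \<tau>, OF part(1-3) _ mesh])
         (rule part(4))
    then show "AE \<omega> in M. (\<lambda>k. cos (h * R k \<omega>)) \<longlonglongrightarrow> cos (h * (b * conv g (\<lambda>r. Z r \<omega>) t))"
      by eventually_elim (intro tendsto_intros)
    have [measurable]: "(\<lambda>\<omega>. conv g (\<lambda>r. Z r \<omega>) t) \<in> borel_measurable M"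
      by (rule conv_random_measurable(1)[OF levy_measurable[OF levy]])
    show "(\<lambda>\<omega>. cos (h * (b * conv g (\<lambda>r. Z r \<omega>) t))) \<in> borel_measurable M" by measurable
  qed auto
  ultimately have "expectation (\<lambda>\<omega>. cos (h * (b * conv g (\<lambda>r. Z r \<omega>) t))) \<ge> 1 - \<bar>h\<bar> powr \<alpha> * (b powr \<alpha> / (\<alpha> * g))"
    by (intro LIMSEQ_le_const) auto
  then show ?thesis by simp
qed

text \<open>Averaging \<open>1 - cos (h x)\<close> over a standard Gaussian \<open>h\<close> gives \<open>1 - exp (- x\<^sup>2 / 2)\<close>.\<close>

lemma AE_summable_sq:
  fixes X :: "nat \<Rightarrow> 'a \<Rightarrow> real"
  assumes X [measurable]: "\<And>n. X n \<in> borel_measurable M" and \<alpha>: "0 < \<alpha>" "\<alpha> \<le> 2"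
    and c: "summable c" "\<And>n. c n \<ge> 0"
    and bd: "\<And>n h. 1 - expectation (\<lambda>\<omega>. cos (h * X n \<omega>)) \<le> \<bar>h\<bar> powr \<alpha> * c n"
  shows "AE \<omega> in M. summable (\<lambda>n. (X n \<omega>)\<^sup>2)"
proof -
  let ?N = "std_normal_distribution"
  interpret N: prob_space ?N by (rule prob_space_normal_density) simp
  interpret P: pair_sigma_finite M ?N ..
  have [measurable_cong]: "sets ?N = sets borel" by simp
  have gauss: "(\<integral>\<^sup>+h. ennreal (1 - cos (h * x)) \<partial>?N) = ennreal (1 - exp (- (x\<^sup>2) / 2))" for x
  proof -
    have "N.expectation (\<lambda>h. cos (x * h)) = Re (char (distr ?N borel (\<lambda>h. h)) x)"
      by (rule N.expectation_cos_eq_char) simp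
    also have "distr ?N borel (\<lambda>h. h) = ?N" by (rule distr_id2) simp
    finally have "N.expectation (\<lambda>h. cos (h * x)) = exp (- (x\<^sup>2) / 2)"
      by (simp add: char_std_normal_distribution mult.commute)
    moreover have int: "integrable ?N (\<lambda>h. cos (h * x))"
      by (rule N.integrable_const_bound[where B = 1]) auto
    ultimately have "N.expectation (\<lambda>h. 1 - cos (h * x)) = 1 - exp (- (x\<^sup>2) / 2)"
      by (subst Bochner_Integration.integral_diff) (auto simp: N.prob_space[simplified])
    then show ?thesis using int by (subst nn_integral_eq_integral) auto
  qed
  \<comment> \<open>\<open>|h| powr \<alpha> \<le> 1 + h\<^sup>2\<close> since
    \<open>\<alpha> \<le> 2\<close>, and the Gaussian has mass 1 and variance 1.\<close>
  have moment: "(\<integral>\<^sup>+h. ennreal (\<bar>h\<bar> powr \<alpha>) \<partial>?N) \<le> 2"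
  proof -
    have "\<bar>h\<bar> powr \<alpha> \<le> 1 + h\<^sup>2" for h
    proof (cases "\<bar>h\<bar> \<le> 1")
      case True
      then have "\<bar>h\<bar> powr \<alpha> \<le> 1 powr \<alpha>" using \<alpha> by (intro powr_mono2) auto
      then show ?thesis by (simp add: add_increasing2)
    next
      case False
      then have "\<bar>h\<bar> powr \<alpha> \<le> \<bar>h\<bar> powr 2" using \<alpha> by (intro powr_mono) auto
      also have "\<dots> = h\<^sup>2" using False by (subst powr_numeral) auto
      finally show ?thesis by simp
    qed
    then have "(\<integral>\<^sup>+h. ennreal (\<bar>h\<bar> powr \<alpha>) \<partial>?N) \<le> (\<integral>\<^sup>+h. ennreal (1 + h\<^sup>2) \<partial>?N)"
      by (intro nn_integral_mono ennreal_leI)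
    also have "\<dots> = (\<integral>\<^sup>+h. ennreal (std_normal_density h * h ^ (2 * 0) + std_normal_density h * h ^ (2 * 1)) \<partial>lborel)"
      by (subst nn_integral_density)
         (auto simp: ennreal_mult[symmetric] distrib_left simp del: ennreal_plus intro!: nn_integral_cong)
    also have "\<dots> = ennreal 2"
    proof -
      have "has_bochner_integral lborel (\<lambda>h. std_normal_density h * h ^ (2 * 0) + std_normal_density h * h ^ (2 * 1)) 2"
        using has_bochner_integral_add[OF std_normal_moment_even[of 0] std_normal_moment_even[of 1]] by (simp add: fact_numeral)
      then show ?thesis
        by (subst nn_integral_eq_integral) (auto simp: has_bochner_integral_iff)
    qed
    finally show ?thesis by simp
  qed
  have "(\<integral>\<^sup>+\<omega>. ennreal (1 - exp (- ((X n \<omega>)\<^sup>2) / 2)) \<partial>M) \<le> ennreal (2 * c n)" for n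
  proof -
    have "(\<integral>\<^sup>+\<omega>. ennreal (1 - exp (- ((X n \<omega>)\<^sup>2) / 2)) \<partial>M) = (\<integral>\<^sup>+\<omega>. \<integral>\<^sup>+h. ennreal (1 - cos (h * X n \<omega>)) \<partial>?N \<partial>M)"
      by (simp add: gauss)
    also have "\<dots> = (\<integral>\<^sup>+h. \<integral>\<^sup>+\<omega>. ennreal (1 - cos (h * X n \<omega>)) \<partial>M \<partial>?N)"
      by (rule P.Fubini'[symmetric]) measurable
    also have "\<dots> \<le> (\<integral>\<^sup>+h. ennreal (c n) * ennreal (\<bar>h\<bar> powr \<alpha>) \<partial>?N)"
    proof (rule nn_integral_mono)
      fix h
      have int: "integrable M (\<lambda>\<omega>. cos (h * X n \<omega>))"
        by (rule integrable_const_bound[where B = 1]) auto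
      have "(\<integral>\<^sup>+\<omega>. ennreal (1 - cos (h * X n \<omega>)) \<partial>M) = ennreal (expectation (\<lambda>\<omega>. 1 - cos (h * X n \<omega>)))"
        using int by (intro nn_integral_eq_integral) auto
      also have "expectation (\<lambda>\<omega>. 1 - cos (h * X n \<omega>)) = 1 - expectation (\<lambda>\<omega>. cos (h * X n \<omega>))"
        using int by (subst Bochner_Integration.integral_diff) (auto simp: prob_space)
      also have "ennreal \<dots> \<le> ennreal (c n * \<bar>h\<bar> powr \<alpha>)"
        using bd[of h n] by (intro ennreal_leI) (simp add: mult.commute)
      finally show "(\<integral>\<^sup>+\<omega>. ennreal (1 - cos (h * X n \<omega>)) \<partial>M) \<le> ennreal (c n) * ennreal (\<bar>h\<bar> powr \<alpha>)"
        using c(2) by (simp add: ennreal_mult)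
    qed
    also have "\<dots> = ennreal (c n) * (\<integral>\<^sup>+h. ennreal (\<bar>h\<bar> powr \<alpha>) \<partial>?N)"
      by (rule nn_integral_cmult) measurable
    also have "\<dots> \<le> ennreal (c n) * 2" by (intro mult_left_mono moment) auto
    also have "\<dots> = ennreal (2 * c n)" using c(2) by (simp add: ennreal_mult mult.commute)
    finally show ?thesis .
  qed
  then have "(\<Sum>n. \<integral>\<^sup>+\<omega>. ennreal (1 - exp (- ((X n \<omega>)\<^sup>2) / 2)) \<partial>M) \<le> (\<Sum>n. ennreal (2 * c n))"
    by (intro suminf_le) auto
  also have "\<dots> < \<infinity>"
    using c by (subst suminf_ennreal2) (auto intro!: summable_mult)
  finally have "(\<integral>\<^sup>+\<omega>. (\<Sum>n. ennreal (1 - exp (- ((X n \<omega>)\<^sup>2) / 2))) \<partial>M) \<noteq> \<infinity>"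
    by (subst nn_integral_suminf) auto
  then have "AE \<omega> in M. (\<Sum>n. ennreal (1 - exp (- ((X n \<omega>)\<^sup>2) / 2))) \<noteq> \<infinity>"
    by (intro nn_integral_PInf_AE) auto
  then show ?thesis
  proof eventually_elim
    case (elim \<omega>)
    let ?y = "\<lambda>n. 1 - exp (- ((X n \<omega>)\<^sup>2) / 2)"
    have s: "summable ?y" by (rule summable_suminf_not_top) (use elim in auto)
    then have "?y \<longlonglongrightarrow> 0" by (rule summable_LIMSEQ_zero)
    then have "\<forall>\<^sub>F n in sequentially. ?y n < 1/2" by (rule order_tendstoD) simp
    \<comment> \<open>With \<open>u = (X n \<omega>)\<^sup>2 / 2\<close> one has
      \<open>u * exp (- u) \<le> 1 - exp (- u)\<close>, and \<open>exp (- u) > 1/2\<close>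
      eventually. Hence \<open>u / 2 \<le> 1 - exp (- u)\<close>, and the square
      \<open>2 * u\<close> is at most 4 times the right-hand side.\<close>
    then have "\<forall>\<^sub>F n in sequentially. norm ((X n \<omega>)\<^sup>2) \<le> 4 * ?y n"
    proof eventually_elim
      case (elim n)
      define u where "u = (X n \<omega>)\<^sup>2 / 2"
      have "exp (- u) * (1 + u) \<le> exp (- u) * exp u" by (intro mult_left_mono exp_ge_add_one_self) simp
      then have "exp (- u) * (1 + u) \<le> 1" by (simp add: exp_add[symmetric])
      moreover have "exp (- u) > 1/2" "u \<ge> 0" using elim by (simp_all add: u_def)
      then have "u * (1/2) \<le> u * exp (- u)" by (intro mult_left_mono) auto
      ultimately have "u / 2 \<le> 1 - exp (- u)" by (simp add: algebra_simps)
      then show ?case by (simp add: u_def)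
    qed
    then show ?case by (rule summable_comparison_test_ev) (intro summable_mult s)
  qed
qed

end

section \<open>Laws of shifted paths\<close>

abbreviation path_space :: "(real \<Rightarrow> real) measure" where
  "path_space \<equiv> Pi\<^sub>M {0..} (\<lambda>_. borel)"

context prob_space
begin

text \<open>Laws on path space are determined by cylinders, and a cylinder is, up to a null set, an
  event about finitely many increments. Their joint law is a product by independence, with factors
  that agree by \<open>incr\<close>.\<close>

lemma distr_path_eq:
  fixes Y Y' :: "real \<Rightarrow> 'a \<Rightarrow> real"
  assumes meas: "\<And>s. s \<ge> 0 \<Longrightarrow> Y s \<in> borel_measurable M" "\<And>s. s \<ge> 0 \<Longrightarrow> Y' s \<in> borel_measurable M"
    and zero: "AE \<omega> in M. Y 0 \<omega> = 0" "AE \<omega> in M. Y' 0 \<omega> = 0"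
    and indep: "\<And>n \<tau>. \<tau> 0 = 0 \<Longrightarrow> (\<And>i. i < n \<Longrightarrow> \<tau> i \<le> \<tau> (Suc i)) \<Longrightarrow>
        indep_vars (\<lambda>_. borel) (\<lambda>i \<omega>. Y (\<tau> (Suc i)) \<omega> - Y (\<tau> i) \<omega>) {..<n::nat}"
      "\<And>n \<tau>. \<tau> 0 = 0 \<Longrightarrow> (\<And>i. i < n \<Longrightarrow> \<tau> i \<le> \<tau> (Suc i)) \<Longrightarrow>
        indep_vars (\<lambda>_. borel) (\<lambda>i \<omega>. Y' (\<tau> (Suc i)) \<omega> - Y' (\<tau> i) \<omega>) {..<n::nat}"
    and incr: "\<And>r s. 0 \<le> r \<Longrightarrow> r \<le> s \<Longrightarrow>
        distr M borel (\<lambda>\<omega>. Y s \<omega> - Y r \<omega>) = distr M borel (\<lambda>\<omega>. Y' s \<omega> - Y' r \<omega>)"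
  shows "distr M path_space (\<lambda>\<omega>. \<lambda>r\<in>{0..}. Y r \<omega>) = distr M path_space (\<lambda>\<omega>. \<lambda>r\<in>{0..}. Y' r \<omega>)"
proof (rule measure_eqI_PiM_infinite)
  fix A :: "real \<Rightarrow> real set" and J :: "real set"
  assume J: "finite J" "J \<subseteq> {0..}" and A: "\<And>i. i \<in> J \<Longrightarrow> A i \<in> sets borel"
  \<comment> \<open>Adding 0 starts the increments at a time where the value is known, so that
    partial sums recover the values of the path; it also keeps the list nonempty when
    \<open>J\<close> is empty.\<close>
  define ts where "ts = sorted_list_of_set (insert 0 J)"
  define m where "m = length ts"
  \<comment> \<open>Capping the index makes \<open>\<tau>\<close> total and monotone; the increment
    number \<open>m - 1\<close> is then zero.\<close>
  define \<tau> where "\<tau> i = ts ! min i (m - 1)" for i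
  have ts: "set ts = insert 0 J" "sorted ts" 
    unfolding ts_def using J by (simp_all only: set_sorted_list_of_set finite_insert sorted_sorted_list_of_set)
  then have m: "m > 0" unfolding m_def by (cases ts) auto
  have in_ts: "\<tau> i \<in> insert 0 J" for i
    unfolding \<tau>_def ts(1)[symmetric] by (rule nth_mem) (use m in \<open>simp add: m_def min_less_iff_disj\<close>)
  have \<tau>_nonneg: "\<tau> i \<ge> 0" for i using J in_ts[of i] by auto
  have \<tau>_mono: "\<tau> i \<le> \<tau> (Suc i)" for i
    unfolding \<tau>_def by (rule sorted_nth_mono[OF ts(2)]) (use m in \<open>auto simp: m_def min_less_iff_disj\<close>)
  have "0 \<in> set ts" using ts(1) by simp
  then obtain i0 where "i0 < m" "ts ! i0 = 0" unfolding m_def by (auto simp only: in_set_conv_nth)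
  then have "\<tau> 0 \<le> 0" using sorted_nth_mono[OF ts(2), of 0 i0] by (simp add: \<tau>_def m_def)
  then have \<tau>0: "\<tau> 0 = 0" using \<tau>_nonneg[of 0] by simp
  have J_\<tau>: "\<exists>k<m. \<tau> k = j" if "j \<in> J" for j
  proof -
    have "j \<in> set ts" using that ts(1) by simp
    then obtain k where "k < m" "ts ! k = j" unfolding m_def by (auto simp only: in_set_conv_nth)
    then show ?thesis by (intro exI[of _ k]) (auto simp: \<tau>_def min_def)
  qed
  let ?P = "Pi\<^sub>M {..<m} (\<lambda>_. borel :: real measure)"
  \<comment> \<open>The cylinder in terms of increments: the partial sum up to \<open>k\<close>
    stands for the value at time \<open>\<tau> k\<close>.\<close>
  define C where "C = {v \<in> space ?P. \<forall>k\<in>{..<m}. \<tau> k \<in> J \<longrightarrow> (\<Sum>i<k. v i) \<in> A (\<tau> k)}"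
  have C: "C \<in> sets ?P"
    unfolding C_def
  proof (rule sets.sets_Collect_finite_All[OF _ finite_lessThan])
    fix k assume k: "k \<in> {..<m}"
    have [measurable]: "(\<lambda>v. \<Sum>i<k. v i) \<in> borel_measurable ?P"
      by (intro borel_measurable_sum measurable_component_singleton) (use k in auto)
    show "{v \<in> space ?P. \<tau> k \<in> J \<longrightarrow> (\<Sum>i<k. v i) \<in> A (\<tau> k)} \<in> sets ?P"
    proof (cases "\<tau> k \<in> J")
      case True
      note [measurable] = A[OF True]
      show ?thesis by measurable
    qed simp
  qed
  have main: "emeasure (distr M path_space (\<lambda>\<omega>. \<lambda>r\<in>{0..}. W r \<omega>)) (prod_emb {0..} (\<lambda>_. borel) J (Pi\<^sub>E J A))
      = emeasure (Pi\<^sub>M {..<m} (\<lambda>i. distr M borel (\<lambda>\<omega>. W (\<tau> (Suc i)) \<omega> - W (\<tau> i) \<omega>))) C"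
    if W: "\<And>s. s \<ge> 0 \<Longrightarrow> W s \<in> borel_measurable M" and W0: "AE \<omega> in M. W 0 \<omega> = 0"
      and ind: "indep_vars (\<lambda>_. borel) (\<lambda>i \<omega>. W (\<tau> (Suc i)) \<omega> - W (\<tau> i) \<omega>) {..<m}"
    for W :: "real \<Rightarrow> 'a \<Rightarrow> real"
  proof -
    note [measurable] = W[OF \<tau>_nonneg]
    define V where "V \<omega> = (\<lambda>i\<in>{..<m}. W (\<tau> (Suc i)) \<omega> - W (\<tau> i) \<omega>)" for \<omega>
    have V: "V \<in> M \<rightarrow>\<^sub>M ?P" unfolding V_def by measurable
    have path: "(\<lambda>\<omega>. \<lambda>r\<in>{0..}. W r \<omega>) \<in> M \<rightarrow>\<^sub>M path_space"
      by (rule measurable_restrict) (use W in auto)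
    have emb: "prod_emb {0..} (\<lambda>_. borel) J (Pi\<^sub>E J A) \<in> sets path_space"
      using J A by (intro sets_PiM_I) auto
    have "emeasure (distr M path_space (\<lambda>\<omega>. \<lambda>r\<in>{0..}. W r \<omega>)) (prod_emb {0..} (\<lambda>_. borel) J (Pi\<^sub>E J A))
        = emeasure M ((\<lambda>\<omega>. \<lambda>r\<in>{0..}. W r \<omega>) -` prod_emb {0..} (\<lambda>_. borel) J (Pi\<^sub>E J A) \<inter> space M)"
      by (rule emeasure_distr[OF path emb])
    also have "\<dots> = emeasure M (V -` C \<inter> space M)"
    proof (rule emeasure_eq_AE)
      show "AE \<omega> in M. \<omega> \<in> (\<lambda>\<omega>. \<lambda>r\<in>{0..}. W r \<omega>) -` prod_emb {0..} (\<lambda>_. borel) J (Pi\<^sub>E J A) \<inter> space M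
          \<longleftrightarrow> \<omega> \<in> V -` C \<inter> space M"
        using W0 AE_space
      proof eventually_elim
        case (elim \<omega>)
        have sum: "(\<Sum>i<k. V \<omega> i) = W (\<tau> k) \<omega>" if "k < m" for k
        proof -
          have "(\<Sum>i<k. V \<omega> i) = (\<Sum>i<k. W (\<tau> (Suc i)) \<omega> - W (\<tau> i) \<omega>)"
            using that by (intro sum.cong) (auto simp: V_def)
          also have "\<dots> = W (\<tau> k) \<omega> - W (\<tau> 0) \<omega>" by (rule sum_lessThan_telescope[of "\<lambda>i. W (\<tau> i) \<omega>"])
          finally show ?thesis using elim \<tau>0 by simp
        qed
        have "V \<omega> \<in> C \<longleftrightarrow> (\<forall>k<m. \<tau> k \<in> J \<longrightarrow> W (\<tau> k) \<omega> \<in> A (\<tau> k))"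
          using measurable_space[OF V elim(2)] by (auto simp: C_def sum)
        also have "\<dots> \<longleftrightarrow> (\<forall>j\<in>J. W j \<omega> \<in> A j)" using J_\<tau> by metis
        also have "\<dots> \<longleftrightarrow> (\<lambda>r\<in>{0..}. W r \<omega>) \<in> prod_emb {0..} (\<lambda>_. borel) J (Pi\<^sub>E J A)"
          using J(2) by (auto simp: prod_emb_def PiE_iff subset_eq)
        finally show ?case using elim(2) by simp
      qed
    qed (use measurable_sets[OF path emb] measurable_sets[OF V C] in auto)
    also have "\<dots> = emeasure (distr M ?P V) C" by (rule emeasure_distr[OF V C, symmetric])
    also have "distr M ?P V = Pi\<^sub>M {..<m} (\<lambda>i. distr M borel (\<lambda>\<omega>. W (\<tau> (Suc i)) \<omega> - W (\<tau> i) \<omega>))"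
      unfolding V_def using ind m
      by (subst (asm) indep_vars_iff_distr_eq_PiM) auto
    finally show ?thesis .
  qed
  show "emeasure (distr M path_space (\<lambda>\<omega>. \<lambda>r\<in>{0..}. Y r \<omega>)) (prod_emb {0..} (\<lambda>_. borel) J (Pi\<^sub>E J A))
      = emeasure (distr M path_space (\<lambda>\<omega>. \<lambda>r\<in>{0..}. Y' r \<omega>)) (prod_emb {0..} (\<lambda>_. borel) J (Pi\<^sub>E J A))"
    using main[of Y, OF meas(1) zero(1) indep(1)[OF \<tau>0 \<tau>_mono]] main[of Y', OF meas(2) zero(2) indep(2)[OF \<tau>0 \<tau>_mono]]
    by (simp add: incr[OF \<tau>_nonneg \<tau>_mono])
next
  have "(\<lambda>\<omega>. \<lambda>r\<in>{0..}. Y r \<omega>) \<in> M \<rightarrow>\<^sub>M path_space"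
    by (rule measurable_restrict) (use meas in auto)
  then show "finite_measure (distr M path_space (\<lambda>\<omega>. \<lambda>r\<in>{0..}. Y r \<omega>))"
    by (rule finite_measure_distr)
qed auto

lemma distr_levy_shift:
  assumes levy: "levy_process M Z" and t: "t \<ge> 0"
  shows "distr M path_space (\<lambda>\<omega>. \<lambda>r\<in>{0..}. Z (t + r) \<omega> - Z t \<omega>) = distr M path_space (\<lambda>\<omega>. \<lambda>r\<in>{0..}. Z r \<omega>)"
proof (rule distr_path_eq)
  show "Z s \<in> borel_measurable M" "(\<lambda>\<omega>. Z (t + s) \<omega> - Z t \<omega>) \<in> borel_measurable M" if "s \<ge> 0" for s
    using that t by (auto intro!: borel_measurable_diff levy_measurable[OF levy])
  show "AE \<omega> in M. Z 0 \<omega> = 0" by (rule levy_zero[OF levy])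
  fix n and \<tau> :: "nat \<Rightarrow> real" assume \<tau>: "\<tau> 0 = 0" "\<And>i. i < n \<Longrightarrow> \<tau> i \<le> \<tau> (Suc i)"
  show "indep_vars (\<lambda>_. borel) (\<lambda>i \<omega>. Z (\<tau> (Suc i)) \<omega> - Z (\<tau> i) \<omega>) {..<n}"
    by (rule levy_indep[OF levy]) (use \<tau> in auto)
  have "indep_vars (\<lambda>_. borel) (\<lambda>i \<omega>. Z (t + \<tau> (Suc i)) \<omega> - Z (t + \<tau> i) \<omega>) {..<n}"
    by (rule levy_indep[OF levy, of "\<lambda>i. t + \<tau> i"]) (use \<tau> t in auto)
  then show "indep_vars (\<lambda>_. borel) (\<lambda>i \<omega>. Z (t + \<tau> (Suc i)) \<omega> - Z t \<omega> - (Z (t + \<tau> i) \<omega> - Z t \<omega>)) {..<n}"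
    by simp
next
  fix r s :: real assume rs: "0 \<le> r" "r \<le> s"
  have "distr M borel (\<lambda>\<omega>. Z (t + s) \<omega> - Z (t + r) \<omega>) = distr M borel (Z (s - r))"
    using levy_stationary[OF levy, of "t + r" "s - r"] t rs by simp
  also have "\<dots> = distr M borel (\<lambda>\<omega>. Z s \<omega> - Z r \<omega>)"
    using levy_stationary[OF levy, of r "s - r"] rs by simp
  finally show "distr M borel (\<lambda>\<omega>. Z (t + s) \<omega> - Z t \<omega> - (Z (t + r) \<omega> - Z t \<omega>)) = distr M borel (\<lambda>\<omega>. Z s \<omega> - Z r \<omega>)"
    by simp
qed simp

text \<open>One measurable map \<open>sh\<close> of path space shifts each coordinate, so
  independence survives the shift, and both joint laws are products with equal factors.\<close>

lemma distr_driving_shift: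
  assumes Z: "driving_stable_processes M \<F> \<alpha> Z" and t: "t \<ge> 0"
  shows "distr M (Pi\<^sub>M UNIV (\<lambda>_. path_space)) (\<lambda>\<omega> n. \<lambda>r\<in>{0..}. Z n (t + r) \<omega> - Z n t \<omega>)
    = distr M (Pi\<^sub>M UNIV (\<lambda>_. path_space)) (\<lambda>\<omega> n. \<lambda>r\<in>{0..}. Z n r \<omega>)"
proof -
  have levy: "levy_process M (Z n)" for n
    using Z by (simp add: driving_stable_processes_def normalized_stable_process_def)
  have indep: "indep_vars (\<lambda>_. path_space) (\<lambda>n \<omega>. \<lambda>r\<in>{0..}. Z n r \<omega>) UNIV"
    using Z by (simp add: driving_stable_processes_def)
  have meas: "(\<lambda>\<omega>. \<lambda>r\<in>{0..}. Z n r \<omega>) \<in> M \<rightarrow>\<^sub>M path_space" for n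
    by (rule measurable_restrict) (use levy_measurable[OF levy] in auto)
  define sh where "sh z = (\<lambda>r\<in>{0..}. z (t + r) - z t :: real)" for z :: "real \<Rightarrow> real"
  have sh: "sh \<in> path_space \<rightarrow>\<^sub>M path_space"
    unfolding sh_def
    by (intro measurable_restrict borel_measurable_diff measurable_component_singleton) (use t in auto)
  have sh_Z: "sh (\<lambda>r\<in>{0..}. Z n r \<omega>) = (\<lambda>r\<in>{0..}. Z n (t + r) \<omega> - Z n t \<omega>)" for n \<omega>
    using t by (auto simp: sh_def)
  have indep': "indep_vars (\<lambda>_. path_space) (\<lambda>n \<omega>. \<lambda>r\<in>{0..}. Z n (t + r) \<omega> - Z n t \<omega>) UNIV"
    using indep_vars_compose2[OF indep, of "\<lambda>_. sh" "\<lambda>_. path_space"] sh by (simp add: sh_Z)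
  have meas': "(\<lambda>\<omega>. \<lambda>r\<in>{0..}. Z n (t + r) \<omega> - Z n t \<omega>) \<in> M \<rightarrow>\<^sub>M path_space" for n
    using measurable_compose[OF meas sh] by (simp add: sh_Z)
  show ?thesis
    using indep indep' meas meas' distr_levy_shift[OF levy t]
    by (simp add: indep_vars_iff_distr_eq_PiM restrict_UNIV)
qed

section \<open>Conditional expectations with an independent second argument\<close>

lemma real_cond_exp_freezing:
  fixes g :: "'s \<Rightarrow> 'z \<Rightarrow> real"
  assumes G: "subalgebra M G" and \<zeta>: "\<zeta> \<in> M \<rightarrow>\<^sub>M N" and X: "X \<in> G \<rightarrow>\<^sub>M S"
    and indep: "indep_set (sets G) {\<zeta> -` B \<inter> space M | B. B \<in> sets N}"
    and g: "(\<lambda>p. g (fst p) (snd p)) \<in> borel_measurable (S \<Otimes>\<^sub>M N)" and bd: "\<And>x z. \<bar>g x z\<bar> \<le> B"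
  shows "AE \<omega> in M. real_cond_exp M G (\<lambda>\<omega>. g (X \<omega>) (\<zeta> \<omega>)) \<omega> = (\<integral>z. g (X \<omega>) z \<partial>distr M N \<zeta>)"
proof -
  interpret finite_measure_subalgebra M G by unfold_locales (rule G)
  interpret N: prob_space "distr M N \<zeta>" by (rule prob_space_distr[OF \<zeta>])
  have space_G: "space G = space M" and sets_G: "sets G \<subseteq> sets M" using G by (auto simp: subalgebra_def)
  \<comment> \<open>The identity, as a random element of the space with the sigma-algebra
    \<open>G\<close>, carries the whole past at once; both \<open>X\<close> and the conditioning
    events are functions of it.\<close>
  have id: "(\<lambda>\<omega>. \<omega>) \<in> M \<rightarrow>\<^sub>M G" by (rule measurable_from_subalg[OF G]) simp
  interpret MG: prob_space "distr M G (\<lambda>\<omega>. \<omega>)" by (rule prob_space_distr[OF id])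
  interpret P: pair_sigma_finite "distr M G (\<lambda>\<omega>. \<omega>)" "distr M N \<zeta>" ..
  have XM: "X \<in> M \<rightarrow>\<^sub>M S" by (rule measurable_from_subalg[OF G X])
  have gXz: "(\<lambda>p. g (X (fst p)) (snd p)) \<in> borel_measurable (G \<Otimes>\<^sub>M N)"
    using measurable_compose[OF measurable_Pair[OF measurable_compose[OF measurable_fst X] measurable_snd] g] by simp
  have f: "(\<lambda>\<omega>. g (X \<omega>) (\<zeta> \<omega>)) \<in> borel_measurable M"
    using measurable_compose[OF measurable_Pair[OF XM \<zeta>] g] by simp
  have inner: "(\<lambda>\<omega>. \<integral>z. g (X \<omega>) z \<partial>distr M N \<zeta>) \<in> borel_measurable G"
    by (rule N.borel_measurable_lebesgue_integral) (use gXz in \<open>simp add: case_prod_beta cong: measurable_cong_sets\<close>)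
  have inner_bd: "\<bar>\<integral>z. g (X \<omega>) z \<partial>distr M N \<zeta>\<bar> \<le> B" for \<omega>
  proof -
    have "B \<ge> 0" using bd[of "X \<omega>" undefined] by linarith
    then have "norm (\<integral>z. g (X \<omega>) z \<partial>distr M N \<zeta>) \<le> (\<integral>z. B \<partial>distr M N \<zeta>)"
      by (intro order.trans[OF integral_norm_bound] integral_mono') (auto simp: bd)
    then show ?thesis by (simp add: N.prob_space[simplified])
  qed
  \<comment> \<open>Independence, tested on rectangles, says that \<open>\<omega>\<close> seen
    through \<open>G\<close> and \<open>\<zeta>\<close> have a product as joint law. Fubini's
    theorem then integrates out \<open>\<zeta>\<close> while the past is frozen.\<close>
  have pair: "distr M G (\<lambda>\<omega>. \<omega>) \<Otimes>\<^sub>M distr M N \<zeta> = distr M (G \<Otimes>\<^sub>M N) (\<lambda>\<omega>. (\<omega>, \<zeta> \<omega>))"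
  proof (rule pair_measure_eqI)
    fix A C assume A: "A \<in> sets (distr M G (\<lambda>\<omega>. \<omega>))" and C: "C \<in> sets (distr M N \<zeta>)"
    then have AM: "A \<in> sets M" "A \<subseteq> space M"
      using sets_G sets.sets_into_space[of A M] by auto
    have "\<zeta> -` C \<inter> space M \<in> {\<zeta> -` B \<inter> space M | B. B \<in> sets N}" using C by auto
    then have "prob (A \<inter> (\<zeta> -` C \<inter> space M)) = prob A * prob (\<zeta> -` C \<inter> space M)"
      using A by (intro indep_setD[OF indep]) auto
    moreover have "(\<lambda>\<omega>. (\<omega>, \<zeta> \<omega>)) -` (A \<times> C) \<inter> space M = A \<inter> (\<zeta> -` C \<inter> space M)" by auto
    moreover have "(\<lambda>\<omega>. \<omega>) -` A \<inter> space M = A" using AM by auto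
    ultimately show "emeasure (distr M G (\<lambda>\<omega>. \<omega>)) A * emeasure (distr M N \<zeta>) C
        = emeasure (distr M (G \<Otimes>\<^sub>M N) (\<lambda>\<omega>. (\<omega>, \<zeta> \<omega>))) (A \<times> C)"
      using A C id \<zeta> measurable_Pair[OF id \<zeta>]
      by (simp add: emeasure_distr emeasure_eq_measure ennreal_mult[symmetric])
  qed (unfold_locales, simp cong: sets_pair_measure_cong)
  show ?thesis
  proof (rule real_cond_exp_charact)
    show "integrable M (\<lambda>\<omega>. g (X \<omega>) (\<zeta> \<omega>))"
      by (rule integrable_const_bound[where B = B]) (use f bd in auto)
    show "integrable M (\<lambda>\<omega>. \<integral>z. g (X \<omega>) z \<partial>distr M N \<zeta>)"
      by (rule integrable_const_bound[where B = B]) (use measurable_from_subalg[OF G inner] inner_bd in auto)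
    show "(\<lambda>\<omega>. \<integral>z. g (X \<omega>) z \<partial>distr M N \<zeta>) \<in> borel_measurable G" by (rule inner)
    fix A assume A: "A \<in> sets G"
    let ?k = "\<lambda>p. indicator A (fst p) * g (X (fst p)) (snd p)"
    have k: "?k \<in> borel_measurable (G \<Otimes>\<^sub>M N)"
      by (intro borel_measurable_times gXz measurable_compose[OF measurable_fst borel_measurable_indicator[OF A]])
    have "(LINT \<omega>:A|M. g (X \<omega>) (\<zeta> \<omega>)) = (\<integral>\<omega>. ?k (\<omega>, \<zeta> \<omega>) \<partial>M)"
      by (simp add: set_lebesgue_integral_def)
    also have "\<dots> = (\<integral>p. ?k p \<partial>distr M (G \<Otimes>\<^sub>M N) (\<lambda>\<omega>. (\<omega>, \<zeta> \<omega>)))"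
      by (rule integral_distr[symmetric, OF measurable_Pair[OF id \<zeta>] k])
    also have "\<dots> = (\<integral>p. ?k p \<partial>(distr M G (\<lambda>\<omega>. \<omega>) \<Otimes>\<^sub>M distr M N \<zeta>))" by (simp only: pair)
    also have "\<dots> = (\<integral>\<omega>. \<integral>z. ?k (\<omega>, z) \<partial>distr M N \<zeta> \<partial>distr M G (\<lambda>\<omega>. \<omega>))"
    proof (rule P.integral_fst'[symmetric])
      interpret PP: prob_space "distr M (G \<Otimes>\<^sub>M N) (\<lambda>\<omega>. (\<omega>, \<zeta> \<omega>))"
        by (rule prob_space_distr[OF measurable_Pair[OF id \<zeta>]])
      show "integrable (distr M G (\<lambda>\<omega>. \<omega>) \<Otimes>\<^sub>M distr M N \<zeta>) ?k"
        unfolding pair by (rule PP.integrable_const_bound[where B = B])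
          (use k bd bd[THEN order_trans[OF abs_ge_zero]] in \<open>auto simp: indicator_def cong: measurable_cong_sets\<close>)
    qed
    also have "\<dots> = (\<integral>\<omega>. \<integral>z. ?k (\<omega>, z) \<partial>distr M N \<zeta> \<partial>M)"
    proof (rule integral_distr[OF id])
      show "(\<lambda>\<omega>. \<integral>z. ?k (\<omega>, z) \<partial>distr M N \<zeta>) \<in> borel_measurable G"
        using inner A by simp
    qed
    also have "\<dots> = (LINT \<omega>:A|M. \<integral>z. g (X \<omega>) z \<partial>distr M N \<zeta>)"
      by (simp add: set_lebesgue_integral_def)
    finally show "(LINT \<omega>:A|M. g (X \<omega>) (\<zeta> \<omega>)) = (LINT \<omega>:A|M. \<integral>z. g (X \<omega>) z \<partial>distr M N \<zeta>)" .
  qed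
qed

end

section \<open>The mild solution\<close>

text \<open>Makes predictable processes jointly measurable. Time is clamped because predictable sets
  live over \<open>{0..}\<close>, while Fubini's theorem is applied over the whole line.\<close>

lemma predictable_to_pair:
  assumes filt: "usual_filtration M \<F>"
  shows "(\<lambda>p. (max 0 (fst p), snd p)) \<in> borel \<Otimes>\<^sub>M M \<rightarrow>\<^sub>M predictable_sigma M \<F>"
proof (subst predictable_sigma_def, rule measurable_measure_of[OF predictable_generator[OF filt]])
  show "(\<lambda>p. (max (0 :: real) (fst p), snd p)) \<in> space (borel \<Otimes>\<^sub>M M) \<rightarrow> {0..} \<times> space M"
    by (auto simp: space_pair_measure)
  fix C assume "C \<in> {{s<..t} \<times> B | s t B. 0 \<le> s \<and> s < t \<and> B \<in> sets (\<F> s)} \<union> {{0} \<times> B | B. B \<in> sets (\<F> 0)}"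
  then consider s u B where "C = {s<..u} \<times> B" "0 \<le> s" "B \<in> sets (\<F> s)"
    | B where "C = {0} \<times> B" "B \<in> sets (\<F> 0)" by blast
  then obtain I s B where C: "C = I \<times> B" "0 \<le> s" "B \<in> sets (\<F> s)" and I: "I \<in> sets (borel :: real measure)"
  proof cases
    case (1 s u B)
    then show ?thesis using that[of "{s<..u}" B s] by auto
  next
    case (2 B)
    then show ?thesis using that[of "{0}" B 0] by auto
  qed
  have B: "B \<in> sets M" using filtration_subalgebra[OF filt C(2)] C(3) by (auto simp: subalgebra_def)
  have "(\<lambda>p. (max 0 (fst p), snd p)) -` C \<inter> space (borel \<Otimes>\<^sub>M M) = (max 0 -` I) \<times> B"
    using sets.sets_into_space[OF B] by (auto simp: C space_pair_measure)
  moreover have "max 0 -` I \<in> sets (borel :: real measure)"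
    using measurable_sets[of "max (0::real)" borel borel I] I by simp
  ultimately show "(\<lambda>p. (max 0 (fst p), snd p)) -` C \<inter> space (borel \<Otimes>\<^sub>M M) \<in> sets (borel \<Otimes>\<^sub>M M)"
    using B by simp
qed

locale stable_driven_equation = prob_space M + spectral_semigroup e \<gamma>
  for M :: "'w measure" and e :: "nat \<Rightarrow> 'h::{real_inner, banach, second_countable_topology}" and \<gamma> +
  fixes \<F> :: "real \<Rightarrow> 'w measure" and \<alpha> :: real and \<beta> :: "nat \<Rightarrow> real" and Z :: "nat \<Rightarrow> real \<Rightarrow> 'w \<Rightarrow> real"
    and D :: "'h set" and A F :: "'h \<Rightarrow> 'h" and L K :: real
  assumes \<alpha>: "0 < \<alpha>" "\<alpha> \<le> 2"
    and filt: "usual_filtration M \<F>"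
    and driving: "driving_stable_processes M \<F> \<alpha> Z"
    and \<beta>: "\<And>n. \<beta> n > 0"
    and sa: "self_adjoint_operator D A" "\<And>n. e n \<in> D" "\<And>n. A (e n) = - \<gamma> n *\<^sub>R e n"
    and sum: "summable (\<lambda>n. \<beta> n powr \<alpha> / \<gamma> n)"
    and lip: "L \<ge> 0" "\<And>x y. norm (F x - F y) \<le> L * norm (x - y)" and bd: "\<And>x. norm (F x) \<le> K"
begin

sublocale mild: mild_equation sgr F L K
proof (rule mild_equation.intro)
  show "(\<lambda>x. sgr (fst x) (snd x)) \<in> borel_measurable (borel \<Otimes>\<^sub>M borel)"
    unfolding sgr_def diag_def by measurable
qed (auto simp: bounded_linear_sgr norm_sgr_le sgr_add lip bd)

lemma stable: "normalized_stable_process M \<alpha> (Z n)"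
  using driving[unfolded driving_stable_processes_def, THEN conjunct1] by blast

lemma levy: "levy_process M (Z n)"
  using stable by (simp add: normalized_stable_process_def)

lemma adapted: "t \<ge> 0 \<Longrightarrow> Z n t \<in> borel_measurable (\<F> t)"
  using driving[unfolded driving_stable_processes_def, THEN conjunct2, THEN conjunct2, THEN conjunct1] by blast

text \<open>A deterministic functional of a family of paths, so that the same formula can be applied
  to the driving processes and to their increments after a later time.\<close>

definition noise :: "(nat \<Rightarrow> real \<Rightarrow> real) \<Rightarrow> real \<Rightarrow> 'h" where
  "noise z t = (\<Sum>n. (\<beta> n * conv (\<gamma> n) (z n) t) *\<^sub>R e n)"

definition ZA :: "real \<Rightarrow> 'w \<Rightarrow> 'h" where
  "ZA t \<omega> = noise (\<lambda>n r. Z n r \<omega>) t"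

definition X :: "'h \<Rightarrow> real \<Rightarrow> 'w \<Rightarrow> 'h" where
  "X x t \<omega> = mild.sol (\<lambda>s. sgr s x + ZA s \<omega>) t"

lemma noise_cong: "(\<And>n r. r \<ge> 0 \<Longrightarrow> z n r = z' n r) \<Longrightarrow> noise z = noise z'"
proof -
  assume "\<And>n r. r \<ge> 0 \<Longrightarrow> z n r = z' n r"
  then have "conv (\<gamma> n) (z n) = conv (\<gamma> n) (z' n)" for n by (intro conv_cong) auto
  then show ?thesis by (simp add: noise_def fun_eq_iff)
qed

lemma noise_measurable_past:
  assumes "past_closed G" "\<And>n. (\<lambda>p. lft (\<lambda>s. U n s (snd p)) (fst p)) \<in> borel_measurable G"
  shows "(\<lambda>p. noise (\<lambda>n s. U n s (snd p)) (fst p)) \<in> borel_measurable G"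
  unfolding noise_def
  by (intro borel_measurable_suminf borel_measurable_scaleR borel_measurable_times borel_measurable_const
      conv_measurable_past[OF assms(1), where U = "U n" for n] assms(2))

lemma noise_measurable_pair:
  assumes "\<And>n s. s \<ge> 0 \<Longrightarrow> U n s \<in> borel_measurable N"
  shows "(\<lambda>p. noise (\<lambda>n s. U n s (snd p)) (fst p)) \<in> borel_measurable (borel \<Otimes>\<^sub>M N)"
  by (intro noise_measurable_past past_closed_pair lft_measurable_pair assms)

lemma noise_measurable [measurable]: "noise z \<in> borel_measurable borel"
  by (rule borel_measurable_section, rule noise_measurable_pair[where U = "\<lambda>n s _. z n s"]) measurable

lemma noise_measurable_path:
  "(\<lambda>p. noise (snd p) (fst p)) \<in> borel_measurable (borel \<Otimes>\<^sub>M Pi\<^sub>M UNIV (\<lambda>_. path_space))"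
proof (rule noise_measurable_pair[where U = "\<lambda>n s z. z n s"])
  fix n and s :: real assume "s \<ge> 0"
  then show "(\<lambda>z. z n s) \<in> borel_measurable (Pi\<^sub>M UNIV (\<lambda>_. path_space))"
    by (intro measurable_compose[OF measurable_component_singleton[of n] measurable_component_singleton[of s]]) auto
qed

lemma ZA_measurable_pair: "(\<lambda>p. ZA (fst p) (snd p)) \<in> borel_measurable (borel \<Otimes>\<^sub>M M)"
  unfolding ZA_def by (rule noise_measurable_pair[OF levy_measurable[OF levy]])

lemma ZA_path_measurable [measurable]: "(\<lambda>t. ZA t \<omega>) \<in> borel_measurable borel"
  unfolding ZA_def by measurable

lemma ZA_predictable: "(\<lambda>p. ZA (fst p) (snd p)) \<in> borel_measurable (predictable_sigma M \<F>)"
  unfolding ZA_def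
  by (intro noise_measurable_past past_closed_predictable lft_measurable_predictable filt adapted)

text \<open>Square summability of the coordinates follows from the cosine bound at the fixed time
  \<open>t\<close>; the exceptional set may depend on \<open>t\<close>.\<close>

lemma ZA_AE_sums:
  assumes t: "t \<ge> 0"
  shows "AE \<omega> in M. (\<lambda>n. (\<beta> n * conv (\<gamma> n) (\<lambda>r. Z n r \<omega>) t) *\<^sub>R e n) sums ZA t \<omega>"
proof -
  have "AE \<omega> in M. summable (\<lambda>n. (\<beta> n * conv (\<gamma> n) (\<lambda>r. Z n r \<omega>) t)\<^sup>2)"
  proof (rule AE_summable_sq[OF _ \<alpha>])
    show "(\<lambda>\<omega>. \<beta> n * conv (\<gamma> n) (\<lambda>r. Z n r \<omega>) t) \<in> borel_measurable M" for n
      by (intro borel_measurable_times borel_measurable_const conv_random_measurable(1) levy_measurable[OF levy])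
    have "summable (\<lambda>n. (1 / \<alpha>) * (\<beta> n powr \<alpha> / \<gamma> n))" by (intro summable_mult sum)
    then show "summable (\<lambda>n. \<beta> n powr \<alpha> / (\<alpha> * \<gamma> n))" by (simp add: mult.commute)
    show "0 \<le> \<beta> n powr \<alpha> / (\<alpha> * \<gamma> n)" for n using \<alpha> \<gamma>_pos[of n] by simp
    show "1 - expectation (\<lambda>\<omega>. cos (h * (\<beta> n * conv (\<gamma> n) (\<lambda>r. Z n r \<omega>) t))) \<le> \<bar>h\<bar> powr \<alpha> * (\<beta> n powr \<alpha> / (\<alpha> * \<gamma> n))" for n h
      by (rule expectation_cos_conv_ge[OF stable \<alpha>(1) \<gamma>_pos \<beta> t])
  qed
  then show ?thesis
    by eventually_elim (auto simp: ZA_def noise_def intro: summable_sums summable_basis_series)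
qed

lemma stochastic_convolution_ZA: "stochastic_convolution M \<F> e \<beta> \<gamma> Z ZA"
  unfolding stochastic_convolution_def
proof (intro conjI allI impI)
  show "predictable M \<F> ZA" using ZA_predictable by (simp add: predictable_def case_prod_beta)
  fix t :: real assume t: "t \<ge> 0"
  show "\<exists>I. (\<forall>n. has_stochastic_integral M (Z n) (\<lambda>s. exp (- \<gamma> n * (t - s)) * \<beta> n) t (I n)) \<and>
      (AE \<omega> in M. (\<lambda>n. I n \<omega> *\<^sub>R e n) sums ZA t \<omega>)"
    by (intro exI[of _ "\<lambda>n \<omega>. \<beta> n * conv (\<gamma> n) (\<lambda>r. Z n r \<omega>) t"] conjI allI ZA_AE_sums t
        levy_has_stochastic_integral[OF levy] less_imp_le[OF \<gamma>_pos])
qed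

lemma stochastic_convolution_unique:
  assumes W: "stochastic_convolution M \<F> e \<beta> \<gamma> Z W" and t: "t \<ge> 0"
  shows "AE \<omega> in M. W t \<omega> = ZA t \<omega>"
proof -
  obtain I where I: "\<And>n. has_stochastic_integral M (Z n) (\<lambda>s. exp (- \<gamma> n * (t - s)) * \<beta> n) t (I n)"
    and W: "AE \<omega> in M. (\<lambda>n. I n \<omega> *\<^sub>R e n) sums W t \<omega>"
    using W t unfolding stochastic_convolution_def by blast
  have "AE \<omega> in M. I n \<omega> = \<beta> n * conv (\<gamma> n) (\<lambda>r. Z n r \<omega>) t" for n
    by (rule stochastic_integral_unique[OF levy t I levy_has_stochastic_integral[OF levy t less_imp_le[OF \<gamma>_pos]]])
  then have "AE \<omega> in M. \<forall>n. I n \<omega> = \<beta> n * conv (\<gamma> n) (\<lambda>r. Z n r \<omega>) t" unfolding AE_all_countable by blast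
  with W ZA_AE_sums[OF t] show ?thesis by eventually_elim (auto intro: sums_unique2)
qed

lemma X_predictable: "(\<lambda>p. X x (fst p) (snd p)) \<in> borel_measurable (predictable_sigma M \<F>)"
  unfolding X_def
proof (rule mild.sol_measurable_past[OF past_closed_predictable[OF filt], where U = "\<lambda>s \<omega>. sgr s x + ZA s \<omega>"])
  note [measurable] = ZA_predictable fst_predictable[OF filt]
  show "(\<lambda>p. sgr (fst p) x + ZA (fst p) (snd p)) \<in> borel_measurable (predictable_sigma M \<F>)" by measurable
qed

lemma X_eq: "t \<ge> 0 \<Longrightarrow> X x t \<omega> = sgr t x + ZA t \<omega> + mild.drift (\<lambda>s. X x s \<omega>) t"
  unfolding X_def by (rule mild.sol_eq) measurable

lemma mild_integral_eq:
  assumes t: "t \<ge> 0"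
  shows "(LINT s:{0..t}|lborel. exp_semigroup D A (t - s) (F (v s))) = mild.drift v t"
  unfolding mild.drift_def
  by (intro set_lebesgue_integral_cong) (auto simp: exp_semigroup_eq_sgr[OF sa])

lemma mild_solution_X: "mild_solution M \<F> e \<beta> \<gamma> Z D A F x (X x)"
  unfolding mild_solution_def
  by (intro conjI exI[of _ ZA] stochastic_convolution_ZA allI impI AE_I2)
     (use X_predictable in \<open>auto simp: predictable_def case_prod_beta mild_integral_eq exp_semigroup_eq_sgr[OF sa] X_eq\<close>)

lemma mild_solution_unique:
  assumes Y: "mild_solution M \<F> e \<beta> \<gamma> Z D A F x Y" and t: "t \<ge> 0"
  shows "AE \<omega> in M. Y t \<omega> = X x t \<omega>"
proof -
  obtain W where pY: "predictable M \<F> Y" and W: "stochastic_convolution M \<F> e \<beta> \<gamma> Z W"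
    and eq: "\<And>t. t \<ge> 0 \<Longrightarrow> AE \<omega> in M. Y t \<omega> = exp_semigroup D A t x
      + (LINT s:{0..t}|lborel. exp_semigroup D A (t - s) (F (Y s \<omega>))) + W t \<omega>"
    using Y unfolding mild_solution_def by blast
  \<comment> \<open>Values of \<open>Y\<close> at negative times are arbitrary. Freezing them at
    \<open>Y 0\<close> gives Borel paths on the line and leaves the drift unchanged.\<close>
  define v where "v s \<omega> = Y (max 0 s) \<omega>" for s \<omega>
  have v: "(\<lambda>p. v (fst p) (snd p)) \<in> borel_measurable (borel \<Otimes>\<^sub>M M)"
    using measurable_compose[OF predictable_to_pair[OF filt] pY[unfolded predictable_def]] by (simp add: v_def)
  have v_path: "(\<lambda>s. v s \<omega>) \<in> borel_measurable borel" if "\<omega> \<in> space M" for \<omega>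
    using measurable_compose[OF measurable_Pair2'[OF that] v] by simp
  have v_eq: "AE \<omega> in M. v s \<omega> = sgr s x + ZA s \<omega> + mild.drift (\<lambda>s. v s \<omega>) s" if s: "s \<ge> 0" for s
    using eq[OF s] stochastic_convolution_unique[OF W s]
  proof eventually_elim
    case (elim \<omega>)
    have "mild.drift (\<lambda>s. Y s \<omega>) s = mild.drift (\<lambda>s. v s \<omega>) s"
      unfolding mild.drift_def by (intro set_lebesgue_integral_cong) (auto simp: v_def)
    then show ?case using elim s by (simp add: mild_integral_eq exp_semigroup_eq_sgr[OF sa] v_def)
  qed
  have "AE \<omega> in M. AE s in lborel. s \<ge> 0 \<longrightarrow> v s \<omega> = sgr s x + ZA s \<omega> + mild.drift (\<lambda>s. v s \<omega>) s"
  proof (rule AE_lborel_commute[OF _ v _ v_eq])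
    note [measurable] = ZA_measurable_pair mild.drift_measurable_past[OF past_closed_pair v]
    show "(\<lambda>p. sgr (fst p) x + ZA (fst p) (snd p) + mild.drift (\<lambda>s. v s (snd p)) (fst p)) \<in> borel_measurable (borel \<Otimes>\<^sub>M M)"
      by measurable
  qed unfold_locales
  with v_eq[OF t] AE_space show ?thesis
  proof eventually_elim
    case (elim \<omega>)
    have "v t \<omega> = X x t \<omega>"
      unfolding X_def by (rule mild.sol_unique_AE[OF _ v_path[OF elim(2)] _ t]) (use elim in auto)
    then show ?case using t by (simp add: v_def)
  qed
qed

lemma X_measurable: "t \<ge> 0 \<Longrightarrow> X x t \<in> borel_measurable (\<F> t)"
  by (rule predictable_imp_adapted[OF filt]) (use X_predictable in \<open>simp_all add: case_prod_beta\<close>)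

lemma X_random: "t \<ge> 0 \<Longrightarrow> X x t \<in> borel_measurable M"
  by (rule measurable_from_subalg[OF filtration_subalgebra[OF filt] X_measurable])

lemma feller: "feller_process M X"
  unfolding feller_process_def
proof (intro allI impI, elim conjE)
  fix t :: real and f :: "'h \<Rightarrow> real"
  assume t: "t \<ge> 0" and f: "continuous_on UNIV f" and "bounded (range f)"
  then obtain B where B: "\<And>x. \<bar>f x\<bar> \<le> B" unfolding bounded_iff by auto
  have [measurable]: "f \<in> borel_measurable borel" by (rule borel_measurable_continuous_onI[OF f])
  note [measurable] = X_random[OF t]
  show "continuous_on UNIV (transition_operator M X t f)"
    unfolding continuous_on_sequentially comp_def
  proof (intro allI ballI impI, elim conjE)
    fix u :: "nat \<Rightarrow> 'h" and x :: 'h assume u: "u \<longlonglongrightarrow> x"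
    show "(\<lambda>n. transition_operator M X t f (u n)) \<longlonglongrightarrow> transition_operator M X t f x"
      unfolding transition_operator_def
    proof (rule integral_dominated_convergence[where w = "\<lambda>_. B"])
      have "(\<lambda>n. X (u n) t \<omega>) \<longlonglongrightarrow> X x t \<omega>" for \<omega>
      proof (rule Lim_null_comparison[THEN LIM_zero_cancel])
        \<comment> \<open>The noise cancels in the difference of the two inputs, and
          \<open>sgr\<close> is a contraction on what remains.\<close>
        have "norm (X (u n) t \<omega> - X x t \<omega>) \<le> norm (u n - x) * exp (L * t)" for n
          unfolding X_def
        proof (rule mild.sol_lipschitz[OF _ _ _ t])
          show "norm (sgr s (u n) + ZA s \<omega> - (sgr s x + ZA s \<omega>)) \<le> norm (u n - x)" for s
            using norm_sgr_le[of s "u n - x"] linear_diff[OF bounded_linear.linear[OF bounded_linear_sgr], of s "u n" x] by simp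
        qed measurable
        then show "\<forall>\<^sub>F n in sequentially. norm (X (u n) t \<omega> - X x t \<omega>) \<le> norm (u n - x) * exp (L * t)" by simp
        have "(\<lambda>n. norm (u n - x) * exp (L * t)) \<longlonglongrightarrow> norm (x - x) * exp (L * t)" by (intro tendsto_intros u)
        then show "(\<lambda>n. norm (u n - x) * exp (L * t)) \<longlonglongrightarrow> 0" by simp
      qed
      then show "AE \<omega> in M. (\<lambda>n. f (X (u n) t \<omega>)) \<longlonglongrightarrow> f (X x t \<omega>)"
        by (intro AE_I2 continuous_on_tendsto_compose[OF f]) auto
    qed (use B in auto)
  qed
qed

section \<open>Restarting at a later time, and the Markov property\<close>

definition shifted :: "real \<Rightarrow> 'w \<Rightarrow> nat \<Rightarrow> real \<Rightarrow> real" where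
  "shifted t \<omega> n = (\<lambda>r\<in>{0..}. Z n (t + r) \<omega> - Z n t \<omega>)"

text \<open>The sigma-algebra is left open because two are used: that of \<open>M\<close>, and the
  one generated by the increments after \<open>t\<close>, which independence refers to.\<close>

lemma shifted_measurable:
  assumes t: "t \<ge> 0" and N: "\<And>n r. r \<ge> 0 \<Longrightarrow> (\<lambda>\<omega>. Z n (t + r) \<omega> - Z n t \<omega>) \<in> borel_measurable N"
  shows "shifted t \<in> N \<rightarrow>\<^sub>M Pi\<^sub>M UNIV (\<lambda>_. path_space)"
proof -
  have "(\<lambda>\<omega>. shifted t \<omega> n) \<in> N \<rightarrow>\<^sub>M path_space" for n
    unfolding shifted_def by (rule measurable_restrict) (simp add: N)
  then have "(\<lambda>\<omega>. \<lambda>n\<in>UNIV. shifted t \<omega> n) \<in> N \<rightarrow>\<^sub>M Pi\<^sub>M UNIV (\<lambda>_. path_space)"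
    by (rule measurable_restrict)
  then show ?thesis by (simp only: restrict_UNIV)
qed

lemma shifted_random:
  assumes t: "t \<ge> 0" shows "shifted t \<in> M \<rightarrow>\<^sub>M Pi\<^sub>M UNIV (\<lambda>_. path_space)"
  by (intro shifted_measurable borel_measurable_diff levy_measurable[OF levy]) (use t in auto)

text \<open>This is \<open>conv_shift\<close> in each coordinate, followed by subtraction of two
  series. Convergence at \<open>t\<close> and \<open>t + s\<close>, cadlag paths and the absence of
  a jump at \<open>t\<close> hold almost surely for all \<open>n\<close> together.\<close>

lemma noise_shifted_AE:
  assumes t: "t \<ge> 0" and s: "s \<ge> 0"
  shows "AE \<omega> in M. ZA (t + s) \<omega> - sgr s (ZA t \<omega>) = noise (shifted t \<omega>) s"
proof -
  have "AE \<omega> in M. \<forall>n. cadlag (\<lambda>r. Z n r \<omega>)" unfolding AE_all_countable using levy_cadlag[OF levy] by blast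
  moreover have "AE \<omega> in M. \<forall>n. lft (\<lambda>r. Z n r \<omega>) t = Z n t \<omega>"
    unfolding AE_all_countable using levy_lft_AE[OF levy t] by blast
  moreover have "t + s \<ge> 0" using t s by simp
  note ZA_AE_sums[OF t] ZA_AE_sums[OF this]
  ultimately show ?thesis
  proof eventually_elim
    case (elim \<omega>)
    have "(\<lambda>n. (exp (- \<gamma> n * s) * (\<beta> n * conv (\<gamma> n) (\<lambda>r. Z n r \<omega>) t)) *\<^sub>R e n) sums sgr s (ZA t \<omega>)"
      using sgr_sums[of s "ZA t \<omega>"] s by (simp add: inner_basis_series[OF elim(3)])
    from sums_diff[OF elim(4) this]
    have "(\<lambda>n. (\<beta> n * (conv (\<gamma> n) (\<lambda>r. Z n r \<omega>) (t + s) - exp (- \<gamma> n * s) * conv (\<gamma> n) (\<lambda>r. Z n r \<omega>) t)) *\<^sub>R e n)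
        sums (ZA (t + s) \<omega> - sgr s (ZA t \<omega>))"
      by (simp add: algebra_simps)
    moreover have "conv (\<gamma> n) (\<lambda>r. Z n r \<omega>) (t + s) - exp (- \<gamma> n * s) * conv (\<gamma> n) (\<lambda>r. Z n r \<omega>) t
        = conv (\<gamma> n) (shifted t \<omega> n) s" for n
    proof -
      have "conv (\<gamma> n) (shifted t \<omega> n) = conv (\<gamma> n) (\<lambda>r. Z n (t + r) \<omega> - Z n t \<omega>)"
        by (rule conv_cong) (simp add: shifted_def)
      then show ?thesis using conv_shift[of "\<lambda>r. Z n r \<omega>" t s "\<gamma> n"] elim(1,2) t s by simp
    qed
    ultimately show ?case by (simp add: noise_def sums_iff)
  qed
qed

definition flow :: "real \<Rightarrow> 'h \<Rightarrow> (nat \<Rightarrow> real \<Rightarrow> real) \<Rightarrow> 'h" where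
  "flow h y z = mild.sol (\<lambda>s. sgr s y + noise z s) h"

text \<open>Conditioning inserts a random state, so measurability is required jointly in the state
  and the noise path. The pair of both plays the part of the random parameter in
  \<open>sol_measurable_past\<close>.\<close>

lemma flow_measurable:
  "(\<lambda>p. flow h (fst p) (snd p)) \<in> borel_measurable (borel \<Otimes>\<^sub>M Pi\<^sub>M UNIV (\<lambda>_. path_space))"
proof -
  let ?N = "borel \<Otimes>\<^sub>M Pi\<^sub>M UNIV (\<lambda>_. path_space) :: ('h \<times> (nat \<Rightarrow> real \<Rightarrow> real)) measure"
  have "(\<lambda>p. (fst p, snd (snd p))) \<in> borel \<Otimes>\<^sub>M ?N \<rightarrow>\<^sub>M borel \<Otimes>\<^sub>M Pi\<^sub>M UNIV (\<lambda>_. path_space)" by measurable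
  from measurable_compose[OF this noise_measurable_path]
  have [measurable]: "(\<lambda>p. noise (snd (snd p)) (fst p)) \<in> borel_measurable (borel \<Otimes>\<^sub>M ?N)" by simp
  have "(\<lambda>p. mild.sol (\<lambda>s. sgr s (fst (snd p)) + noise (snd (snd p)) s) (fst p)) \<in> borel_measurable (borel \<Otimes>\<^sub>M ?N)"
    by (rule mild.sol_measurable_past[OF past_closed_pair, where U = "\<lambda>s a. sgr s (fst a) + noise (snd a) s"]) measurable
  moreover have "(\<lambda>p. (h, p)) \<in> ?N \<rightarrow>\<^sub>M borel \<Otimes>\<^sub>M ?N" by measurable
  ultimately have "(\<lambda>p. (\<lambda>p. mild.sol (\<lambda>s. sgr s (fst (snd p)) + noise (snd (snd p)) s) (fst p)) (h, p)) \<in> borel_measurable ?N"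
    by (rule measurable_compose[rotated])
  then show ?thesis by (simp add: flow_def)
qed

text \<open>\<open>shifted 0\<close> subtracts \<open>Z n 0\<close>, which vanishes only almost
  surely; hence the assumption on \<open>\<omega>\<close>.\<close>

lemma X_eq_flow: "X y h \<omega> = flow h y (shifted 0 \<omega>)" if "\<And>n. Z n 0 \<omega> = 0"
proof -
  have "noise (\<lambda>n r. Z n r \<omega>) = noise (shifted 0 \<omega>)" by (rule noise_cong) (simp add: shifted_def that)
  then show ?thesis by (simp add: X_def flow_def ZA_def)
qed

lemma X_flow_AE:
  assumes t: "t \<ge> 0" and h: "h \<ge> 0"
  shows "AE \<omega> in M. X x (t + h) \<omega> = flow h (X x t \<omega>) (shifted t \<omega>)"
proof -
  \<comment> \<open>\<open>sol_cong_AE\<close> asks for equal inputs at almost every time and at the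
    final time \<open>h\<close>. This gives the former, and \<open>noise_shifted_AE\<close> at
    \<open>h\<close> gives the latter.\<close>
  have "AE \<omega> in M. AE s in lborel. s \<ge> 0 \<longrightarrow> ZA (t + s) \<omega> - sgr s (ZA t \<omega>) = noise (shifted t \<omega>) s"
  proof (rule AE_lborel_commute[OF _ _ _ noise_shifted_AE[OF t]])
    have 1: "(\<lambda>p. (t + fst p, snd p)) \<in> borel \<Otimes>\<^sub>M M \<rightarrow>\<^sub>M borel \<Otimes>\<^sub>M M" by measurable
    have 2: "(\<lambda>p. (t, snd p)) \<in> borel \<Otimes>\<^sub>M M \<rightarrow>\<^sub>M borel \<Otimes>\<^sub>M M" by measurable
    have [measurable]: "(\<lambda>p. ZA (t + fst p) (snd p)) \<in> borel_measurable (borel \<Otimes>\<^sub>M M)"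
      "(\<lambda>p. ZA t (snd p)) \<in> borel_measurable (borel \<Otimes>\<^sub>M M)"
      using measurable_compose[OF 1 ZA_measurable_pair] measurable_compose[OF 2 ZA_measurable_pair] by simp_all
    show "(\<lambda>p. ZA (t + fst p) (snd p) - sgr (fst p) (ZA t (snd p))) \<in> borel_measurable (borel \<Otimes>\<^sub>M M)" by measurable
    note [measurable] = shifted_random[OF t]
    have 3: "(\<lambda>p. (fst p, shifted t (snd p))) \<in> borel \<Otimes>\<^sub>M M \<rightarrow>\<^sub>M borel \<Otimes>\<^sub>M Pi\<^sub>M UNIV (\<lambda>_. path_space)" by measurable
    show "(\<lambda>p. noise (shifted t (snd p)) (fst p)) \<in> borel_measurable (borel \<Otimes>\<^sub>M M)"
      using measurable_compose[OF 3 noise_measurable_path] by simp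
  qed unfold_locales
  with noise_shifted_AE[OF t h] show ?thesis
  proof eventually_elim
    case (elim \<omega>)
    define u where "u s = sgr s x + ZA s \<omega>" for s
    have [measurable]: "u \<in> borel_measurable borel" unfolding u_def[abs_def] by measurable
    have u: "u (t + s) - sgr s (u t) = ZA (t + s) \<omega> - sgr s (ZA t \<omega>)" if "s \<ge> 0" for s
      using that t sgr_add[of s t x]
      by (simp add: u_def linear_add[OF bounded_linear.linear[OF bounded_linear_sgr]] add.commute)
    have "mild.sol u (t + h) = mild.sol (\<lambda>s. sgr s (mild.sol u t) + (u (t + s) - sgr s (u t))) h"
      by (rule mild.sol_flow[OF _ t h]) measurable
    also have "\<dots> = mild.sol (\<lambda>s. sgr s (mild.sol u t) + noise (shifted t \<omega>) s) h"
    proof (rule mild.sol_cong_AE)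
      show "AE s in lborel. s \<ge> 0 \<longrightarrow> sgr s (mild.sol u t) + (u (t + s) - sgr s (u t)) = sgr s (mild.sol u t) + noise (shifted t \<omega>) s"
        using elim(2) by eventually_elim (simp add: u)
    qed (use elim(1) h u in \<open>simp_all, measurable\<close>)
    finally show ?case by (simp add: X_def flow_def u_def[abs_def])
  qed
qed

text \<open>The assumption on the filtration concerns the sigma-algebra generated by single
  increments. The path space carries the product sigma-algebra, so the whole family of shifted paths
  is measurable with respect to it.\<close>

lemma shifted_indep:
  assumes t: "t \<ge> 0"
  shows "indep_set (sets (\<F> t)) {shifted t -` B \<inter> space M | B. B \<in> sets (Pi\<^sub>M UNIV (\<lambda>_. path_space))}"
proof -
  define C where "C = {(\<lambda>\<omega>. Z n r \<omega> - Z n t \<omega>) -` B \<inter> space M | n r B. t \<le> r \<and> B \<in> sets borel}"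
  have ind: "indep_set (sets (\<F> t)) (sigma_sets (space M) C)"
    using driving[unfolded driving_stable_processes_def, THEN conjunct2, THEN conjunct2, THEN conjunct2, rule_format, OF t]
    unfolding C_def .
  have C: "C \<subseteq> Pow (space M)" unfolding C_def by blast
  have "shifted t \<in> sigma (space M) C \<rightarrow>\<^sub>M Pi\<^sub>M UNIV (\<lambda>_. path_space)"
  proof (rule shifted_measurable[OF t])
    fix n and r :: real assume r: "r \<ge> 0"
    show "(\<lambda>\<omega>. Z n (t + r) \<omega> - Z n t \<omega>) \<in> borel_measurable (sigma (space M) C)"
    proof (rule measurableI)
      fix B :: "real set" assume B: "B \<in> sets borel"
      have "t \<le> t + r" using r by simp
      then have "(\<lambda>\<omega>. Z n (t + r) \<omega> - Z n t \<omega>) -` B \<inter> space M \<in> C" using B unfolding C_def by blast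
      then show "(\<lambda>\<omega>. Z n (t + r) \<omega> - Z n t \<omega>) -` B \<inter> space (sigma (space M) C) \<in> sets (sigma (space M) C)"
        by (simp only: sets_measure_of[OF C] space_measure_of[OF C] sigma_sets.Basic)
    qed simp
  qed
  note meas = this
  let ?S = "{shifted t -` B \<inter> space M | B. B \<in> sets (Pi\<^sub>M UNIV (\<lambda>_. path_space))}"
  have sub: "?S \<subseteq> sigma_sets (space M) C"
  proof (rule subsetI)
    fix a assume "a \<in> ?S"
    then obtain B where "a = shifted t -` B \<inter> space M" "B \<in> sets (Pi\<^sub>M UNIV (\<lambda>_. path_space))" by blast
    then show "a \<in> sigma_sets (space M) C"
      using measurable_sets[OF meas, of B] by (simp only: sets_measure_of[OF C] space_measure_of[OF C])
  qed
  show ?thesis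
    unfolding indep_sets2_eq
  proof (intro conjI ballI)
    show "sets (\<F> t) \<subseteq> events" by (rule indep_setD_ev1[OF ind])
    show "?S \<subseteq> events" by (rule order_trans[OF sub indep_setD_ev2[OF ind]])
    show "prob (a \<inter> b) = prob a * prob b" if "a \<in> sets (\<F> t)" "b \<in> ?S" for a b
      by (rule indep_setD[OF ind that(1) subsetD[OF sub that(2)]])
  qed
qed

lemma markov: "markov_process M \<F> X"
  unfolding markov_process_def
proof (intro allI impI, elim conjE)
  fix x :: 'h and t h :: real and f :: "'h \<Rightarrow> real"
  assume t: "0 \<le> t" and h: "0 \<le> h" and f [measurable]: "f \<in> borel_measurable borel" and "bounded (range f)"
  then obtain B where B: "\<And>x. \<bar>f x\<bar> \<le> B" unfolding bounded_iff by auto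
  let ?N = "Pi\<^sub>M UNIV (\<lambda>_. path_space) :: (nat \<Rightarrow> real \<Rightarrow> real) measure"
  have g: "(\<lambda>p. f (flow h (fst p) (snd p))) \<in> borel_measurable (borel \<Otimes>\<^sub>M ?N)"
    using measurable_compose[OF flow_measurable f] .
  have "AE \<omega> in M. real_cond_exp M (\<F> t) (\<lambda>\<omega>. f (flow h (X x t \<omega>) (shifted t \<omega>))) \<omega>
      = (\<integral>z. f (flow h (X x t \<omega>) z) \<partial>distr M ?N (shifted t))"
    by (rule real_cond_exp_freezing[OF filtration_subalgebra[OF filt t] shifted_random[OF t]
          X_measurable[OF t] shifted_indep[OF t] g B])
  moreover have "AE \<omega> in M. real_cond_exp M (\<F> t) (\<lambda>\<omega>. f (X x (t + h) \<omega>)) \<omega>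
      = real_cond_exp M (\<F> t) (\<lambda>\<omega>. f (flow h (X x t \<omega>) (shifted t \<omega>))) \<omega>"
  proof -
    interpret finite_measure_subalgebra M "\<F> t" by unfold_locales (rule filtration_subalgebra[OF filt t])
    have "X x t \<in> borel_measurable M" by (rule X_random[OF t])
    from measurable_compose[OF measurable_Pair[OF this shifted_random[OF t]] g]
    have "(\<lambda>\<omega>. f (flow h (X x t \<omega>) (shifted t \<omega>))) \<in> borel_measurable M" by simp
    moreover have "(\<lambda>\<omega>. f (X x (t + h) \<omega>)) \<in> borel_measurable M"
      by (intro measurable_compose[OF X_random f] add_nonneg_nonneg t h)
    moreover have "AE \<omega> in M. f (X x (t + h) \<omega>) = f (flow h (X x t \<omega>) (shifted t \<omega>))"
      using X_flow_AE[OF t h, of x] by eventually_elim simp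
    ultimately show ?thesis by (intro real_cond_exp_cong)
  qed
  \<comment> \<open>The increments after \<open>t\<close> have the same law as those after 0, so the
    integral with the state frozen at \<open>y\<close> is the expectation for the solution started
    at \<open>y\<close>.\<close>
  moreover have "(\<integral>z. f (flow h y z) \<partial>distr M ?N (shifted t)) = transition_operator M X h f y" for y
  proof -
    have gy: "(\<lambda>z. f (flow h y z)) \<in> borel_measurable ?N"
    proof -
      have "(\<lambda>z. (y, z)) \<in> ?N \<rightarrow>\<^sub>M borel \<Otimes>\<^sub>M ?N" by measurable
      from measurable_compose[OF this g] show ?thesis by simp
    qed
    have "AE \<omega> in M. \<forall>n. Z n 0 \<omega> = 0" unfolding AE_all_countable using levy_zero[OF levy] by blast
    then have zero: "AE \<omega> in M. shifted 0 \<omega> = (\<lambda>n. \<lambda>r\<in>{0..}. Z n r \<omega>)"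
      by eventually_elim (auto simp: shifted_def fun_eq_iff)
    have "distr M ?N (shifted t) = distr M ?N (shifted 0)"
      using distr_driving_shift[OF driving t] distr_driving_shift[OF driving order_refl]
      unfolding shifted_def[abs_def] by simp
    then have "(\<integral>z. f (flow h y z) \<partial>distr M ?N (shifted t)) = (\<integral>\<omega>. f (flow h y (shifted 0 \<omega>)) \<partial>M)"
      using integral_distr[OF shifted_random[OF order_refl] gy] by simp
    also have "\<dots> = (\<integral>\<omega>. f (X y h \<omega>) \<partial>M)"
    proof (rule integral_cong_AE)
      show "AE \<omega> in M. f (flow h y (shifted 0 \<omega>)) = f (X y h \<omega>)"
        using \<open>AE \<omega> in M. \<forall>n. Z n 0 \<omega> = 0\<close> by eventually_elim (simp add: X_eq_flow)
      show "(\<lambda>\<omega>. f (flow h y (shifted 0 \<omega>))) \<in> borel_measurable M"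
        using measurable_compose[OF shifted_random[OF order_refl] gy] .
      show "(\<lambda>\<omega>. f (X y h \<omega>)) \<in> borel_measurable M" by (rule measurable_compose[OF X_random[OF h] f])
    qed
    finally show ?thesis by (simp add: transition_operator_def)
  qed
  ultimately show "AE \<omega> in M. real_cond_exp M (\<F> t) (\<lambda>\<omega>'. f (X x (t + h) \<omega>')) \<omega> = transition_operator M X h f (X x t \<omega>)"
    by (auto elim: eventually_elim2)
qed

end

theorem theorem5p4:
  fixes M :: "'w measure" and \<F> :: "real \<Rightarrow> 'w measure"
    and e :: "nat \<Rightarrow> 'h::{real_inner, banach, second_countable_topology}"
    and \<alpha> :: real and \<beta> \<gamma> :: "nat \<Rightarrow> real"
    and Z :: "nat \<Rightarrow> real \<Rightarrow> 'w \<Rightarrow> real"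
    and D :: "'h set" and A F :: "'h \<Rightarrow> 'h"
  assumes "orthonormal_basis e"
    and "0 < \<alpha>" and "\<alpha> < 2"
    and "prob_space M"
    and "usual_filtration M \<F>"
    and "driving_stable_processes M \<F> \<alpha> Z"
    and "\<And>n. \<beta> n > 0"
    and "self_adjoint_operator D A"
    and "\<And>n. e n \<in> D" and "\<And>n. A (e n) = - \<gamma> n *\<^sub>R e n"
    and "\<And>n. \<gamma> n > 0" and "filterlim \<gamma> at_top sequentially"
    and "summable (\<lambda>n. \<beta> n powr \<alpha> / \<gamma> n)"
    and "\<exists>L. L-lipschitz_on UNIV F" and "bounded (range F)"
  shows "\<exists>X. (\<forall>x. mild_solution M \<F> e \<beta> \<gamma> Z D A F x (X x)) \<and>
             (\<forall>x Y. mild_solution M \<F> e \<beta> \<gamma> Z D A F x Y \<longrightarrow>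
                (\<forall>t\<ge>0. AE \<omega> in M. Y t \<omega> = X x t \<omega>)) \<and>
             markov_process M \<F> X \<and> feller_process M X"
proof -
  obtain L where L: "L-lipschitz_on UNIV F" using assms(14) ..
  obtain K where K: "\<And>x. norm (F x) \<le> K" using assms(15) unfolding bounded_iff by auto
  interpret prob_space M by fact
  interpret stable_driven_equation M e \<gamma> \<F> \<alpha> \<beta> Z D A F L K
  proof unfold_locales
    show "norm (F x - F y) \<le> L * norm (x - y)" for x y
      using lipschitz_onD[OF L UNIV_I UNIV_I] by (simp add: dist_norm)
    show "\<alpha> \<le> 2" using assms(3) by simp
  qed (rule assms K lipschitz_on_nonneg[OF L])+
  show ?thesis
    using mild_solution_X mild_solution_unique markov feller by blast
qed

end
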